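(* Let $(\mathcal{B},\mathcal{A},e,i,l)$ be a cleft extension of abelian categories which is compatible, and let $X\in\mathcal{A}$. Consider the following conditions: (1) $X$ is Gorenstein projective in $\mathcal{A}$; (2) $q(X)$ is Gorenstein projective in $\mathcal{B}$ and $q(u_X)$ is a monomorphism; (3) $q(X)$ is Gorenstein projective in $\mathcal{B}$ and the sequence $F^2e(X)\xrightarrow{\alpha_X}Fe(X)\xrightarrow{\beta_X}e(X)$ is exact. Then (1) $\Rightarrow$ (2) $\Leftrightarrow$ (3). Moreover, all three conditions are equivalent if the natural transformation $\eta:F^2\to F$ given at $Y\in\mathcal{B}$ by the composition $$F^2(Y)\xrightarrow{\nu_{F(Y)}}elF(Y)\xrightarrow{el(\nu_Y)}elel(Y)\xrightarrow{e(\lambda_{l(Y)})}el(Y)\xrightarrow{\nu'_Y}F(Y)$$ is zero.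
   Context: Gorenstein projectives. For an abelian category $\mathcal{C}$, $\mathrm{Proj}\,\mathcal{C}$ is the full subcategory of projective objects. A complete $\mathcal{C}$-projective resolution is an exact complex $P^\bullet=\cdots\to P^{-1}\xrightarrow{d^{-1}}P^0\xrightarrow{d^0}P^1\to\cdots$ with all $P^i\in\mathrm{Proj}\,\mathcal{C}$ such that $\mathrm{Hom}_{\mathcal{C}}(P^\bullet,Q)$ is exact for every $Q\in\mathrm{Proj}\,\mathcal{C}$. An object is Gorenstein projective if it is $\mathrm{Im}(d^0)$ for some complete $\mathcal{C}$-projective resolution. Cleft extensions. A cleft extension $(\mathcal{B},\mathcal{A},e,i,l)$ of an abelian category $\mathcal{B}$ is an abelian category $\mathcal{A}$ together with functors $i:\mathcal{B}\to\mathcal{A}$, $e:\mathcal{A}\to\mathcal{B}$, $l:\mathcal{B}\to\mathcal{A}$ such that $e$ is faithful exact, $l$ is left adjoint to $e$, and there is a natural isomorphism $ei\cong\mathrm{Id}_{\mathcal{B}}$. It is known that then $i$ is fully faithful and exact and has a left adjoint $q:\mathcal{A}\to\mathcal{B}$, and $ql\cong\mathrm{Id}_{\mathcal{B}}$. Let $\lambda:le\to\mathrm{Id}_{\mathcal{A}}$ be the counit of $(l,e)$ (an epimorphism), and $u:G\to le$ its kernel, so that there is a short exact sequence of functors $0\to G\xrightarrow{u}le\xrightarrow{\lambda}\mathrm{Id}_{\mathcal{A}}\to0$. Put $F=eGi:\mathcal{B}\to\mathcal{B}$. Applying $e(-)i$ to this sequence and using $ei\cong\mathrm{Id}_{\mathcal{B}}$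 gives a short exact sequence $0\to F\xrightarrow{\nu}el\to\mathrm{Id}_{\mathcal{B}}\to0$, which splits naturally; $\nu':el\to F$ is a corresponding natural retraction, $\nu'\nu=\mathrm{id}_F$. One has $F^ne\cong eG^n$ for all $n\ge1$. $F^j$ is the $j$-fold composite; $F$ is nilpotent if $F^s=0$ for some $s$. $\mathbb{L}_i$ denotes the $i$-th left derived functor; the categories are assumed to have enough projectives. The maps $\alpha_X,\beta_X$. For $X\in\mathcal{A}$, apply $q$ to the maps $leG^2(X)\xrightarrow{u_{G(X)}\circ\lambda_{G^2(X)}}leG(X)\xrightarrow{u_X\circ\lambda_{G(X)}}le(X)$ and identify $qleG^n(X)\cong eG^n(X)\cong F^ne(X)$ and $qle(X)\cong e(X)$. The resulting maps are $\alpha_X=q(u_{G(X)})\circ q(\lambda_{G^2(X)}):F^2e(X)\to Fe(X)$ and $\beta_X=q(u_X)\circ q(\lambda_{G(X)}):Fe(X)\to e(X)$. Compatible. The cleft extension is compatible if both of the following hold. (C1) For any complete $\mathcal{B}$-projective resolution $P^\bullet$ and any $P'\in\mathrm{Proj}\,\mathcal{B}$, the complexes $F(P^\bullet)$ and $\mathrm{Hom}_{\mathcal{B}}(P^\bullet,F(P'))$ are acyclic. (C2) At least one of the following holds: (i) for any complete $\mathcal{A}$-projective resolution $Q^\bullet$ and any $P\in\mathrm{Proj}\,\mathcal{B}$, the complexes $q(Q^\bullet)$ and $\mathrm{Hom}_{\mathcal{A}}(Q^\bullet,i(P))$ are acyclic; (ii) $F$ is nilpotent, $\mathbb{L}_iF^j(F(P))=0$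 for all $i,j>0$ and $P\in\mathrm{Proj}\,\mathcal{B}$, and for any complete $\mathcal{A}$-projective resolution $Q^\bullet$, any $P\in\mathrm{Proj}\,\mathcal{B}$ and any $j>0$, the complexes $F^j(eQ^\bullet)$ and $\mathrm{Hom}_{\mathcal{A}}(Q^\bullet,lF^j(P))$ are acyclic. *)

theory Defs
  imports "HOL-Algebra.Coset"
begin

section \<open>Abelian categories\<close>

record ('o, 'm) catg =
  Ob :: "'o set"
  Arr :: "'m set"
  Dom :: "'m \<Rightarrow> 'o"
  Cod :: "'m \<Rightarrow> 'o"
  Idt :: "'o \<Rightarrow> 'm"
  Cmp :: "'m \<Rightarrow> 'm \<Rightarrow> 'm"  (infixl \<open>\<cdot>\<index>\<close> 70)
  Add :: "'m \<Rightarrow> 'm \<Rightarrow> 'm"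
  Zro :: "'o \<Rightarrow> 'o \<Rightarrow> 'm"

text \<open>Composition is written in the order of application: \<open>g \<cdot> f\<close> means \<open>g\<close> after \<open>f\<close>.
  \<open>Add\<close> and \<open>Zro\<close> are the addition and the zero morphisms of a preadditive structure.\<close>

definition Hom :: "('o, 'm) catg \<Rightarrow> 'o \<Rightarrow> 'o \<Rightarrow> 'm set" where
  "Hom C X Y = {f \<in> Arr C. Dom C f = X \<and> Cod C f = Y}"

definition hom_group :: "('o, 'm) catg \<Rightarrow> 'o \<Rightarrow> 'o \<Rightarrow> 'm monoid" where
  "hom_group C X Y = \<lparr>carrier = Hom C X Y, monoid.mult = Add C, one = Zro C X Y\<rparr>"

locale cat =
  fixes C :: "('o, 'm) catg" (structure)
  assumes dom_ob: "f \<in> Arr C \<Longrightarrow> Dom C f \<in> Ob C"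
    and cod_ob: "f \<in> Arr C \<Longrightarrow> Cod C f \<in> Ob C"
    and idt_hom: "X \<in> Ob C \<Longrightarrow> Idt C X \<in> Hom C X X"
    and cmp_hom: "\<lbrakk>f \<in> Hom C X Y; g \<in> Hom C Y Z\<rbrakk> \<Longrightarrow> g \<cdot> f \<in> Hom C X Z"
    and idt_left: "f \<in> Hom C X Y \<Longrightarrow> Idt C Y \<cdot> f = f"
    and idt_right: "f \<in> Hom C X Y \<Longrightarrow> f \<cdot> Idt C X = f"
    and cmp_assoc: "\<lbrakk>f \<in> Hom C W X; g \<in> Hom C X Y; h \<in> Hom C Y Z\<rbrakk>
      \<Longrightarrow> (h \<cdot> g) \<cdot> f = h \<cdot> (g \<cdot> f)"

locale preadditive_cat = cat +
  assumes hom_comm_group: "\<lbrakk>X \<in> Ob C; Y \<in> Ob C\<rbrakk> \<Longrightarrow> comm_group (hom_group C X Y)"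
    and cmp_add_left: "\<lbrakk>f \<in> Hom C X Y; g \<in> Hom C Y Z; h \<in> Hom C Y Z\<rbrakk>
      \<Longrightarrow> Add C g h \<cdot> f = Add C (g \<cdot> f) (h \<cdot> f)"
    and cmp_add_right: "\<lbrakk>f \<in> Hom C X Y; g \<in> Hom C X Y; h \<in> Hom C Y Z\<rbrakk>
      \<Longrightarrow> h \<cdot> Add C f g = Add C (h \<cdot> f) (h \<cdot> g)"

definition is_mono :: "('o, 'm) catg \<Rightarrow> 'm \<Rightarrow> bool" where
  "is_mono C f \<longleftrightarrow> f \<in> Arr C \<and>
     (\<forall>W. \<forall>g \<in> Hom C W (Dom C f). \<forall>h \<in> Hom C W (Dom C f).
        f \<cdot>\<^bsub>C\<^esub> g = f \<cdot>\<^bsub>C\<^esub> h \<longrightarrow> g = h)"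

definition is_epi :: "('o, 'm) catg \<Rightarrow> 'm \<Rightarrow> bool" where
  "is_epi C f \<longleftrightarrow> f \<in> Arr C \<and>
     (\<forall>Z. \<forall>g \<in> Hom C (Cod C f) Z. \<forall>h \<in> Hom C (Cod C f) Z.
        g \<cdot>\<^bsub>C\<^esub> f = h \<cdot>\<^bsub>C\<^esub> f \<longrightarrow> g = h)"

definition inverse_arrows :: "('o, 'm) catg \<Rightarrow> 'm \<Rightarrow> 'm \<Rightarrow> bool" where
  "inverse_arrows C f g \<longleftrightarrow> f \<in> Arr C \<and> g \<in> Hom C (Cod C f) (Dom C f) \<and>
     g \<cdot>\<^bsub>C\<^esub> f = Idt C (Dom C f) \<and> f \<cdot>\<^bsub>C\<^esub> g = Idt C (Cod C f)"

definition is_iso_arr :: "('o, 'm) catg \<Rightarrow> 'm \<Rightarrow> bool" where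
  "is_iso_arr C f \<longleftrightarrow> (\<exists>g. inverse_arrows C f g)"

definition inv_arr :: "('o, 'm) catg \<Rightarrow> 'm \<Rightarrow> 'm" where
  "inv_arr C f = (THE g. inverse_arrows C f g)"

definition zero_object :: "('o, 'm) catg \<Rightarrow> 'o \<Rightarrow> bool" where
  "zero_object C Z \<longleftrightarrow> Z \<in> Ob C \<and>
     (\<forall>X \<in> Ob C. (\<exists>!f. f \<in> Hom C X Z) \<and> (\<exists>!f. f \<in> Hom C Z X))"

definition is_product :: "('o, 'm) catg \<Rightarrow> 'o \<Rightarrow> 'o \<Rightarrow> 'o \<Rightarrow> 'm \<Rightarrow> 'm \<Rightarrow> bool" where
  "is_product C X Y P p1 p2 \<longleftrightarrow> p1 \<in> Hom C P X \<and> p2 \<in> Hom C P Y \<and>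
     (\<forall>W. \<forall>f \<in> Hom C W X. \<forall>g \<in> Hom C W Y.
        \<exists>!h. h \<in> Hom C W P \<and> p1 \<cdot>\<^bsub>C\<^esub> h = f \<and> p2 \<cdot>\<^bsub>C\<^esub> h = g)"

definition is_kernel :: "('o, 'm) catg \<Rightarrow> 'm \<Rightarrow> 'm \<Rightarrow> bool" where
  "is_kernel C k f \<longleftrightarrow> k \<in> Arr C \<and> f \<in> Arr C \<and> Cod C k = Dom C f \<and>
     f \<cdot>\<^bsub>C\<^esub> k = Zro C (Dom C k) (Cod C f) \<and>
     (\<forall>W. \<forall>g \<in> Hom C W (Dom C f). f \<cdot>\<^bsub>C\<^esub> g = Zro C W (Cod C f) \<longrightarrow>
        (\<exists>!h. h \<in> Hom C W (Dom C k) \<and> k \<cdot>\<^bsub>C\<^esub> h = g))"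

definition is_cokernel :: "('o, 'm) catg \<Rightarrow> 'm \<Rightarrow> 'm \<Rightarrow> bool" where
  "is_cokernel C c f \<longleftrightarrow> c \<in> Arr C \<and> f \<in> Arr C \<and> Dom C c = Cod C f \<and>
     c \<cdot>\<^bsub>C\<^esub> f = Zro C (Dom C f) (Cod C c) \<and>
     (\<forall>Z. \<forall>g \<in> Hom C (Cod C f) Z. g \<cdot>\<^bsub>C\<^esub> f = Zro C (Dom C f) Z \<longrightarrow>
        (\<exists>!h. h \<in> Hom C (Cod C c) Z \<and> h \<cdot>\<^bsub>C\<^esub> c = g))"

locale abelian_cat = preadditive_cat +
  assumes ex_zero_object: "\<exists>Z. zero_object C Z"
    and ex_product: "\<lbrakk>X \<in> Ob C; Y \<in> Ob C\<rbrakk> \<Longrightarrow> \<exists>P p1 p2. is_product C X Y P p1 p2"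
    and ex_kernel: "f \<in> Arr C \<Longrightarrow> \<exists>k. is_kernel C k f"
    and ex_cokernel: "f \<in> Arr C \<Longrightarrow> \<exists>c. is_cokernel C c f"
    and mono_is_kernel: "is_mono C f \<Longrightarrow> \<exists>g. is_kernel C f g"
    and epi_is_cokernel: "is_epi C f \<Longrightarrow> \<exists>g. is_cokernel C f g"


section \<open>Exactness, homology and projective objects\<close>

text \<open>\<open>f = m \<cdot> p\<close> is a factorization through the image of \<open>f\<close>; the image object is
  \<open>Cod C p = Dom C m\<close>.\<close>

definition is_image :: "('o, 'm) catg \<Rightarrow> 'm \<Rightarrow> 'm \<Rightarrow> 'm \<Rightarrow> bool" where
  "is_image C f p m \<longleftrightarrow> f \<in> Arr C \<and> is_epi C p \<and> is_mono C m \<and>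
     Dom C p = Dom C f \<and> Cod C p = Dom C m \<and> Cod C m = Cod C f \<and> f = m \<cdot>\<^bsub>C\<^esub> p"

definition exact_at :: "('o, 'm) catg \<Rightarrow> 'm \<Rightarrow> 'm \<Rightarrow> bool" where
  "exact_at C f g \<longleftrightarrow> (\<exists>p m. is_image C f p m \<and> is_kernel C m g)"

definition short_exact :: "('o, 'm) catg \<Rightarrow> 'm \<Rightarrow> 'm \<Rightarrow> bool" where
  "short_exact C f g \<longleftrightarrow> is_mono C f \<and> exact_at C f g \<and> is_epi C g"

text \<open>\<open>H\<close> is the homology at the middle term of \<open>\<midarrow>f\<rightarrow> \<midarrow>g\<rightarrow>\<close>: the cokernel of the map into
  \<open>ker g\<close> induced by \<open>f\<close>.\<close>

definition is_homology :: "('o, 'm) catg \<Rightarrow> 'm \<Rightarrow> 'm \<Rightarrow> 'o \<Rightarrow> bool" where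
  "is_homology C f g H \<longleftrightarrow> (\<exists>k f' c. is_kernel C k g \<and> f' \<in> Hom C (Dom C f) (Dom C k) \<and>
     k \<cdot>\<^bsub>C\<^esub> f' = f \<and> is_cokernel C c f' \<and> Cod C c = H)"

definition exact_complex :: "('o, 'm) catg \<Rightarrow> (int \<Rightarrow> 'o) \<Rightarrow> (int \<Rightarrow> 'm) \<Rightarrow> bool" where
  "exact_complex C P d \<longleftrightarrow>
     (\<forall>n. P n \<in> Ob C \<and> d n \<in> Hom C (P n) (P (n + 1)) \<and> exact_at C (d (n - 1)) (d n))"

text \<open>Exactness of the complex of abelian groups
  \<open>Hom (P (n + 1)) Q \<rightarrow> Hom (P n) Q \<rightarrow> Hom (P (n - 1)) Q\<close> at every \<open>n\<close>.\<close>

definition hom_exact :: "('o, 'm) catg \<Rightarrow> (int \<Rightarrow> 'o) \<Rightarrow> (int \<Rightarrow> 'm) \<Rightarrow> 'o \<Rightarrow> bool" where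
  "hom_exact C P d Q \<longleftrightarrow>
     (\<forall>n. kernel (hom_group C (P n) Q) (hom_group C (P (n - 1)) Q) (\<lambda>f. f \<cdot>\<^bsub>C\<^esub> d (n - 1)) =
          (\<lambda>g. g \<cdot>\<^bsub>C\<^esub> d n) ` Hom C (P (n + 1)) Q)"

definition Proj :: "('o, 'm) catg \<Rightarrow> 'o set" where
  "Proj C = {P \<in> Ob C. \<forall>g f. is_epi C g \<and> f \<in> Hom C P (Cod C g) \<longrightarrow>
     (\<exists>h \<in> Hom C P (Dom C g). g \<cdot>\<^bsub>C\<^esub> h = f)}"

definition enough_projectives :: "('o, 'm) catg \<Rightarrow> bool" where
  "enough_projectives C \<longleftrightarrow> (\<forall>X \<in> Ob C. \<exists>P \<in> Proj C. \<exists>p \<in> Hom C P X. is_epi C p)"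

definition complete_resolution :: "('o, 'm) catg \<Rightarrow> (int \<Rightarrow> 'o) \<Rightarrow> (int \<Rightarrow> 'm) \<Rightarrow> bool" where
  "complete_resolution C P d \<longleftrightarrow> exact_complex C P d \<and> (\<forall>n. P n \<in> Proj C) \<and>
     (\<forall>Q \<in> Proj C. hom_exact C P d Q)"

definition Gorenstein_projective :: "('o, 'm) catg \<Rightarrow> 'o \<Rightarrow> bool" where
  "Gorenstein_projective C X \<longleftrightarrow>
     (\<exists>P d p m. complete_resolution C P d \<and> is_image C (d 0) p m \<and> Cod C p = X)"


section \<open>Functors and natural transformations\<close>

record ('o1, 'm1, 'o2, 'm2) ftor =
  fob :: "'o1 \<Rightarrow> 'o2"
  far :: "'m1 \<Rightarrow> 'm2"

definition is_functor ::
  "('o1, 'm1) catg \<Rightarrow> ('o2, 'm2) catg \<Rightarrow> ('o1, 'm1, 'o2, 'm2) ftor \<Rightarrow> bool" where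
  "is_functor C D T \<longleftrightarrow>
     (\<forall>X \<in> Ob C. fob T X \<in> Ob D \<and> far T (Idt C X) = Idt D (fob T X)) \<and>
     (\<forall>X Y. \<forall>f \<in> Hom C X Y. far T f \<in> Hom D (fob T X) (fob T Y)) \<and>
     (\<forall>X Y Z. \<forall>f \<in> Hom C X Y. \<forall>g \<in> Hom C Y Z.
        far T (g \<cdot>\<^bsub>C\<^esub> f) = far T g \<cdot>\<^bsub>D\<^esub> far T f)"

definition additive_functor ::
  "('o1, 'm1) catg \<Rightarrow> ('o2, 'm2) catg \<Rightarrow> ('o1, 'm1, 'o2, 'm2) ftor \<Rightarrow> bool" where
  "additive_functor C D T \<longleftrightarrow> is_functor C D T \<and>
     (\<forall>X Y. \<forall>f \<in> Hom C X Y. \<forall>g \<in> Hom C X Y. far T (Add C f g) = Add D (far T f) (far T g))"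

definition exact_functor ::
  "('o1, 'm1) catg \<Rightarrow> ('o2, 'm2) catg \<Rightarrow> ('o1, 'm1, 'o2, 'm2) ftor \<Rightarrow> bool" where
  "exact_functor C D T \<longleftrightarrow> additive_functor C D T \<and>
     (\<forall>f g. short_exact C f g \<longrightarrow> short_exact D (far T f) (far T g))"

definition faithful_functor ::
  "('o1, 'm1) catg \<Rightarrow> ('o2, 'm2) catg \<Rightarrow> ('o1, 'm1, 'o2, 'm2) ftor \<Rightarrow> bool" where
  "faithful_functor C D T \<longleftrightarrow> is_functor C D T \<and>
     (\<forall>X \<in> Ob C. \<forall>Y \<in> Ob C. inj_on (far T) (Hom C X Y))"

definition id_ftor :: "('o, 'm, 'o, 'm) ftor" where
  "id_ftor = \<lparr>fob = id, far = id\<rparr>"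

definition comp_ftor :: "('o2, 'm2, 'o3, 'm3) ftor \<Rightarrow> ('o1, 'm1, 'o2, 'm2) ftor \<Rightarrow>
    ('o1, 'm1, 'o3, 'm3) ftor"  (infixl \<open>\<circ>\<^sub>F\<close> 75) where
  "S \<circ>\<^sub>F T = \<lparr>fob = fob S \<circ> fob T, far = far S \<circ> far T\<rparr>"

primrec pow_ftor :: "('o, 'm, 'o, 'm) ftor \<Rightarrow> nat \<Rightarrow> ('o, 'm, 'o, 'm) ftor" where
  "pow_ftor T 0 = id_ftor"
| "pow_ftor T (Suc n) = T \<circ>\<^sub>F pow_ftor T n"

definition nat_trans :: "('o1, 'm1) catg \<Rightarrow> ('o2, 'm2) catg \<Rightarrow> ('o1, 'm1, 'o2, 'm2) ftor \<Rightarrow>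
    ('o1, 'm1, 'o2, 'm2) ftor \<Rightarrow> ('o1 \<Rightarrow> 'm2) \<Rightarrow> bool" where
  "nat_trans C D S T \<tau> \<longleftrightarrow> is_functor C D S \<and> is_functor C D T \<and>
     (\<forall>X \<in> Ob C. \<tau> X \<in> Hom D (fob S X) (fob T X)) \<and>
     (\<forall>X Y. \<forall>f \<in> Hom C X Y. \<tau> Y \<cdot>\<^bsub>D\<^esub> far S f = far T f \<cdot>\<^bsub>D\<^esub> \<tau> X)"

definition nat_iso :: "('o1, 'm1) catg \<Rightarrow> ('o2, 'm2) catg \<Rightarrow> ('o1, 'm1, 'o2, 'm2) ftor \<Rightarrow>
    ('o1, 'm1, 'o2, 'm2) ftor \<Rightarrow> ('o1 \<Rightarrow> 'm2) \<Rightarrow> bool" where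
  "nat_iso C D S T \<tau> \<longleftrightarrow> nat_trans C D S T \<tau> \<and> (\<forall>X \<in> Ob C. is_iso_arr D (\<tau> X))"

text \<open>\<open>L : C \<rightarrow> D\<close> is left adjoint to \<open>R : D \<rightarrow> C\<close>, with unit \<open>\<sigma> : Id \<rightarrow> R L\<close> and
  counit \<open>\<tau> : L R \<rightarrow> Id\<close>.\<close>

definition adjunction :: "('o1, 'm1) catg \<Rightarrow> ('o2, 'm2) catg \<Rightarrow> ('o1, 'm1, 'o2, 'm2) ftor \<Rightarrow>
    ('o2, 'm2, 'o1, 'm1) ftor \<Rightarrow> ('o1 \<Rightarrow> 'm1) \<Rightarrow> ('o2 \<Rightarrow> 'm2) \<Rightarrow> bool" where
  "adjunction C D L R \<sigma> \<tau> \<longleftrightarrow> is_functor C D L \<and> is_functor D C R \<and>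
     nat_trans C C id_ftor (R \<circ>\<^sub>F L) \<sigma> \<and> nat_trans D D (L \<circ>\<^sub>F R) id_ftor \<tau> \<and>
     (\<forall>X \<in> Ob C. \<tau> (fob L X) \<cdot>\<^bsub>D\<^esub> far L (\<sigma> X) = Idt D (fob L X)) \<and>
     (\<forall>Y \<in> Ob D. far R (\<tau> Y) \<cdot>\<^bsub>C\<^esub> \<sigma> (fob R Y) = Idt C (fob R Y))"

definition zero_functor ::
  "('o1, 'm1) catg \<Rightarrow> ('o2, 'm2) catg \<Rightarrow> ('o1, 'm1, 'o2, 'm2) ftor \<Rightarrow> bool" where
  "zero_functor C D T \<longleftrightarrow> is_functor C D T \<and> (\<forall>X \<in> Ob C. zero_object D (fob T X))"

definition nilpotent_functor :: "('o, 'm) catg \<Rightarrow> ('o, 'm, 'o, 'm) ftor \<Rightarrow> bool" where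
  "nilpotent_functor C T \<longleftrightarrow> (\<exists>s. zero_functor C C (pow_ftor T s))"


section \<open>Left derived functors\<close>

text \<open>A projective resolution \<open>\<dots> \<rightarrow> P 2 \<midarrow>d 1\<rightarrow> P 1 \<midarrow>d 0\<rightarrow> P 0 \<midarrow>a\<rightarrow> M \<rightarrow> 0\<close>.\<close>

definition projective_resolution ::
  "('o, 'm) catg \<Rightarrow> 'o \<Rightarrow> (nat \<Rightarrow> 'o) \<Rightarrow> (nat \<Rightarrow> 'm) \<Rightarrow> 'm \<Rightarrow> bool" where
  "projective_resolution C M P d a \<longleftrightarrow>
     (\<forall>n. P n \<in> Proj C \<and> d n \<in> Hom C (P (Suc n)) (P n)) \<and>
     a \<in> Hom C (P 0) M \<and> is_epi C a \<and> exact_at C (d 0) a \<and>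
     (\<forall>n. exact_at C (d (Suc n)) (d n))"

text \<open>\<open>H\<close> is a value of the \<open>n\<close>-th left derived functor of \<open>T\<close> at \<open>M\<close>, computed from some
  projective resolution.\<close>

definition is_left_derived :: "('o1, 'm1) catg \<Rightarrow> ('o2, 'm2) catg \<Rightarrow>
    ('o1, 'm1, 'o2, 'm2) ftor \<Rightarrow> nat \<Rightarrow> 'o1 \<Rightarrow> 'o2 \<Rightarrow> bool" where
  "is_left_derived C D T n M H \<longleftrightarrow> (\<exists>P d a. projective_resolution C M P d a \<and>
     (case n of
        0 \<Rightarrow> \<exists>c. is_cokernel D c (far T (d 0)) \<and> Cod D c = H
      | Suc k \<Rightarrow> is_homology D (far T (d n)) (far T (d k)) H))"

definition left_derived_zero :: "('o1, 'm1) catg \<Rightarrow> ('o2, 'm2) catg \<Rightarrow>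
    ('o1, 'm1, 'o2, 'm2) ftor \<Rightarrow> nat \<Rightarrow> 'o1 \<Rightarrow> bool" where
  "left_derived_zero C D T n M \<longleftrightarrow> (\<forall>H. is_left_derived C D T n M H \<longrightarrow> zero_object D H)"


section \<open>Cleft extensions\<close>

text \<open>The adjunction \<open>(l, e)\<close> is given by its unit \<open>\<sigma>\<close> and counit \<open>lam\<close>, and
  \<open>\<rho> : e i \<rightarrow> Id\<close> is the chosen natural isomorphism.\<close>

locale cleft_extension =
  fixes B :: "('ob, 'mb) catg" and A :: "('oa, 'ma) catg"
    and e :: "('oa, 'ma, 'ob, 'mb) ftor"
    and i :: "('ob, 'mb, 'oa, 'ma) ftor"
    and l :: "('ob, 'mb, 'oa, 'ma) ftor"
    and \<sigma> :: "'ob \<Rightarrow> 'mb" and lam :: "'oa \<Rightarrow> 'ma" and \<rho> :: "'ob \<Rightarrow> 'mb"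
  assumes abelian_B: "abelian_cat B"
    and abelian_A: "abelian_cat A"
    and functor_i: "is_functor B A i"
    and faithful_e: "faithful_functor A B e"
    and exact_e: "exact_functor A B e"
    and adjunction_l_e: "adjunction B A l e \<sigma> lam"
    and iso_e_i: "nat_iso B B (e \<circ>\<^sub>F i) id_ftor \<rho>"

definition kernel_of_counit :: "('oa, 'ma) catg \<Rightarrow> ('oa, 'ma, 'ob, 'mb) ftor \<Rightarrow>
    ('ob, 'mb, 'oa, 'ma) ftor \<Rightarrow> ('oa \<Rightarrow> 'ma) \<Rightarrow> ('oa, 'ma, 'oa, 'ma) ftor \<Rightarrow>
    ('oa \<Rightarrow> 'ma) \<Rightarrow> bool" where
  "kernel_of_counit A e l lam G u \<longleftrightarrow> nat_trans A A G (l \<circ>\<^sub>F e) u \<and>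
     (\<forall>X \<in> Ob A. is_kernel A (u X) (lam X))"

abbreviation cleft_F :: "('oa, 'ma, 'ob, 'mb) ftor \<Rightarrow> ('ob, 'mb, 'oa, 'ma) ftor \<Rightarrow>
    ('oa, 'ma, 'oa, 'ma) ftor \<Rightarrow> ('ob, 'mb, 'ob, 'mb) ftor" where
  "cleft_F e i G \<equiv> e \<circ>\<^sub>F G \<circ>\<^sub>F i"

text \<open>\<open>\<nu>\<close> is \<open>e(u\<^bsub>i(Y)\<^esub>) : F(Y) \<rightarrow> e l e i(Y)\<close> followed by the identification
  \<open>e l e i(Y) \<cong> e l(Y)\<close>.\<close>

definition cleft_nu :: "('ob, 'mb) catg \<Rightarrow> ('oa, 'ma, 'ob, 'mb) ftor \<Rightarrow>
    ('ob, 'mb, 'oa, 'ma) ftor \<Rightarrow> ('ob, 'mb, 'oa, 'ma) ftor \<Rightarrow> ('ob \<Rightarrow> 'mb) \<Rightarrow>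
    ('oa \<Rightarrow> 'ma) \<Rightarrow> 'ob \<Rightarrow> 'mb" where
  "cleft_nu B e i l \<rho> u Y = far (e \<circ>\<^sub>F l) (\<rho> Y) \<cdot>\<^bsub>B\<^esub> far e (u (fob i Y))"

definition natural_retraction :: "('o, 'm) catg \<Rightarrow> ('o, 'm, 'o, 'm) ftor \<Rightarrow>
    ('o, 'm, 'o, 'm) ftor \<Rightarrow> ('o \<Rightarrow> 'm) \<Rightarrow> ('o \<Rightarrow> 'm) \<Rightarrow> bool" where
  "natural_retraction C S T \<tau> \<tau>' \<longleftrightarrow> nat_trans C C T S \<tau>' \<and>
     (\<forall>Y \<in> Ob C. \<tau>' Y \<cdot>\<^bsub>C\<^esub> \<tau> Y = Idt C (fob S Y))"

definition cleft_eta :: "('ob, 'mb) catg \<Rightarrow> ('oa, 'ma, 'ob, 'mb) ftor \<Rightarrow>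
    ('ob, 'mb, 'oa, 'ma) ftor \<Rightarrow> ('ob, 'mb, 'oa, 'ma) ftor \<Rightarrow> ('oa \<Rightarrow> 'ma) \<Rightarrow>
    ('ob \<Rightarrow> 'mb) \<Rightarrow> ('oa, 'ma, 'oa, 'ma) ftor \<Rightarrow> ('oa \<Rightarrow> 'ma) \<Rightarrow> ('ob \<Rightarrow> 'mb) \<Rightarrow>
    'ob \<Rightarrow> 'mb" where
  "cleft_eta B e i l lam \<rho> G u \<nu>' Y =
     \<nu>' Y \<cdot>\<^bsub>B\<^esub> (far e (lam (fob l Y)) \<cdot>\<^bsub>B\<^esub>
       (far (e \<circ>\<^sub>F l) (cleft_nu B e i l \<rho> u Y) \<cdot>\<^bsub>B\<^esub>
          cleft_nu B e i l \<rho> u (fob (cleft_F e i G) Y)))"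

text \<open>Identifications used in \<open>\<alpha>\<close> and \<open>\<beta>\<close>: \<open>\<kappa> : q l \<cong> Id\<close>, \<open>\<phi>1 : e G \<cong> F e\<close> and
  \<open>\<phi>2 : e G\<^sup>2 \<cong> F\<^sup>2 e\<close>. Any choice is allowed; since the same identification of the middle term
  enters both maps, exactness of \<open>\<alpha>, \<beta>\<close> does not depend on it.\<close>

definition identifications :: "('ob, 'mb) catg \<Rightarrow> ('oa, 'ma) catg \<Rightarrow>
    ('oa, 'ma, 'ob, 'mb) ftor \<Rightarrow> ('ob, 'mb, 'oa, 'ma) ftor \<Rightarrow> ('ob, 'mb, 'oa, 'ma) ftor \<Rightarrow>
    ('oa, 'ma, 'oa, 'ma) ftor \<Rightarrow> ('oa, 'ma, 'ob, 'mb) ftor \<Rightarrow>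
    ('ob \<Rightarrow> 'mb) \<Rightarrow> ('oa \<Rightarrow> 'mb) \<Rightarrow> ('oa \<Rightarrow> 'mb) \<Rightarrow> bool" where
  "identifications B A e i l G q \<kappa> \<phi>1 \<phi>2 \<longleftrightarrow>
     nat_iso B B (q \<circ>\<^sub>F l) id_ftor \<kappa> \<and>
     nat_iso A B (e \<circ>\<^sub>F G) (cleft_F e i G \<circ>\<^sub>F e) \<phi>1 \<and>
     nat_iso A B (e \<circ>\<^sub>F pow_ftor G 2) (pow_ftor (cleft_F e i G) 2 \<circ>\<^sub>F e) \<phi>2"

definition alpha :: "('ob, 'mb) catg \<Rightarrow> ('oa, 'ma, 'ob, 'mb) ftor \<Rightarrow>
    ('oa \<Rightarrow> 'ma) \<Rightarrow> ('oa, 'ma, 'oa, 'ma) ftor \<Rightarrow> ('oa \<Rightarrow> 'ma) \<Rightarrow>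
    ('oa, 'ma, 'ob, 'mb) ftor \<Rightarrow> ('ob \<Rightarrow> 'mb) \<Rightarrow> ('oa \<Rightarrow> 'mb) \<Rightarrow> ('oa \<Rightarrow> 'mb) \<Rightarrow>
    'oa \<Rightarrow> 'mb" where
  "alpha B e lam G u q \<kappa> \<phi>1 \<phi>2 X =
     (\<phi>1 X \<cdot>\<^bsub>B\<^esub> \<kappa> (fob e (fob G X))) \<cdot>\<^bsub>B\<^esub>
       (far q (u (fob G X)) \<cdot>\<^bsub>B\<^esub> far q (lam (fob G (fob G X)))) \<cdot>\<^bsub>B\<^esub>
     inv_arr B (\<phi>2 X \<cdot>\<^bsub>B\<^esub> \<kappa> (fob e (fob G (fob G X))))"

definition beta :: "('ob, 'mb) catg \<Rightarrow> ('oa, 'ma, 'ob, 'mb) ftor \<Rightarrow>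
    ('oa \<Rightarrow> 'ma) \<Rightarrow> ('oa, 'ma, 'oa, 'ma) ftor \<Rightarrow> ('oa \<Rightarrow> 'ma) \<Rightarrow>
    ('oa, 'ma, 'ob, 'mb) ftor \<Rightarrow> ('ob \<Rightarrow> 'mb) \<Rightarrow> ('oa \<Rightarrow> 'mb) \<Rightarrow> 'oa \<Rightarrow> 'mb" where
  "beta B e lam G u q \<kappa> \<phi>1 X =
     \<kappa> (fob e X) \<cdot>\<^bsub>B\<^esub>
       (far q (u X) \<cdot>\<^bsub>B\<^esub> far q (lam (fob G X))) \<cdot>\<^bsub>B\<^esub>
     inv_arr B (\<phi>1 X \<cdot>\<^bsub>B\<^esub> \<kappa> (fob e (fob G X)))"


section \<open>Compatibility\<close>

definition exact_image :: "('o2, 'm2) catg \<Rightarrow> ('o1, 'm1, 'o2, 'm2) ftor \<Rightarrow>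
    (int \<Rightarrow> 'o1) \<Rightarrow> (int \<Rightarrow> 'm1) \<Rightarrow> bool" where
  "exact_image D T P d \<longleftrightarrow> exact_complex D (fob T \<circ> P) (far T \<circ> d)"

definition compatible_C1 :: "('o, 'm) catg \<Rightarrow> ('o, 'm, 'o, 'm) ftor \<Rightarrow> bool" where
  "compatible_C1 B F \<longleftrightarrow>
     (\<forall>P d. complete_resolution B P d \<longrightarrow>
        exact_image B F P d \<and> (\<forall>P' \<in> Proj B. hom_exact B P d (fob F P')))"

definition compatible_C2i :: "('ob, 'mb) catg \<Rightarrow> ('oa, 'ma) catg \<Rightarrow>
    ('ob, 'mb, 'oa, 'ma) ftor \<Rightarrow> ('oa, 'ma, 'ob, 'mb) ftor \<Rightarrow> bool" where
  "compatible_C2i B A i q \<longleftrightarrow>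
     (\<forall>Q d. complete_resolution A Q d \<longrightarrow>
        exact_image B q Q d \<and> (\<forall>P \<in> Proj B. hom_exact A Q d (fob i P)))"

definition compatible_C2ii :: "('ob, 'mb) catg \<Rightarrow> ('oa, 'ma) catg \<Rightarrow>
    ('oa, 'ma, 'ob, 'mb) ftor \<Rightarrow> ('ob, 'mb, 'oa, 'ma) ftor \<Rightarrow>
    ('ob, 'mb, 'ob, 'mb) ftor \<Rightarrow> bool" where
  "compatible_C2ii B A e l F \<longleftrightarrow>
     nilpotent_functor B F \<and>
     (\<forall>n > 0. \<forall>j > 0. \<forall>P \<in> Proj B. left_derived_zero B B (pow_ftor F j) n (fob F P)) \<and>
     (\<forall>Q d. complete_resolution A Q d \<longrightarrow>
        (\<forall>j > 0. exact_image B (pow_ftor F j \<circ>\<^sub>F e) Q d \<and>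
           (\<forall>P \<in> Proj B. hom_exact A Q d (fob (l \<circ>\<^sub>F pow_ftor F j) P))))"

definition compatible :: "('ob, 'mb) catg \<Rightarrow> ('oa, 'ma) catg \<Rightarrow>
    ('oa, 'ma, 'ob, 'mb) ftor \<Rightarrow> ('ob, 'mb, 'oa, 'ma) ftor \<Rightarrow> ('ob, 'mb, 'oa, 'ma) ftor \<Rightarrow>
    ('oa, 'ma, 'oa, 'ma) ftor \<Rightarrow> ('oa, 'ma, 'ob, 'mb) ftor \<Rightarrow> bool" where
  "compatible B A e i l G q \<longleftrightarrow>
     compatible_C1 B (cleft_F e i G) \<and>
     (compatible_C2i B A i q \<or> compatible_C2ii B A e l (cleft_F e i G))"

end

theory Submission
  imports Defs
begin

text \<open>
  Write \<open>T = e l\<close> for the monad of the adjunction.  As \<open>e\<close> is faithful and exact, an object \<open>X\<close> of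
  \<open>A\<close> amounts to the object \<open>e X\<close> of \<open>B\<close> with an action of \<open>T\<close>, and as \<open>T = Id \<oplus> F\<close> this is an action
  \<open>a : F e X \<rightarrow> e X\<close> of \<open>F\<close>, whose multiplication is \<open>\<eta> : F\<^sup>2 \<rightarrow> F\<close> (\<open>act\<close>, \<open>act_fullness\<close>).  The objects
  \<open>i Z\<close> carry the zero action, so \<open>q X\<close> is the cokernel of \<open>a\<close> (\<open>quot_cokernel\<close>).  All diagram chases
  are made with morphisms from projective objects as elements.

  (2) and (3) are equivalent because \<open>q\<close> is right exact: \<open>\<alpha>\<close> has the image of \<open>q(u)\<close> at \<open>G X\<close>, which is
  the kernel of the epimorphism \<open>q(\<lambda>)\<close> at \<open>G X\<close>, and \<open>\<beta>\<close> is that epimorphism followed by \<open>q(u)\<close> at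
  \<open>X\<close> (\<open>alpha_beta_exact_iff_mono\<close>).

  For (1) implies (2), the second form of (C2) is reduced to the first
  (\<open>compatible_C2ii_imp_C2i\<close>): the sequences \<open>0 \<rightarrow> G\<^sup>n\<^sup>+\<^sup>1 \<rightarrow> l e G\<^sup>n \<rightarrow> G\<^sup>n \<rightarrow> 0\<close> end after finitely many steps
  when \<open>F\<close> is nilpotent, and they stay exact under \<open>q\<close> on projective objects and under \<open>Hom(Q, -)\<close> for
  projective \<open>Q\<close>, so acyclicity passes from the middle terms to the identity functor.  Then \<open>q\<close> maps a complete resolution of \<open>X\<close> to one of \<open>q X\<close>, and
  acyclicity of the image complex is the vanishing of \<open>L\<^sub>1 q\<close> at \<open>X\<close>, which makes \<open>q(u)\<close> mono
  (\<open>Gorenstein_q\<close>).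

  For (2) implies (1), let \<open>\<eta> = 0\<close>.  Then (2) says that \<open>0 \<rightarrow> F Y \<rightarrow> e X \<rightarrow> Y \<rightarrow> 0\<close> is exact for \<open>Y = q X\<close>,
  with \<open>a\<close> the composite \<open>F e X \<rightarrow> F Y \<rightarrow> e X\<close> (\<open>mono_imp_structure\<close>), and \<open>l P\<close> is of this kind over
  \<open>P\<close>.  A horseshoe argument over the complete resolution of \<open>Y\<close> shows that the objects of this kind
  over Gorenstein projective \<open>Y\<close> have syzygies and cosyzygies of the same kind with middle terms
  \<open>l P\<close> (\<open>syzygy_structure\<close>, \<open>cosyzygy_structure\<close>); here (C1) keeps the sequences exact under \<open>F\<close> and
  makes \<open>Ext\<^sup>1(Y, P')\<close> and \<open>Ext\<^sup>1(Y, F P')\<close> vanish.  The same two groups control morphisms to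
  \<open>l P'\<close> (\<open>extends_free\<close>), so splicing yields a complete resolution of \<open>X\<close>
  (\<open>Gorenstein_splice\<close>, \<open>Gorenstein_of_structure\<close>).
\<close>

section \<open>Morphisms of a preadditive category\<close>

text \<open>The rules below type a morphism by \<open>Arr\<close>, \<open>Dom\<close> and \<open>Cod\<close> instead of by a hom-set.  The domain and
  codomain of a composite can then be computed by rewriting, which discharges the side conditions of
  associativity and bilinearity.\<close>

definition Neg :: "('o, 'm) catg \<Rightarrow> 'm \<Rightarrow> 'm" where
  "Neg C f = m_inv (hom_group C (Dom C f) (Cod C f)) f"

definition Sub :: "('o, 'm) catg \<Rightarrow> 'm \<Rightarrow> 'm \<Rightarrow> 'm" where
  "Sub C f g = Add C f (Neg C g)"

context cat
begin

lemma idt_arr [simp]: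
  assumes "X \<in> Ob C"
  shows "Idt C X \<in> Arr C" "Dom C (Idt C X) = X" "Cod C (Idt C X) = X"
  using idt_hom[OF assms] by (auto simp: Hom_def)

lemma arr_ob [simp]: "f \<in> Arr C \<Longrightarrow> Dom C f \<in> Ob C" "f \<in> Arr C \<Longrightarrow> Cod C f \<in> Ob C"
  by (rule dom_ob cod_ob; assumption)+

lemma cmp_arr [simp]:
  assumes "f \<in> Arr C" "g \<in> Arr C" "Cod C f = Dom C g"
  shows "g \<cdot> f \<in> Arr C" "Dom C (g \<cdot> f) = Dom C f" "Cod C (g \<cdot> f) = Cod C g"
  using cmp_hom[of f "Dom C f" "Dom C g" g "Cod C g"] assms by (auto simp: Hom_def)

lemma cmp_idt_left [simp]: "f \<in> Arr C \<Longrightarrow> Cod C f = X \<Longrightarrow> Idt C X \<cdot> f = f"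
  using idt_left[of f "Dom C f" X] by (auto simp: Hom_def)

lemma cmp_idt_right [simp]: "f \<in> Arr C \<Longrightarrow> Dom C f = X \<Longrightarrow> f \<cdot> Idt C X = f"
  using idt_right[of f X "Cod C f"] by (auto simp: Hom_def)

lemma assoc [simp]:
  "\<lbrakk>f \<in> Arr C; g \<in> Arr C; h \<in> Arr C; Cod C f = Dom C g; Cod C g = Dom C h\<rbrakk>
    \<Longrightarrow> (h \<cdot> g) \<cdot> f = h \<cdot> (g \<cdot> f)"
  using cmp_assoc[of f "Dom C f" "Dom C g" g "Dom C h" h "Cod C h"] by (auto simp: Hom_def)

text \<open>The following two rules apply an equation between composites inside a longer composite
  that is bracketed to the right.\<close>

lemma reassoc:
  "\<lbrakk>g \<cdot> f = h; f \<in> Arr C; g \<in> Arr C; x \<in> Arr C; Cod C x = Dom C f; Cod C f = Dom C g\<rbrakk>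
    \<Longrightarrow> g \<cdot> (f \<cdot> x) = h \<cdot> x"
  using assoc[of x f g] by simp

lemma reassoc2:
  "\<lbrakk>g \<cdot> f = h \<cdot> k; f \<in> Arr C; g \<in> Arr C; h \<in> Arr C; k \<in> Arr C; x \<in> Arr C;
    Cod C x = Dom C f; Cod C f = Dom C g; Dom C k = Dom C f; Cod C k = Dom C h\<rbrakk>
    \<Longrightarrow> g \<cdot> (f \<cdot> x) = h \<cdot> (k \<cdot> x)"
  using assoc[of x f g] assoc[of x k h] by simp

end

context preadditive_cat
begin

lemma hom_group_carrier: "carrier (hom_group C X Y) = Hom C X Y"
  and hom_group_mult: "monoid.mult (hom_group C X Y) = Add C"
  and hom_group_one: "one (hom_group C X Y) = Zro C X Y"
  by (simp_all add: hom_group_def)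

lemmas hom_group_simps = hom_group_carrier hom_group_mult hom_group_one

lemma zro_arr [simp]:
  assumes "X \<in> Ob C" "Y \<in> Ob C"
  shows "Zro C X Y \<in> Arr C" "Dom C (Zro C X Y) = X" "Cod C (Zro C X Y) = Y"
proof -
  interpret H: comm_group "hom_group C X Y" using hom_comm_group assms .
  show "Zro C X Y \<in> Arr C" "Dom C (Zro C X Y) = X" "Cod C (Zro C X Y) = Y"
    using H.one_closed by (auto simp: hom_group_simps Hom_def)
qed

context
  fixes f g
  assumes fg: "f \<in> Arr C" "g \<in> Arr C" "Dom C f = Dom C g" "Cod C f = Cod C g"
begin

interpretation H: comm_group "hom_group C (Dom C g) (Cod C g)"
  using fg hom_comm_group by simp

lemma add_arr [simp]:
  shows "Add C f g \<in> Arr C" "Dom C (Add C f g) = Dom C g" "Cod C (Add C f g) = Cod C g"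
  using H.m_closed[of f g] fg by (auto simp: hom_group_simps Hom_def)

lemma neg_arr [simp]:
  shows "Neg C g \<in> Arr C" "Dom C (Neg C g) = Dom C g" "Cod C (Neg C g) = Cod C g"
  using H.inv_closed[of g] fg by (auto simp: hom_group_simps Hom_def Neg_def)

lemma add_comm: "Add C f g = Add C g f"
  using H.m_comm[of f g] fg by (auto simp: hom_group_simps Hom_def)

lemma sub_add_cancel [simp]: "Add C (Sub C f g) g = f"
  using H.inv_solve_right'[of "f" "Sub C f g" g] fg H.m_closed[of f "Neg C g"]
    H.inv_closed[of g] H.m_assoc[of f "Neg C g" g] H.l_inv[of g] H.r_one[of f]
  by (auto simp: hom_group_simps Hom_def Neg_def Sub_def)

lemma add_sub_cancel [simp]: "Sub C (Add C f g) g = f"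
  using fg H.inv_closed[of g] H.m_assoc[of f g "Neg C g"] H.r_inv[of g] H.r_one[of f]
  by (auto simp: hom_group_simps Hom_def Neg_def Sub_def)

lemma sub_zero_eq: "Sub C f g = Zro C (Dom C g) (Cod C g) \<Longrightarrow> f = g"
  using sub_add_cancel fg H.l_one[of g] by (auto simp: hom_group_simps Hom_def)

lemma sub_self [simp]: "Sub C g g = Zro C (Dom C g) (Cod C g)"
  using H.r_inv[of g] fg by (auto simp: hom_group_simps Hom_def Neg_def Sub_def)

lemma add_zro_left [simp]: "Add C (Zro C (Dom C g) (Cod C g)) g = g"
  using H.l_one[of g] fg by (auto simp: hom_group_simps Hom_def)

end

lemma neg_arr' [simp]:
  assumes "g \<in> Arr C"
  shows "Neg C g \<in> Arr C" "Dom C (Neg C g) = Dom C g" "Cod C (Neg C g) = Cod C g"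
  using neg_arr[of g g] assms by auto

declare neg_arr [simp del] sub_self [simp del] add_zro_left [simp del]

lemma sub_arr [simp]:
  assumes "f \<in> Arr C" "g \<in> Arr C" "Dom C f = Dom C g" "Cod C f = Cod C g"
  shows "Sub C f g \<in> Arr C" "Dom C (Sub C f g) = Dom C g" "Cod C (Sub C f g) = Cod C g"
  using assms by (auto simp: Sub_def)

lemma sub_self' [simp]: "g \<in> Arr C \<Longrightarrow> Sub C g g = Zro C (Dom C g) (Cod C g)"
  using sub_self[of g g] by simp

lemma zro_add [simp]:
  assumes "g \<in> Arr C" "X = Dom C g" "Y = Cod C g"
  shows "Add C (Zro C X Y) g = g" "Add C g (Zro C X Y) = g" "Sub C g (Zro C X Y) = g"
proof -
  have z: "Zro C X Y \<in> Arr C" "Dom C (Zro C X Y) = Dom C g" "Cod C (Zro C X Y) = Cod C g"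
    using assms by simp_all
  show 1: "Add C (Zro C X Y) g = g" using add_zro_left[OF assms(1,1)] assms(2,3) by simp
  have 2: "Add C (Zro C X Y) g = Add C g (Zro C X Y)"
    by (rule add_comm) (use z assms(1) in simp_all)
  show 3: "Add C g (Zro C X Y) = g" using 1 unfolding 2 .
  have "Sub C (Add C g (Zro C X Y)) (Zro C X Y) = g"
    by (rule add_sub_cancel) (use z assms(1) in simp_all)
  then show "Sub C g (Zro C X Y) = g" unfolding 3 .
qed

lemma add_idem_zro:
  assumes "f \<in> Arr C" "Add C f f = f"
  shows "f = Zro C (Dom C f) (Cod C f)"
  using add_sub_cancel[of f f] assms by simp

lemma add_zero_neg:
  assumes "f \<in> Arr C" "g \<in> Arr C" "Dom C f = Dom C g" "Cod C f = Cod C g"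
    and "Add C f g = Zro C (Dom C g) (Cod C g)"
  shows "f = Neg C g"
  using add_sub_cancel[OF assms(1-4)] assms add_zro_left[of "Neg C g" "Neg C g"]
  by (simp add: Sub_def)

lemma add_neg [simp]: "g \<in> Arr C \<Longrightarrow> Add C (Neg C g) g = Zro C (Dom C g) (Cod C g)"
  using sub_self'[of g] add_comm[of "Neg C g" g] by (simp add: Sub_def)

lemma cmp_add_distl [simp]:
  "\<lbrakk>f \<in> Arr C; g \<in> Arr C; h \<in> Arr C; Dom C g = Dom C h; Cod C g = Cod C h; Cod C f = Dom C h\<rbrakk>
    \<Longrightarrow> Add C g h \<cdot> f = Add C (g \<cdot> f) (h \<cdot> f)"
  using cmp_add_left[of f "Dom C f" "Dom C h" g "Cod C h" h] by (auto simp: Hom_def)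

lemma cmp_add_distr [simp]:
  "\<lbrakk>f \<in> Arr C; g \<in> Arr C; h \<in> Arr C; Dom C f = Dom C g; Cod C f = Cod C g; Cod C g = Dom C h\<rbrakk>
    \<Longrightarrow> h \<cdot> Add C f g = Add C (h \<cdot> f) (h \<cdot> g)"
  using cmp_add_right[of f "Dom C g" "Dom C h" g h "Cod C h"] by (auto simp: Hom_def)

lemma cmp_zro_right [simp]:
  assumes "X \<in> Ob C" "f \<in> Arr C" "Dom C f = Y"
  shows "f \<cdot> Zro C X Y = Zro C X (Cod C f)"
proof -
  have Y: "Y \<in> Ob C" using assms by auto
  have "Add C (f \<cdot> Zro C X Y) (f \<cdot> Zro C X Y) = f \<cdot> Add C (Zro C X Y) (Zro C X Y)"
    using assms Y by (subst cmp_add_distr) auto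
  also have "\<dots> = f \<cdot> Zro C X Y" using assms Y by (subst zro_add) auto
  finally have "f \<cdot> Zro C X Y = Zro C (Dom C (f \<cdot> Zro C X Y)) (Cod C (f \<cdot> Zro C X Y))"
    using assms Y by (intro add_idem_zro) auto
  then show ?thesis using assms Y by simp
qed

lemma cmp_zro_left [simp]:
  assumes "Z \<in> Ob C" "f \<in> Arr C" "Cod C f = Y"
  shows "Zro C Y Z \<cdot> f = Zro C (Dom C f) Z"
proof -
  have Y: "Y \<in> Ob C" using assms by auto
  have "Add C (Zro C Y Z \<cdot> f) (Zro C Y Z \<cdot> f) = Add C (Zro C Y Z) (Zro C Y Z) \<cdot> f"
    using assms Y by (subst cmp_add_distl) auto
  also have "\<dots> = Zro C Y Z \<cdot> f" using assms Y by (subst zro_add) auto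
  finally have "Zro C Y Z \<cdot> f = Zro C (Dom C (Zro C Y Z \<cdot> f)) (Cod C (Zro C Y Z \<cdot> f))"
    using assms Y by (intro add_idem_zro) auto
  then show ?thesis using assms Y by simp
qed

lemma cmp_neg [simp]:
  assumes "f \<in> Arr C" "g \<in> Arr C" "Cod C f = Dom C g"
  shows "g \<cdot> Neg C f = Neg C (g \<cdot> f)" "Neg C g \<cdot> f = Neg C (g \<cdot> f)"
  using assms cmp_add_distr[of "Neg C f" f g] cmp_add_distl[of f "Neg C g" g]
  by (auto intro!: add_zero_neg)

lemma cmp_sub [simp]:
  "\<lbrakk>f \<in> Arr C; g \<in> Arr C; h \<in> Arr C; Dom C g = Dom C h; Cod C g = Cod C h; Cod C f = Dom C h\<rbrakk>
    \<Longrightarrow> Sub C g h \<cdot> f = Sub C (g \<cdot> f) (h \<cdot> f)"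
  "\<lbrakk>f \<in> Arr C; g \<in> Arr C; h \<in> Arr C; Dom C f = Dom C g; Cod C f = Cod C g; Cod C g = Dom C h\<rbrakk>
    \<Longrightarrow> h \<cdot> Sub C f g = Sub C (h \<cdot> f) (h \<cdot> g)"
  by (simp_all add: Sub_def)

lemma zero_ob_zro:
  assumes "zero_object C Z" "f \<in> Arr C" "Dom C f = Z \<or> Cod C f = Z" "Dom C f = X" "Cod C f = Y"
  shows "f = Zro C X Y"
proof -
  have Z: "Z \<in> Ob C" using assms(1) by (auto simp: zero_object_def)
  from assms(3) show ?thesis
  proof
    assume d: "Dom C f = Z"
    have "\<exists>!h. h \<in> Hom C Z (Cod C f)"
      using assms(1,2) by (simp add: zero_object_def)
    moreover have "f \<in> Hom C Z (Cod C f)" "Zro C Z (Cod C f) \<in> Hom C Z (Cod C f)"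
      using assms d Z by (auto simp: Hom_def)
    ultimately show ?thesis using d assms(4,5) by metis
  next
    assume d: "Cod C f = Z"
    have "\<exists>!h. h \<in> Hom C (Dom C f) Z"
      using assms(1,2) by (simp add: zero_object_def)
    moreover have "f \<in> Hom C (Dom C f) Z" "Zro C (Dom C f) Z \<in> Hom C (Dom C f) Z"
      using assms d Z by (auto simp: Hom_def)
    ultimately show ?thesis using d assms(4,5) by metis
  qed
qed

lemma idt_zro_zero_ob:
  assumes "Z \<in> Ob C" "Idt C Z = Zro C Z Z"
  shows "zero_object C Z"
proof -
  have "f = Zro C X Z" if "f \<in> Hom C X Z" for f X
    using that assms cmp_idt_left[of f Z] cmp_zro_left[of Z f Z] by (auto simp: Hom_def)
  moreover have "f = Zro C Z X" if "f \<in> Hom C Z X" for f X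
    using that assms cmp_idt_right[of f Z] cmp_zro_right[of Z f Z] by (auto simp: Hom_def)
  moreover have "Zro C X Z \<in> Hom C X Z" "Zro C Z X \<in> Hom C Z X" if "X \<in> Ob C" for X
    using that assms by (auto simp: Hom_def)
  ultimately show ?thesis using assms(1) unfolding zero_object_def by blast
qed

lemma monoI:
  assumes f: "f \<in> Arr C"
    and 0: "\<And>g W. \<lbrakk>g \<in> Arr C; Dom C g = W; Cod C g = Dom C f; f \<cdot> g = Zro C W (Cod C f)\<rbrakk>
      \<Longrightarrow> g = Zro C W (Dom C f)"
  shows "is_mono C f"
  unfolding is_mono_def
proof (intro conjI allI ballI impI)
  fix W g h assume gh: "g \<in> Hom C W (Dom C f)" "h \<in> Hom C W (Dom C f)" "f \<cdot> g = f \<cdot> h"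
  have "Sub C g h = Zro C W (Dom C f)"
    by (rule 0) (use gh f in \<open>auto simp: Hom_def\<close>)
  then show "g = h" using gh sub_zero_eq[of g h] by (auto simp: Hom_def)
qed fact

lemma epiI:
  assumes f: "f \<in> Arr C"
    and 0: "\<And>g W. \<lbrakk>g \<in> Arr C; Dom C g = Cod C f; Cod C g = W; g \<cdot> f = Zro C (Dom C f) W\<rbrakk>
      \<Longrightarrow> g = Zro C (Cod C f) W"
  shows "is_epi C f"
  unfolding is_epi_def
proof (intro conjI allI ballI impI)
  fix W g h assume gh: "g \<in> Hom C (Cod C f) W" "h \<in> Hom C (Cod C f) W" "g \<cdot> f = h \<cdot> f"
  have "Sub C g h = Zro C (Cod C f) W"
    by (rule 0) (use gh f in \<open>auto simp: Hom_def\<close>)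
  then show "g = h" using gh sub_zero_eq[of g h] by (auto simp: Hom_def)
qed fact

lemma mono_arr: "is_mono C f \<Longrightarrow> f \<in> Arr C" and epi_arr: "is_epi C f \<Longrightarrow> f \<in> Arr C"
  by (auto simp: is_mono_def is_epi_def)

lemma mono_cancel:
  "\<lbrakk>is_mono C f; f \<cdot> g = f \<cdot> h; g \<in> Arr C; h \<in> Arr C; Dom C g = Dom C h;
    Cod C g = Dom C f; Cod C h = Dom C f\<rbrakk> \<Longrightarrow> g = h"
  by (auto simp: is_mono_def Hom_def)

lemma epi_cancel:
  "\<lbrakk>is_epi C f; g \<cdot> f = h \<cdot> f; g \<in> Arr C; h \<in> Arr C; Cod C g = Cod C h;
    Dom C g = Cod C f; Dom C h = Cod C f\<rbrakk> \<Longrightarrow> g = h"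
  by (auto simp: is_epi_def Hom_def)

lemma mono_zero:
  assumes "is_mono C f" "f \<cdot> g = Zro C W Z" "g \<in> Arr C" "Dom C g = W" "Cod C f = Z"
    "Cod C g = Dom C f" "Dom C f = Y"
  shows "g = Zro C W Y"
  by (rule mono_cancel[of f]) (use assms mono_arr[of f] in auto)

lemma epi_zero:
  assumes "is_epi C f" "g \<cdot> f = Zro C W Z" "g \<in> Arr C" "Dom C f = W" "Cod C g = Z"
    "Dom C g = Cod C f" "Cod C f = Y"
  shows "g = Zro C Y Z"
  by (rule epi_cancel[of f]) (use assms epi_arr[of f] in auto)

lemma mono_cmp:
  assumes "is_mono C f" "is_mono C g" "Cod C f = Dom C g" shows "is_mono C (g \<cdot> f)"
proof (rule monoI)
  fix h W assume h: "h \<in> Arr C" "Dom C h = W" "Cod C h = Dom C (g \<cdot> f)"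
    "(g \<cdot> f) \<cdot> h = Zro C W (Cod C (g \<cdot> f))"
  then have "f \<cdot> h = Zro C W (Cod C f)"
    using assms mono_arr[of f] mono_arr[of g] by - (rule mono_zero[OF assms(2)]; simp)
  then show "h = Zro C W (Dom C (g \<cdot> f))"
    using h assms mono_arr[of f] mono_arr[of g] by - (rule mono_zero[OF assms(1)]; simp)
qed (use assms mono_arr[of f] mono_arr[of g] in auto)

lemma epi_cmp:
  assumes "is_epi C f" "is_epi C g" "Cod C f = Dom C g" shows "is_epi C (g \<cdot> f)"
proof (rule epiI)
  fix h W assume h: "h \<in> Arr C" "Dom C h = Cod C (g \<cdot> f)" "Cod C h = W"
    "h \<cdot> (g \<cdot> f) = Zro C (Dom C (g \<cdot> f)) W"
  then have "h \<cdot> g = Zro C (Cod C f) W"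
    using assms epi_arr[of f] epi_arr[of g] by - (rule epi_zero[OF assms(1)]; simp)
  then show "h = Zro C (Cod C (g \<cdot> f)) W"
    using h assms epi_arr[of f] epi_arr[of g] by - (rule epi_zero[OF assms(2)]; simp)
qed (use assms epi_arr[of f] epi_arr[of g] in auto)

lemma split_epi:
  assumes "f \<in> Arr C" "g \<in> Arr C" "Cod C g = Dom C f" "f \<cdot> g = Idt C (Cod C f)"
    "Dom C g = Cod C f"
  shows "is_epi C f"
proof (rule epiI)
  fix h W assume h: "h \<in> Arr C" "Dom C h = Cod C f" "Cod C h = W" "h \<cdot> f = Zro C (Dom C f) W"
  then have "W \<in> Ob C" using arr_ob by blast
  then have "(h \<cdot> f) \<cdot> g = Zro C (Cod C f) W" using assms h by simp
  then show "h = Zro C (Cod C f) W" using assms h(1,2) by simp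
qed fact

lemma split_mono:
  assumes "f \<in> Arr C" "g \<in> Arr C" "Cod C f = Dom C g" "g \<cdot> f = Idt C (Dom C f)"
    "Cod C g = Dom C f"
  shows "is_mono C f"
proof (rule monoI)
  fix h W assume h: "h \<in> Arr C" "Dom C h = W" "Cod C h = Dom C f" "f \<cdot> h = Zro C W (Cod C f)"
  then have "W \<in> Ob C" using arr_ob by blast
  then have "g \<cdot> (f \<cdot> h) = Zro C W (Dom C f)" using assms h by simp
  then show "h = Zro C W (Dom C f)" using assms h(1-3) reassoc[OF assms(4), of h] by simp
qed fact

end

section \<open>Kernels, cokernels and images\<close>

context preadditive_cat
begin

lemma kernel_arr:
  assumes "is_kernel C k f"
  shows "k \<in> Arr C" "f \<in> Arr C" "Cod C k = Dom C f" "f \<cdot> k = Zro C (Dom C k) (Cod C f)"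
  using assms by (auto simp: is_kernel_def)

lemma cokernel_arr:
  assumes "is_cokernel C c f"
  shows "c \<in> Arr C" "f \<in> Arr C" "Dom C c = Cod C f" "c \<cdot> f = Zro C (Dom C f) (Cod C c)"
  using assms by (auto simp: is_cokernel_def)

lemma kernel_lift:
  assumes "is_kernel C k f" "g \<in> Arr C" "Dom C g = W" "Cod C g = Dom C f" "f \<cdot> g = Zro C W (Cod C f)"
  obtains h where "h \<in> Arr C" "Dom C h = W" "Cod C h = Dom C k" "k \<cdot> h = g"
proof -
  have "g \<in> Hom C W (Dom C f)" using assms by (simp add: Hom_def)
  then obtain h where "h \<in> Hom C W (Dom C k)" "k \<cdot> h = g"
    using assms(1,5) unfolding is_kernel_def by blast
  then show ?thesis using that unfolding Hom_def by blast
qed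

lemma cokernel_desc:
  assumes "is_cokernel C c f" "g \<in> Arr C" "Dom C g = Cod C f" "Cod C g = Z" "g \<cdot> f = Zro C (Dom C f) Z"
  obtains h where "h \<in> Arr C" "Dom C h = Cod C c" "Cod C h = Z" "h \<cdot> c = g"
proof -
  have "g \<in> Hom C (Cod C f) Z" using assms by (simp add: Hom_def)
  then obtain h where "h \<in> Hom C (Cod C c) Z" "h \<cdot> c = g"
    using assms(1,5) unfolding is_cokernel_def by blast
  then show ?thesis using that unfolding Hom_def by blast
qed

lemma kernel_mono:
  assumes "is_kernel C k f" shows "is_mono C k"
proof (rule monoI)
  note k = kernel_arr[OF assms]
  fix g W assume g: "g \<in> Arr C" "Dom C g = W" "Cod C g = Dom C k" "k \<cdot> g = Zro C W (Cod C k)"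
  then have W: "W \<in> Ob C" by auto
  have "Zro C W (Dom C f) \<in> Hom C W (Dom C f)" using W k by (simp add: Hom_def)
  moreover have "f \<cdot> Zro C W (Dom C f) = Zro C W (Cod C f)" using W k by simp
  ultimately have "\<exists>!h. h \<in> Hom C W (Dom C k) \<and> k \<cdot> h = Zro C W (Dom C f)"
    using assms unfolding is_kernel_def by blast
  moreover have "g \<in> Hom C W (Dom C k) \<and> k \<cdot> g = Zro C W (Dom C f)"
    using g k by (simp add: Hom_def)
  moreover have "Zro C W (Dom C k) \<in> Hom C W (Dom C k) \<and> k \<cdot> Zro C W (Dom C k) = Zro C W (Dom C f)"
    using W k by (simp add: Hom_def)
  ultimately show "g = Zro C W (Dom C k)" by blast
qed (use kernel_arr[OF assms] in simp)

lemma cokernel_epi: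
  assumes "is_cokernel C c f" shows "is_epi C c"
proof (rule epiI)
  note c = cokernel_arr[OF assms]
  fix g W assume g: "g \<in> Arr C" "Dom C g = Cod C c" "Cod C g = W" "g \<cdot> c = Zro C (Dom C c) W"
  then have W: "W \<in> Ob C" by auto
  have "Zro C (Cod C f) W \<in> Hom C (Cod C f) W" using W c by (simp add: Hom_def)
  moreover have "Zro C (Cod C f) W \<cdot> f = Zro C (Dom C f) W" using W c by simp
  ultimately have "\<exists>!h. h \<in> Hom C (Cod C c) W \<and> h \<cdot> c = Zro C (Cod C f) W"
    using assms unfolding is_cokernel_def by blast
  moreover have "g \<in> Hom C (Cod C c) W \<and> g \<cdot> c = Zro C (Cod C f) W"
    using g c by (simp add: Hom_def)
  moreover have "Zro C (Cod C c) W \<in> Hom C (Cod C c) W \<and> Zro C (Cod C c) W \<cdot> c = Zro C (Cod C f) W"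
    using W c by (simp add: Hom_def)
  ultimately show "g = Zro C (Cod C c) W" by blast
qed (use cokernel_arr[OF assms] in simp)

lemma kernelI:
  assumes "is_mono C k" "f \<in> Arr C" "Cod C k = Dom C f" "f \<cdot> k = Zro C (Dom C k) (Cod C f)"
    and 1: "\<And>g. \<lbrakk>g \<in> Arr C; Cod C g = Dom C f; f \<cdot> g = Zro C (Dom C g) (Cod C f)\<rbrakk>
      \<Longrightarrow> \<exists>h. h \<in> Arr C \<and> Dom C h = Dom C g \<and> Cod C h = Dom C k \<and> k \<cdot> h = g"
  shows "is_kernel C k f"
  unfolding is_kernel_def
proof (intro conjI allI ballI impI)
  fix W g assume g: "g \<in> Hom C W (Dom C f)" "f \<cdot> g = Zro C W (Cod C f)"
  then obtain h where "h \<in> Hom C W (Dom C k)" "k \<cdot> h = g" using 1[of g] by (auto simp: Hom_def)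
  then show "\<exists>!h. h \<in> Hom C W (Dom C k) \<and> k \<cdot> h = g"
    using assms(1) unfolding is_mono_def by blast
qed (use assms mono_arr in auto)

lemma cokernelI:
  assumes "is_epi C c" "f \<in> Arr C" "Dom C c = Cod C f" "c \<cdot> f = Zro C (Dom C f) (Cod C c)"
    and 1: "\<And>g. \<lbrakk>g \<in> Arr C; Dom C g = Cod C f; g \<cdot> f = Zro C (Dom C f) (Cod C g)\<rbrakk>
      \<Longrightarrow> \<exists>h. h \<in> Arr C \<and> Dom C h = Cod C c \<and> Cod C h = Cod C g \<and> h \<cdot> c = g"
  shows "is_cokernel C c f"
  unfolding is_cokernel_def
proof (intro conjI allI ballI impI)
  fix Z g assume g: "g \<in> Hom C (Cod C f) Z" "g \<cdot> f = Zro C (Dom C f) Z"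
  then obtain h where "h \<in> Hom C (Cod C c) Z" "h \<cdot> c = g" using 1[of g] by (auto simp: Hom_def)
  moreover have "Cod C f = Dom C c" using assms by simp
  ultimately show "\<exists>!h. h \<in> Hom C (Cod C c) Z \<and> h \<cdot> c = g"
    using assms(1) unfolding is_epi_def by blast
qed (use assms epi_arr in auto)

lemma iso_inverse:
  assumes "is_iso_arr C f"
  shows "f \<in> Arr C" "inv_arr C f \<in> Arr C" "Dom C (inv_arr C f) = Cod C f"
    "Cod C (inv_arr C f) = Dom C f"
    "inv_arr C f \<cdot> f = Idt C (Dom C f)" "f \<cdot> inv_arr C f = Idt C (Cod C f)"
proof -
  obtain g where g: "inverse_arrows C f g" using assms by (auto simp: is_iso_arr_def)
  have "h = g" if "inverse_arrows C f h" for h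
  proof -
    have "(g \<cdot> f) \<cdot> h = g \<cdot> (f \<cdot> h)"
      using g that by (intro assoc) (auto simp: inverse_arrows_def Hom_def)
    then have "h = g" using g that by (simp del: assoc add: inverse_arrows_def Hom_def)
    then show ?thesis .
  qed
  then have "inv_arr C f = g" unfolding inv_arr_def using g by (rule the_equality[rotated])
  then show "f \<in> Arr C" "inv_arr C f \<in> Arr C" "Dom C (inv_arr C f) = Cod C f"
    "Cod C (inv_arr C f) = Dom C f"
    "inv_arr C f \<cdot> f = Idt C (Dom C f)" "f \<cdot> inv_arr C f = Idt C (Cod C f)"
    using g by (auto simp: inverse_arrows_def Hom_def)
qed

lemma iso_mono: "is_iso_arr C f \<Longrightarrow> is_mono C f" and iso_epi: "is_iso_arr C f \<Longrightarrow> is_epi C f"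
  by (rule split_mono[of f "inv_arr C f"] split_epi[of f "inv_arr C f"]; simp add: iso_inverse)+

lemma iso_inv_iso: "is_iso_arr C f \<Longrightarrow> is_iso_arr C (inv_arr C f)"
  unfolding is_iso_arr_def[of C "inv_arr C f"]
  by (rule exI[of _ f]) (simp add: inverse_arrows_def iso_inverse Hom_def)

lemma iso_cmp:
  assumes "is_iso_arr C f" "is_iso_arr C g" "Cod C f = Dom C g"
  shows "is_iso_arr C (g \<cdot> f)"
proof -
  note f = iso_inverse[OF assms(1)] and g = iso_inverse[OF assms(2)]
  have "inverse_arrows C (g \<cdot> f) (inv_arr C f \<cdot> inv_arr C g)"
    using f g assms(3) reassoc[OF f(6), of "inv_arr C g"] reassoc[OF g(5), of f]
    by (simp add: inverse_arrows_def Hom_def)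
  then show ?thesis by (auto simp: is_iso_arr_def)
qed

end

context abelian_cat
begin

lemma mono_is_kernel_of_cokernel:
  assumes "is_mono C f" "is_cokernel C c f" shows "is_kernel C f c"
proof -
  note c = cokernel_arr[OF assms(2)]
  obtain g where g: "is_kernel C f g" using mono_is_kernel[OF assms(1)] by blast
  note g' = kernel_arr[OF g]
  obtain g1 where g1: "g1 \<in> Arr C" "Dom C g1 = Cod C c" "Cod C g1 = Cod C g" "g1 \<cdot> c = g"
    using cokernel_desc[OF assms(2), of g "Cod C g"] g' by auto
  show ?thesis
  proof (rule kernelI)
    fix x assume x: "x \<in> Arr C" "Cod C x = Dom C c" "c \<cdot> x = Zro C (Dom C x) (Cod C c)"
    have "g \<cdot> x = Zro C (Dom C x) (Cod C g)"
      using reassoc[OF g1(4) _ g1(1) x(1)] x c g1(1-3) by simp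
    moreover have "Cod C x = Dom C g" using x c g'(3) by simp
    ultimately show "\<exists>h. h \<in> Arr C \<and> Dom C h = Dom C x \<and> Cod C h = Dom C f \<and> f \<cdot> h = x"
      using kernel_lift[OF g x(1) refl] by blast
  qed (use c assms(1) in simp_all)
qed

lemma epi_is_cokernel_of_kernel:
  assumes "is_epi C f" "is_kernel C k f" shows "is_cokernel C f k"
proof -
  note k = kernel_arr[OF assms(2)]
  obtain g where g: "is_cokernel C f g" using epi_is_cokernel[OF assms(1)] by blast
  note g' = cokernel_arr[OF g]
  obtain g1 where g1: "g1 \<in> Arr C" "Dom C g1 = Dom C g" "Cod C g1 = Dom C k" "k \<cdot> g1 = g"
    using kernel_lift[OF assms(2), of g "Dom C g"] g' by auto
  show ?thesis
  proof (rule cokernelI)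
    fix x assume x: "x \<in> Arr C" "Dom C x = Cod C k" "x \<cdot> k = Zro C (Dom C k) (Cod C x)"
    have "x \<cdot> g = x \<cdot> (k \<cdot> g1)" using g1 by simp
    also have "\<dots> = Zro C (Dom C g) (Cod C x)"
      using x g1 k reassoc[OF x(3), of g1] by simp
    finally show "\<exists>h. h \<in> Arr C \<and> Dom C h = Cod C f \<and> Cod C h = Cod C x \<and> h \<cdot> f = x"
      by - (rule cokernel_desc[OF g x(1) _ refl]; use x k g' in auto)
  qed (use k assms in auto)
qed

text \<open>The image of \<open>f\<close> is the kernel of its cokernel.  The remaining factor \<open>p\<close> is epi: were it
  to factor through a smaller subobject, that subobject would have the same cokernel and so
  would contain the image.\<close>

lemma image_is_kernel_of_cokernel:
  assumes "is_cokernel C c f"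
  obtains p m where "is_image C f p m" "is_kernel C m c"
proof -
  note c = cokernel_arr[OF assms]
  obtain m where m: "is_kernel C m c" using ex_kernel[OF c(1)] by blast
  note m' = kernel_arr[OF m]
  obtain p where p: "p \<in> Arr C" "Dom C p = Dom C f" "Cod C p = Dom C m" "m \<cdot> p = f"
    using kernel_lift[OF m, of f "Dom C f"] c by auto
  have "is_epi C p"
  proof (rule epiI)
    fix g W assume g: "g \<in> Arr C" "Dom C g = Cod C p" "Cod C g = W" "g \<cdot> p = Zro C (Dom C p) W"
    then have W: "W \<in> Ob C" by auto
    obtain k where k: "is_kernel C k g" using ex_kernel[OF g(1)] by blast
    note k' = kernel_arr[OF k]
    obtain p1 where p1: "p1 \<in> Arr C" "Dom C p1 = Dom C p" "Cod C p1 = Dom C k" "k \<cdot> p1 = p"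
      using kernel_lift[OF k, of p "Dom C p"] p g by auto
    have "is_mono C (m \<cdot> k)"
      using mono_cmp[OF kernel_mono[OF k] kernel_mono[OF m]] k' m' g p by simp
    moreover obtain c1 where c1: "is_cokernel C c1 (m \<cdot> k)"
      using ex_cokernel[of "m \<cdot> k"] k' m' g p by auto
    ultimately have mk: "is_kernel C (m \<cdot> k) c1" by (rule mono_is_kernel_of_cokernel)
    note c1' = cokernel_arr[OF c1]
    have D: "Dom C c1 = Cod C m" "Dom C c = Cod C m" "Dom C (m \<cdot> k) = Dom C k"
      "Cod C k = Dom C m" "Cod C f = Cod C m" "Dom C g = Dom C m" "Dom C p = Dom C f"
      using c1'(3) m'(3) k'(1,3) m'(1) g(2) p(2,3) c(3) by simp_all
    have "c1 \<cdot> f = ((c1 \<cdot> (m \<cdot> k)) \<cdot> p1)"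
      using c1'(1) m'(1) k'(1) p1 D(1,4,5) p reassoc[OF p1(4)] by simp
    also have "\<dots> = Zro C (Dom C f) (Cod C c1)"
      unfolding c1'(4) using c1'(1) m'(1) k'(1) p1 D p(1,2) by simp
    finally obtain c2 where c2: "c2 \<in> Arr C" "Dom C c2 = Cod C c" "Cod C c2 = Cod C c1" "c2 \<cdot> c = c1"
      by - (rule cokernel_desc[OF assms c1'(1) _ refl]; use D in simp)
    have "c1 \<cdot> m = Zro C (Dom C m) (Cod C c1)"
      using reassoc[OF c2(4) _ c2(1) m'(1)] c2(1-3) c m' by simp
    then obtain s where s: "s \<in> Arr C" "Dom C s = Dom C m" "Cod C s = Dom C (m \<cdot> k)" "(m \<cdot> k) \<cdot> s = m"
      by - (rule kernel_lift[OF mk m'(1) refl]; use D in simp)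
    have s': "Cod C s = Dom C k" using s(3) D(3) by simp
    have "m \<cdot> (k \<cdot> s) = m \<cdot> Idt C (Dom C m)"
      using s(1,2,4) s' k'(1) m'(1) D(4) by simp
    then have "k \<cdot> s = Idt C (Dom C m)"
      by - (rule mono_cancel[OF kernel_mono[OF m]]; use s(1,2) s' k'(1) m'(1) D in simp)
    then have "g \<cdot> (k \<cdot> s) = g" using g(1) D(6) by simp
    moreover have "g \<cdot> (k \<cdot> s) = Zro C (Cod C p) W"
      using reassoc[OF k'(4), of s] k'(1-3) s(1,2) s' g(1,3) W p(1,3) by simp
    ultimately show "g = Zro C (Cod C p) W" by simp
  qed (use p in simp)
  then have "is_image C f p m"
    using p c m' kernel_mono[OF m] by (simp add: is_image_def)
  then show ?thesis using m that by blast
qed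

lemma image_exists:
  assumes "f \<in> Arr C" obtains p m where "is_image C f p m"
proof -
  obtain c where "is_cokernel C c f" using ex_cokernel[OF assms] by blast
  then show ?thesis using image_is_kernel_of_cokernel that by blast
qed

lemma image_arr:
  assumes "is_image C f p m"
  shows "p \<in> Arr C" "Dom C p = Dom C f" "Cod C p = Dom C m" "m \<cdot> p = f" "is_epi C p"
    "m \<in> Arr C" "Cod C m = Cod C f" "f \<in> Arr C" "is_mono C m"
  using assms epi_arr[of p] mono_arr[of m] unfolding is_image_def by metis+

lemma exact_at_arr:
  assumes "exact_at C f g"
  shows "f \<in> Arr C" "g \<in> Arr C" "Cod C f = Dom C g" "g \<cdot> f = Zro C (Dom C f) (Cod C g)"
proof -
  obtain p m where pm: "is_image C f p m" "is_kernel C m g" using assms by (auto simp: exact_at_def)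
  note m = kernel_arr[OF pm(2)]
  note p = image_arr[OF pm(1)]
  show "f \<in> Arr C" "g \<in> Arr C" "Cod C f = Dom C g" using p m by auto
  have "g \<cdot> (m \<cdot> p) = Zro C (Dom C f) (Cod C g)" using reassoc[OF m(4) _ _ p(1)] p(1-3) m by simp
  then show "g \<cdot> f = Zro C (Dom C f) (Cod C g)" by (simp only: p(4))
qed

lemma biproduct:
  assumes "X \<in> Ob C" "Y \<in> Ob C"
  shows "\<exists>Z p1 p2 i1. p1 \<in> Arr C \<and> Dom C p1 = Z \<and> Cod C p1 = X \<and>
    p2 \<in> Arr C \<and> Dom C p2 = Z \<and> Cod C p2 = Y \<and>
    i1 \<in> Arr C \<and> Dom C i1 = X \<and> Cod C i1 = Z \<and>
    p1 \<cdot> i1 = Idt C X \<and> p2 \<cdot> i1 = Zro C X Y \<and>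
    (\<forall>f g. f \<in> Arr C \<and> g \<in> Arr C \<and> Dom C f = Dom C g \<and> Cod C f = X \<and> Cod C g = Y \<longrightarrow>
      (\<exists>h. h \<in> Arr C \<and> Dom C h = Dom C g \<and> Cod C h = Z \<and> p1 \<cdot> h = f \<and> p2 \<cdot> h = g)) \<and>
    (\<forall>h k. h \<in> Arr C \<and> k \<in> Arr C \<and> Dom C h = Dom C k \<and> Cod C h = Z \<and> Cod C k = Z \<and>
      p1 \<cdot> h = p1 \<cdot> k \<and> p2 \<cdot> h = p2 \<cdot> k \<longrightarrow> h = k)"
proof -
  obtain Z p1 p2 where "is_product C X Y Z p1 p2" using ex_product assms by blast
  then have p: "p1 \<in> Hom C Z X" "p2 \<in> Hom C Z Y"
    and u: "\<And>W f g. f \<in> Hom C W X \<Longrightarrow> g \<in> Hom C W Y \<Longrightarrow>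
      \<exists>!h. h \<in> Hom C W Z \<and> p1 \<cdot> h = f \<and> p2 \<cdot> h = g"
    unfolding is_product_def by blast+
  have ex: "\<exists>h. h \<in> Arr C \<and> Dom C h = Dom C g \<and> Cod C h = Z \<and> p1 \<cdot> h = f \<and> p2 \<cdot> h = g"
    if "f \<in> Arr C \<and> g \<in> Arr C \<and> Dom C f = Dom C g \<and> Cod C f = X \<and> Cod C g = Y" for f g
    using u[of f "Dom C g" g] that by (auto simp: Hom_def)
  have un: "h = k"
    if "h \<in> Arr C \<and> k \<in> Arr C \<and> Dom C h = Dom C k \<and> Cod C h = Z \<and> Cod C k = Z \<and>
      p1 \<cdot> h = p1 \<cdot> k \<and> p2 \<cdot> h = p2 \<cdot> k" for h k
    using u[of "p1 \<cdot> k" "Dom C k" "p2 \<cdot> k"] that p by (auto simp: Hom_def)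
  obtain i1 where i: "i1 \<in> Arr C" "Dom C i1 = X" "Cod C i1 = Z" "p1 \<cdot> i1 = Idt C X" "p2 \<cdot> i1 = Zro C X Y"
    using ex[of "Idt C X" "Zro C X Y"] assms by auto
  have p': "p1 \<in> Arr C" "Dom C p1 = Z" "Cod C p1 = X" "p2 \<in> Arr C" "Dom C p2 = Z" "Cod C p2 = Y"
    using p by (auto simp: Hom_def)
  show ?thesis
    by (rule exI[of _ Z], rule exI[of _ p1], rule exI[of _ p2], rule exI[of _ i1])
      (use p' i ex un in blast)
qed

lemma Proj_ob: "P \<in> Proj C \<Longrightarrow> P \<in> Ob C"
  by (simp add: Proj_def)

lemma Proj_lift:
  assumes "P \<in> Proj C" "is_epi C g" "f \<in> Arr C" "Dom C f = P" "Cod C f = Cod C g"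
  obtains h where "h \<in> Arr C" "Dom C h = P" "Cod C h = Dom C g" "g \<cdot> h = f"
proof -
  have "f \<in> Hom C P (Cod C g)" using assms by (simp add: Hom_def)
  then obtain h where "h \<in> Hom C P (Dom C g)" "g \<cdot> h = f"
    using assms(1,2) unfolding Proj_def by blast
  then show ?thesis using that unfolding Hom_def by blast
qed

end


section \<open>Exactness tested on morphisms from projectives\<close>

text \<open>If there are enough projectives, the functors \<open>Hom(P, -)\<close> for projective \<open>P\<close> are exact and jointly
  detect monomorphisms, epimorphisms and exactness.  Morphisms with projective domain therefore serve
  as elements in diagram chases.\<close>

definition elt :: "('o, 'm) catg \<Rightarrow> 'm \<Rightarrow> 'o \<Rightarrow> bool" where
  "elt C x Y \<longleftrightarrow> x \<in> Arr C \<and> Dom C x \<in> Proj C \<and> Cod C x = Y"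

context abelian_cat
begin

lemma elt_arr:
  assumes "elt C x Y"
  shows "x \<in> Arr C" "Dom C x \<in> Proj C" "Dom C x \<in> Ob C" "Cod C x = Y"
  using assms by (auto simp: elt_def)

lemma exact_at_lift:
  assumes "exact_at C f g" "y \<in> Arr C" "Dom C y = P" "P \<in> Proj C" "Cod C y = Dom C g"
    "g \<cdot> y = Zro C P (Cod C g)"
  obtains x where "x \<in> Arr C" "Dom C x = P" "Cod C x = Dom C f" "f \<cdot> x = y"
proof -
  obtain p m where pm: "is_image C f p m" "is_kernel C m g"
    using assms(1) by (auto simp: exact_at_def)
  note m = kernel_arr[OF pm(2)]
  note p = image_arr[OF pm(1)]
  obtain y1 where y1: "y1 \<in> Arr C" "Dom C y1 = P" "Cod C y1 = Dom C m" "m \<cdot> y1 = y"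
    using kernel_lift[OF pm(2) assms(2,3,5,6)] .
  obtain x where "x \<in> Arr C" "Dom C x = P" "Cod C x = Dom C p" "p \<cdot> x = y1"
    using Proj_lift[OF assms(4) p(5) y1(1,2)] y1 p by auto
  moreover from this have "f \<cdot> x = y" using p(1-3) m(1) y1 assoc[of x p m] by (simp add: p(4))
  ultimately show ?thesis using p(2) that by simp
qed

lemma epi_lift:
  assumes "is_epi C f" "elt C y (Cod C f)"
  obtains x where "elt C x (Dom C f)" "Dom C x = Dom C y" "f \<cdot> x = y"
  using Proj_lift[of "Dom C y" f y] assms that by (auto simp: elt_def)

lemma exact_lift:
  assumes "exact_at C f g" "elt C y (Dom C g)" "g \<cdot> y = Zro C (Dom C y) (Cod C g)"
  obtains x where "elt C x (Dom C f)" "Dom C x = Dom C y" "f \<cdot> x = y"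
  using exact_at_lift[OF assms(1), of y "Dom C y"] assms that by (auto simp: elt_def)

end

locale abelian_cat_ep = abelian_cat +
  assumes ep: "enough_projectives C"
begin

lemma cover:
  assumes "X \<in> Ob C"
  obtains r where "elt C r X" "is_epi C r"
  using ep assms unfolding enough_projectives_def elt_def by (auto simp: Hom_def)

lemma mono_elt:
  assumes f: "f \<in> Arr C"
    and 0: "\<And>x. \<lbrakk>elt C x (Dom C f); f \<cdot> x = Zro C (Dom C x) (Cod C f)\<rbrakk> \<Longrightarrow> x = Zro C (Dom C x) (Dom C f)"
  shows "is_mono C f"
proof (rule monoI)
  fix g W assume g: "g \<in> Arr C" "Dom C g = W" "Cod C g = Dom C f" "f \<cdot> g = Zro C W (Cod C f)"
  then have W: "W \<in> Ob C" by auto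
  obtain r where r: "elt C r W" "is_epi C r" using cover[OF W] .
  note r' = elt_arr[OF r(1)]
  have "f \<cdot> (g \<cdot> r) = Zro C (Dom C r) (Cod C f)"
    using reassoc[OF g(4), of r] g(1-3) f r' W by simp
  then have "g \<cdot> r = Zro C (Dom C (g \<cdot> r)) (Dom C f)"
    using g r r' f by (intro 0) (auto simp: elt_def)
  then have "g \<cdot> r = Zro C (Dom C r) (Dom C f)" using g r' by simp
  from epi_zero[OF r(2) this] show "g = Zro C W (Dom C f)" using g r' by simp
qed fact

lemma epi_elt:
  assumes f: "f \<in> Arr C"
    and 0: "\<And>y. elt C y (Cod C f) \<Longrightarrow> \<exists>x. x \<in> Arr C \<and> Cod C x = Dom C f \<and> f \<cdot> x = y"
  shows "is_epi C f"
proof (rule epiI)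
  fix g W assume g: "g \<in> Arr C" "Dom C g = Cod C f" "Cod C g = W" "g \<cdot> f = Zro C (Dom C f) W"
  then have W: "W \<in> Ob C" by auto
  obtain r where r: "elt C r (Cod C f)" "is_epi C r" using cover[of "Cod C f"] f by auto
  note r' = elt_arr[OF r(1)]
  obtain x where x: "x \<in> Arr C" "Cod C x = Dom C f" "f \<cdot> x = r" using 0[OF r(1)] by blast
  have "g \<cdot> (f \<cdot> x) = Zro C (Dom C x) W" using reassoc[OF g(4), of x] g f x(1,2) W by simp
  then have "g \<cdot> r = Zro C (Dom C r) W" using x f by auto
  from epi_zero[OF r(2) this] show "g = Zro C (Cod C f) W" using g r' by simp
qed fact

lemma exact_elt:
  assumes fg: "f \<in> Arr C" "g \<in> Arr C" "Cod C f = Dom C g" "g \<cdot> f = Zro C (Dom C f) (Cod C g)"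
    and 0: "\<And>y. \<lbrakk>elt C y (Dom C g); g \<cdot> y = Zro C (Dom C y) (Cod C g)\<rbrakk>
      \<Longrightarrow> \<exists>x. x \<in> Arr C \<and> Cod C x = Dom C f \<and> f \<cdot> x = y"
  shows "exact_at C f g"
proof -
  obtain c where c: "is_cokernel C c f" using ex_cokernel[OF fg(1)] by blast
  note c' = cokernel_arr[OF c]
  obtain p m where pm: "is_image C f p m" "is_kernel C m c"
    using image_is_kernel_of_cokernel[OF c] .
  note m = kernel_arr[OF pm(2)]
  note p = image_arr[OF pm(1)]
  have D: "Dom C c = Dom C g" "Cod C m = Dom C g" "Cod C f = Dom C g" using c' m fg by auto
  have "(g \<cdot> m) \<cdot> p = Zro C (Dom C p) (Cod C g)" using fg(4) p(1-4) m(1) fg(2) D by simp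
  from epi_zero[OF p(5) this] have gm: "g \<cdot> m = Zro C (Dom C m) (Cod C g)" using p(3) fg m D by simp
  have "is_kernel C m g"
  proof (rule kernelI)
    fix y assume y: "y \<in> Arr C" "Cod C y = Dom C g" "g \<cdot> y = Zro C (Dom C y) (Cod C g)"
    obtain r where r: "elt C r (Dom C y)" "is_epi C r" using cover[of "Dom C y"] y by auto
    note r' = elt_arr[OF r(1)]
    have "g \<cdot> (y \<cdot> r) = Zro C (Dom C r) (Cod C g)" using reassoc[OF y(3), of r] y(1,2) fg(2) r' by simp
    then obtain x where x: "x \<in> Arr C" "Cod C x = Dom C f" "f \<cdot> x = y \<cdot> r"
      using 0[of "y \<cdot> r"] y r' by (auto simp: elt_def)
    have dx: "Dom C x = Dom C r" using arg_cong[OF x(3), of "Dom C"] x(1,2) fg(1) y(1) r' by simp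
    have "(c \<cdot> y) \<cdot> r = c \<cdot> (f \<cdot> x)" using x c'(1) y(1,2) r' D by simp
    also have "\<dots> = Zro C (Dom C r) (Cod C c)" using reassoc[OF c'(4), of x] x c'(1) fg D dx by simp
    finally have "c \<cdot> y = Zro C (Dom C y) (Cod C c)"
      using epi_zero[OF r(2), of "c \<cdot> y"] c'(1) y(1,2) r' D by simp
    then show "\<exists>h. h \<in> Arr C \<and> Dom C h = Dom C y \<and> Cod C h = Dom C m \<and> m \<cdot> h = y"
      by - (rule kernel_lift[OF pm(2) y(1) refl]; use y(2) D in auto)
  qed (use kernel_mono[OF pm(2)] fg D gm in auto)
  then show ?thesis using pm unfolding exact_at_def by blast
qed

lemma exact_epi_cokernel:
  assumes "exact_at C f g" "is_epi C g" shows "is_cokernel C g f"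
proof (rule cokernelI)
  note fg = exact_at_arr[OF assms(1)]
  fix h assume h: "h \<in> Arr C" "Dom C h = Cod C f" "h \<cdot> f = Zro C (Dom C f) (Cod C h)"
  obtain k where k: "is_kernel C k g" using ex_kernel[OF fg(2)] by blast
  note k' = kernel_arr[OF k]
  have c: "is_cokernel C g k" using epi_is_cokernel_of_kernel[OF assms(2) k] .
  obtain r where r: "elt C r (Dom C k)" "is_epi C r" using cover[of "Dom C k"] k' by auto
  note r' = elt_arr[OF r(1)]
  have "g \<cdot> (k \<cdot> r) = Zro C (Dom C r) (Cod C g)" using reassoc[OF k'(4), of r] k' r' by simp
  then obtain x where x: "x \<in> Arr C" "Dom C x = Dom C r" "Cod C x = Dom C f" "f \<cdot> x = k \<cdot> r"
    using exact_at_lift[OF assms(1), of "k \<cdot> r" "Dom C r"] k' r' by auto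
  have "(h \<cdot> k) \<cdot> r = h \<cdot> (f \<cdot> x)" using x h(1,2) k' r' fg by simp
  also have "\<dots> = Zro C (Dom C r) (Cod C h)" using reassoc[OF h(3), of x] x h(1,2) fg by simp
  finally have "h \<cdot> k = Zro C (Dom C k) (Cod C h)"
    using epi_zero[OF r(2), of "h \<cdot> k"] h(1,2) k' r' fg by simp
  then show "\<exists>h'. h' \<in> Arr C \<and> Dom C h' = Cod C g \<and> Cod C h' = Cod C h \<and> h' \<cdot> g = h"
    by - (rule cokernel_desc[OF c h(1) _ refl]; use h(2) k' fg in auto)
qed (use exact_at_arr[OF assms(1)] assms in auto)

lemma cokernel_exact:
  assumes "is_cokernel C g f" shows "exact_at C f g" "is_epi C g"
proof -
  obtain p m where "is_image C f p m" "is_kernel C m g" using image_is_kernel_of_cokernel[OF assms] .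
  then show "exact_at C f g" unfolding exact_at_def by blast
qed (rule cokernel_epi[OF assms])

lemma kernel_epi_short_exact:
  assumes "is_kernel C k f" "is_epi C f" shows "short_exact C k f"
  using kernel_mono[OF assms(1)] assms cokernel_exact(1)[OF epi_is_cokernel_of_kernel[OF assms(2,1)]]
  by (simp add: short_exact_def)

lemma mono_cokernel_short_exact:
  assumes "is_cokernel C c f" "is_mono C f" shows "short_exact C f c"
  using cokernel_exact[OF assms(1)] assms by (simp add: short_exact_def)

lemma short_exact_arr:
  assumes "short_exact C f g"
  shows "f \<in> Arr C" "g \<in> Arr C" "Cod C f = Dom C g" "g \<cdot> f = Zro C (Dom C f) (Cod C g)"
    "is_mono C f" "is_epi C g" "exact_at C f g"
  using assms exact_at_arr[of f g] by (simp_all add: short_exact_def)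

lemma short_exact_cokernel: "short_exact C f g \<Longrightarrow> is_cokernel C g f"
  by (simp add: short_exact_def exact_epi_cokernel)

lemma short_exact_kernel:
  assumes "short_exact C f g" shows "is_kernel C f g"
proof -
  have c: "is_cokernel C g f" using short_exact_cokernel[OF assms] .
  show ?thesis by (rule mono_is_kernel_of_cokernel[OF _ c]) (use assms in \<open>simp add: short_exact_def\<close>)
qed

text \<open>This is the mapping cone of the morphism \<open>(s, t)\<close> from the right exact sequence \<open>d, p1\<close> to the short
  exact sequence \<open>j, p\<close>.  It is exact because the morphism is the identity on the last terms.  It serves
  as a presentation of the middle term of \<open>j, p\<close>, the pushout of \<open>d\<close> along \<open>s\<close>.\<close>

lemma mapping_cone_exact:
  assumes jp: "short_exact C j p" and d: "exact_at C d p1" "is_epi C p1" "Cod C p1 = Cod C p"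
    and t: "t \<in> Arr C" "Dom C t = Dom C p1" "Cod C t = Dom C p" "p \<cdot> t = p1"
    and s: "s \<in> Arr C" "Dom C s = Dom C d" "Cod C s = Dom C j" "j \<cdot> s = t \<cdot> d"
  shows "\<exists>S r1 r2 i b c. r1 \<in> Arr C \<and> Dom C r1 = S \<and> Cod C r1 = Dom C j \<and>
    r2 \<in> Arr C \<and> Dom C r2 = S \<and> Cod C r2 = Dom C p1 \<and>
    i \<in> Arr C \<and> Dom C i = Dom C j \<and> Cod C i = S \<and>
    r1 \<cdot> i = Idt C (Dom C j) \<and> r2 \<cdot> i = Zro C (Dom C j) (Dom C p1) \<and>
    b \<in> Arr C \<and> Dom C b = Dom C d \<and> Cod C b = S \<and> r1 \<cdot> b = Neg C s \<and> r2 \<cdot> b = d \<and>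
    c \<in> Arr C \<and> Dom C c = S \<and> Cod C c = Dom C p \<and> c \<cdot> i = j \<and> exact_at C b c \<and> is_epi C c"
proof -
  note J = short_exact_arr[OF jp] and D = exact_at_arr[OF d(1)]
  obtain S r1 r2 i where r: "r1 \<in> Arr C" "Dom C r1 = S" "Cod C r1 = Dom C j"
    "r2 \<in> Arr C" "Dom C r2 = S" "Cod C r2 = Dom C p1"
    "i \<in> Arr C" "Dom C i = Dom C j" "Cod C i = S"
    "r1 \<cdot> i = Idt C (Dom C j)" "r2 \<cdot> i = Zro C (Dom C j) (Dom C p1)"
    and ex: "\<forall>f g. f \<in> Arr C \<and> g \<in> Arr C \<and> Dom C f = Dom C g \<and> Cod C f = Dom C j \<and> Cod C g = Dom C p1
      \<longrightarrow> (\<exists>h. h \<in> Arr C \<and> Dom C h = Dom C g \<and> Cod C h = S \<and> r1 \<cdot> h = f \<and> r2 \<cdot> h = g)"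
    and un: "\<forall>h k. h \<in> Arr C \<and> k \<in> Arr C \<and> Dom C h = Dom C k \<and> Cod C h = S \<and> Cod C k = S \<and>
      r1 \<cdot> h = r1 \<cdot> k \<and> r2 \<cdot> h = r2 \<cdot> k \<longrightarrow> h = k"
    using biproduct[OF arr_ob(1)[OF J(1)] arr_ob(1)[OF D(2)]] by blast
  obtain c where cd: "c = Add C (j \<cdot> r1) (t \<cdot> r2)" by blast
  have c: "c \<in> Arr C" "Dom C c = S" "Cod C c = Dom C p" using r(1-6) t(1-3) J cd by simp_all
  have cv: "c \<cdot> v = Add C (j \<cdot> (r1 \<cdot> v)) (t \<cdot> (r2 \<cdot> v))" if "v \<in> Arr C" "Cod C v = S" for v
    using that r(1-6) t(1-3) J cd by simp
  have ci: "c \<cdot> i = j" using cv[of i] r J t(1-3) D by simp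
  obtain b where b: "b \<in> Arr C" "Dom C b = Dom C d" "Cod C b = S" "r1 \<cdot> b = Neg C s" "r2 \<cdot> b = d"
    using ex[rule_format, of "Neg C s" d] s(1-3) D by auto
  have cepi: "is_epi C c"
  proof (rule epi_elt[OF c(1)])
    fix y assume "elt C y (Cod C c)"
    then have y: "elt C y (Dom C p)" using c by simp
    note y' = elt_arr[OF y]
    have "elt C (p \<cdot> y) (Cod C p1)" using y' J d(3) by (simp add: elt_def)
    then obtain w where w: "elt C w (Dom C p1)" "Dom C w = Dom C (p \<cdot> y)" "p1 \<cdot> w = p \<cdot> y"
      using epi_lift[OF d(2)] by blast
    note w' = elt_arr[OF w(1)]
    have dw: "Dom C w = Dom C y" using w(2) y' J by simp
    let ?z = "Sub C y (t \<cdot> w)"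
    have "p \<cdot> ?z = Zro C (Dom C y) (Cod C p)"
      using reassoc[OF t(4), of w] w(3) w' dw y' t(1-3) J by simp
    then obtain z where z: "z \<in> Arr C" "Dom C z = Dom C y" "Cod C z = Dom C j" "j \<cdot> z = ?z"
      by - (rule kernel_lift[OF short_exact_kernel[OF jp], of ?z "Dom C y"]; use w' dw y' t(1-3) in simp)
    obtain v where v: "v \<in> Arr C" "Cod C v = S" "r1 \<cdot> v = z" "r2 \<cdot> v = w"
      using ex[rule_format, of z w] z w' dw by auto
    have "c \<cdot> v = Add C ?z (t \<cdot> w)" using cv[of v] v z(4) by simp
    also have "\<dots> = y" by (rule sub_add_cancel) (use w' dw y' t(1-3) in simp_all)
    finally show "\<exists>x. x \<in> Arr C \<and> Cod C x = Dom C c \<and> c \<cdot> x = y" using v c(2) by auto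
  qed
  have exb: "exact_at C b c"
  proof (rule exact_elt)
    have "c \<cdot> b = Add C (Neg C (j \<cdot> s)) (j \<cdot> s)" using cv[of b] b s J by simp
    also have "\<dots> = Zro C (Dom C d) (Dom C p)" using add_neg[of "j \<cdot> s"] s(1-3) J by simp
    finally show "c \<cdot> b = Zro C (Dom C b) (Cod C c)" using b c by simp
    fix y assume "elt C y (Dom C c)" "c \<cdot> y = Zro C (Dom C y) (Cod C c)"
    then have y: "elt C y S" "c \<cdot> y = Zro C (Dom C y) (Dom C p)" using c by simp_all
    note y' = elt_arr[OF y(1)]
    obtain g w where gw: "g = r1 \<cdot> y" "w = r2 \<cdot> y" by blast
    have g: "g \<in> Arr C" "Dom C g = Dom C y" "Cod C g = Dom C j" and w: "elt C w (Dom C p1)" "Dom C w = Dom C y"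
      using gw y' r(1-6) by (simp_all add: elt_def)
    note w' = elt_arr[OF w(1)]
    have sum: "Add C (j \<cdot> g) (t \<cdot> w) = Zro C (Dom C y) (Dom C p)" using cv[of y] y' y(2) gw by simp
    have "p \<cdot> Add C (j \<cdot> g) (t \<cdot> w) = p1 \<cdot> w"
      using reassoc[OF J(4), of g] reassoc[OF t(4), of w] g w(2) w' t(1-3) J D(2) d(3) by simp
    then have "p1 \<cdot> w = Zro C (Dom C w) (Cod C p1)" unfolding sum using J y' w(2) d(3) by simp
    then obtain x where x: "elt C x (Dom C d)" "Dom C x = Dom C w" "d \<cdot> x = w"
      using exact_lift[OF d(1) w(1)] by blast
    note x' = elt_arr[OF x(1)]
    have sx: "s \<cdot> x \<in> Arr C" "Dom C (s \<cdot> x) = Dom C y" "Cod C (s \<cdot> x) = Dom C j"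
      using x' x(2) w(2) s(1-3) by simp_all
    have "j \<cdot> (s \<cdot> x) = t \<cdot> (d \<cdot> x)"
      by (rule reassoc2[OF s(4)]) (use s(1-3) t(1-3) D x' J in simp_all)
    then have "j \<cdot> Add C g (s \<cdot> x) = Zro C (Dom C y) (Dom C p)"
      using sum x(3) g sx J cmp_add_distr[of g "s \<cdot> x" j] by simp
    then have "Add C g (s \<cdot> x) = Zro C (Dom C (s \<cdot> x)) (Cod C (s \<cdot> x))"
      by - (rule mono_zero[OF J(5)]; use g sx J in simp)
    then have gs: "g = Neg C (s \<cdot> x)" by - (rule add_zero_neg; use g sx in simp)
    have "b \<cdot> x = y"
    proof (rule un[rule_format], intro conjI)
      show "r1 \<cdot> (b \<cdot> x) = r1 \<cdot> y"
        using reassoc[OF b(4), of x] b(1-3) x' r(1-3) s(1-3) gs gw(1) by simp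
      show "r2 \<cdot> (b \<cdot> x) = r2 \<cdot> y"
        using reassoc[OF b(5), of x] b(1-3) x' r(4-6) D x(3) gw(2) by simp
    qed (use b(1-3) x' x(2) w(2) y' in simp_all)
    then show "\<exists>x. x \<in> Arr C \<and> Cod C x = Dom C b \<and> b \<cdot> x = y" using x' b(2) by auto
  qed (use b c in simp_all)
  show ?thesis
    by (rule exI[of _ S], rule exI[of _ r1], rule exI[of _ r2], rule exI[of _ i], rule exI[of _ b],
      rule exI[of _ c]) (use r b c ci exb cepi in simp)
qed

end

section \<open>Functors and adjunctions\<close>

lemma comp_ftor_simps [simp]:
  "fob (S \<circ>\<^sub>F T) X = fob S (fob T X)" "far (S \<circ>\<^sub>F T) f = far S (far T f)"
  by (simp_all add: comp_ftor_def)

lemma id_ftor_simps [simp]: "fob id_ftor X = X" "far id_ftor f = f"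
  by (simp_all add: id_ftor_def)

lemma is_functor_comp: "\<lbrakk>is_functor C D S; is_functor D E T\<rbrakk> \<Longrightarrow> is_functor C E (T \<circ>\<^sub>F S)"
  unfolding is_functor_def by (simp add: Hom_def)

lemma is_functor_id: "is_functor C C id_ftor"
  unfolding is_functor_def by simp

lemma nat_trans_arr:
  assumes "nat_trans C D S T \<tau>" "X \<in> Ob C"
  shows "\<tau> X \<in> Arr D" "Dom D (\<tau> X) = fob S X" "Cod D (\<tau> X) = fob T X"
  using assms by (auto simp: nat_trans_def Hom_def)

lemma nat_trans_nat:
  assumes "nat_trans C D S T \<tau>" "f \<in> Arr C"
  shows "\<tau> (Cod C f) \<cdot>\<^bsub>D\<^esub> far S f = far T f \<cdot>\<^bsub>D\<^esub> \<tau> (Dom C f)"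
  using assms unfolding nat_trans_def Hom_def by blast

lemma nat_iso_nat_trans: "nat_iso C D S T \<tau> \<Longrightarrow> nat_trans C D S T \<tau>"
  and nat_iso_iso: "nat_iso C D S T \<tau> \<Longrightarrow> X \<in> Ob C \<Longrightarrow> is_iso_arr D (\<tau> X)"
  by (auto simp: nat_iso_def)

locale ftr = C: cat C + D: cat D
  for C :: "('o1, 'm1) catg" and D :: "('o2, 'm2) catg" +
  fixes T :: "('o1, 'm1, 'o2, 'm2) ftor"
  assumes ftr: "is_functor C D T"
begin

lemma far_arr [simp]:
  assumes "f \<in> Arr C"
  shows "far T f \<in> Arr D" "Dom D (far T f) = fob T (Dom C f)" "Cod D (far T f) = fob T (Cod C f)"
  using ftr assms by (auto simp: is_functor_def Hom_def)

lemma fob_ob [simp]: "X \<in> Ob C \<Longrightarrow> fob T X \<in> Ob D"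
  and far_idt [simp]: "X \<in> Ob C \<Longrightarrow> far T (Idt C X) = Idt D (fob T X)"
  using ftr by (auto simp: is_functor_def)

lemma far_cmp [simp]:
  "\<lbrakk>f \<in> Arr C; g \<in> Arr C; Cod C f = Dom C g\<rbrakk> \<Longrightarrow> far T (g \<cdot>\<^bsub>C\<^esub> f) = far T g \<cdot>\<^bsub>D\<^esub> far T f"
  using ftr by (auto simp: is_functor_def Hom_def)

end

lemma (in ftr) far_iso:
  assumes "is_iso_arr C f" shows "is_iso_arr D (far T f)"
proof -
  obtain g where g: "inverse_arrows C f g" using assms by (auto simp: is_iso_arr_def)
  then have g': "f \<in> Arr C" "g \<in> Arr C" "Dom C g = Cod C f" "Cod C g = Dom C f"
    "g \<cdot>\<^bsub>C\<^esub> f = Idt C (Dom C f)" "f \<cdot>\<^bsub>C\<^esub> g = Idt C (Cod C f)"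
    by (auto simp: inverse_arrows_def Hom_def)
  have "inverse_arrows D (far T f) (far T g)"
    using g'(1-4) far_cmp[of f g] far_cmp[of g f] unfolding g'(5,6)
    by (simp add: inverse_arrows_def Hom_def)
  then show ?thesis by (auto simp: is_iso_arr_def)
qed

locale additive_ftr = C: preadditive_cat C + D: preadditive_cat D
  for C :: "('o1, 'm1) catg" and D :: "('o2, 'm2) catg" +
  fixes T :: "('o1, 'm1, 'o2, 'm2) ftor"
  assumes additive: "additive_functor C D T"

sublocale additive_ftr \<subseteq> ftr C D T
  by unfold_locales (use additive in \<open>simp add: additive_functor_def\<close>)

context additive_ftr
begin

lemma far_add [simp]:
  "\<lbrakk>f \<in> Arr C; g \<in> Arr C; Dom C f = Dom C g; Cod C f = Cod C g\<rbrakk>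
    \<Longrightarrow> far T (Add C f g) = Add D (far T f) (far T g)"
  using additive by (auto simp: additive_functor_def Hom_def)

lemma far_zro [simp]:
  assumes "X \<in> Ob C" "Y \<in> Ob C" shows "far T (Zro C X Y) = Zro D (fob T X) (fob T Y)"
proof -
  have "Add C (Zro C X Y) (Zro C X Y) = Zro C X Y" using assms by simp
  then have "Add D (far T (Zro C X Y)) (far T (Zro C X Y)) = far T (Zro C X Y)"
    using far_add[of "Zro C X Y" "Zro C X Y"] assms by (simp del: C.zro_add)
  then show ?thesis using D.add_idem_zro[of "far T (Zro C X Y)"] assms by simp
qed

lemma far_neg [simp]: "f \<in> Arr C \<Longrightarrow> far T (Neg C f) = Neg D (far T f)"
  using far_add[of "Neg C f" f] by (intro D.add_zero_neg) auto

lemma far_sub [simp]: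
  "\<lbrakk>f \<in> Arr C; g \<in> Arr C; Dom C f = Dom C g; Cod C f = Cod C g\<rbrakk>
    \<Longrightarrow> far T (Sub C f g) = Sub D (far T f) (far T g)"
  by (simp add: Sub_def)

lemma far_zero_ob: "zero_object C X \<Longrightarrow> zero_object D (fob T X)"
proof -
  assume z: "zero_object C X"
  then have X: "X \<in> Ob C" by (simp add: zero_object_def)
  have "Idt C X = Zro C X X" by (rule C.zero_ob_zro[OF z]) (use X in simp_all)
  then have "Idt D (fob T X) = Zro D (fob T X) (fob T X)"
    using far_idt[OF X] far_zro[OF X X] by simp
  then show ?thesis using D.idt_zro_zero_ob X by simp
qed

end

lemma additive_comp:
  assumes "additive_functor C D S" "additive_functor D E T"
  shows "additive_functor C E (T \<circ>\<^sub>F S)"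
proof -
  have "far S f \<in> Hom D (fob S X) (fob S Y)" if "f \<in> Hom C X Y" for f X Y
    using assms(1) that by (auto simp: additive_functor_def is_functor_def)
  then show ?thesis
    using assms is_functor_comp[of C D S E T] unfolding additive_functor_def by simp metis
qed

locale exact_ftr = C: abelian_cat_ep C + D: abelian_cat_ep D
  for C :: "('o1, 'm1) catg" and D :: "('o2, 'm2) catg" +
  fixes T :: "('o1, 'm1, 'o2, 'm2) ftor"
  assumes exact: "exact_functor C D T"

sublocale exact_ftr \<subseteq> additive_ftr C D T
  by unfold_locales (use exact in \<open>simp add: exact_functor_def\<close>)

context exact_ftr
begin

lemma far_short_exact: "short_exact C f g \<Longrightarrow> short_exact D (far T f) (far T g)"
  using exact unfolding exact_functor_def by blast

lemma far_mono: assumes "is_mono C f" shows "is_mono D (far T f)"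
proof -
  obtain c where "is_cokernel C c f" using C.ex_cokernel[OF C.mono_arr[OF assms]] by blast
  then have "short_exact C f c" using C.mono_cokernel_short_exact assms by blast
  then show ?thesis using far_short_exact unfolding short_exact_def by blast
qed

lemma far_epi: assumes "is_epi C f" shows "is_epi D (far T f)"
proof -
  obtain k where "is_kernel C k f" using C.ex_kernel[OF C.epi_arr[OF assms]] by blast
  then have "short_exact C k f" using C.kernel_epi_short_exact assms by blast
  then show ?thesis using far_short_exact unfolding short_exact_def by blast
qed

text \<open>Only short exact sequences are preserved by definition; for exactness at one term the second map
  is replaced by its coimage.\<close>

lemma far_exact_at: assumes "exact_at C f g" shows "exact_at D (far T f) (far T g)"
proof -
  note fg = C.exact_at_arr[OF assms]
  obtain p m where pm: "is_image C f p m" "is_kernel C m g"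
    using assms unfolding exact_at_def by blast
  note pm' = C.image_arr[OF pm(1)] and k = C.kernel_arr[OF pm(2)]
  obtain p1 m1 where i1: "is_image C g p1 m1" using C.image_exists[OF fg(2)] .
  note i1' = C.image_arr[OF i1]
  have "is_kernel C m p1"
  proof (rule C.kernelI[OF pm'(9) i1'(1)])
    have "m1 \<cdot>\<^bsub>C\<^esub> (p1 \<cdot>\<^bsub>C\<^esub> m) = Zro C (Dom C m) (Cod C g)"
      using C.reassoc[OF i1'(4), of m] i1' k by simp
    from C.mono_zero[OF i1'(9) this] show "p1 \<cdot>\<^bsub>C\<^esub> m = Zro C (Dom C m) (Cod C p1)"
      using i1' k by simp
    fix x assume x: "x \<in> Arr C" "Cod C x = Dom C p1" "p1 \<cdot>\<^bsub>C\<^esub> x = Zro C (Dom C x) (Cod C p1)"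
    have "g \<cdot>\<^bsub>C\<^esub> x = Zro C (Dom C x) (Cod C g)"
      using C.reassoc[OF i1'(4), of x] x i1'(1,2,3,6,7) by simp
    moreover have "Cod C x = Dom C g" using x i1'(2) by simp
    ultimately show "\<exists>h. h \<in> Arr C \<and> Dom C h = Dom C x \<and> Cod C h = Dom C m \<and> m \<cdot>\<^bsub>C\<^esub> h = x"
      using C.kernel_lift[OF pm(2) x(1) refl] by blast
  qed (use k i1'(2) in simp)
  then have "short_exact C m p1" by (rule C.kernel_epi_short_exact[OF _ i1'(5)])
  then have k': "is_kernel D (far T m) (far T p1)"
    using far_short_exact D.short_exact_kernel by blast
  note k1 = D.kernel_arr[OF k']
  have e: "far T m1 \<cdot>\<^bsub>D\<^esub> far T p1 = far T g"
    using far_cmp[of p1 m1] i1' by simp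
  have "is_kernel D (far T m) (far T g)"
  proof (rule D.kernelI)
    show "is_mono D (far T m)" using far_mono[OF pm'(9)] .
    show "far T g \<cdot>\<^bsub>D\<^esub> far T m = Zro D (Dom D (far T m)) (Cod D (far T g))"
      using arg_cong[OF k(4), of "far T"] k(1-3) by simp
    fix x assume x: "x \<in> Arr D" "Cod D x = Dom D (far T g)"
      "far T g \<cdot>\<^bsub>D\<^esub> x = Zro D (Dom D x) (Cod D (far T g))"
    have x2: "Cod D x = fob T (Dom C p1)" using x(2) i1' by simp
    then have "far T m1 \<cdot>\<^bsub>D\<^esub> (far T p1 \<cdot>\<^bsub>D\<^esub> x) = Zro D (Dom D x) (Cod D (far T g))"
      using D.reassoc[OF e, of x] i1' x by simp
    from D.mono_zero[OF far_mono[OF i1'(9)] this]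
    have "far T p1 \<cdot>\<^bsub>D\<^esub> x = Zro D (Dom D x) (Cod D (far T p1))"
      using x x2 i1' by simp
    moreover have "Cod D x = Dom D (far T p1)" using x2 i1'(1) by simp
    ultimately show "\<exists>h. h \<in> Arr D \<and> Dom D h = Dom D x \<and> Cod D h = Dom D (far T m) \<and>
        far T m \<cdot>\<^bsub>D\<^esub> h = x"
      using D.kernel_lift[OF k' x(1) refl] by blast
  qed (use k in simp_all)
  moreover have "is_image D (far T f) (far T p) (far T m)"
    using pm' far_mono[OF pm'(9)] far_epi[OF pm'(5)] far_cmp[of p m] unfolding is_image_def by simp
  ultimately show ?thesis unfolding exact_at_def by blast
qed

end

locale adj = C: preadditive_cat C + D: preadditive_cat D
  for C :: "('o1, 'm1) catg" and D :: "('o2, 'm2) catg" +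
  fixes L :: "('o1, 'm1, 'o2, 'm2) ftor" and R :: "('o2, 'm2, 'o1, 'm1) ftor"
    and \<eta> :: "'o1 \<Rightarrow> 'm1" and \<epsilon> :: "'o2 \<Rightarrow> 'm2"
  assumes adj: "adjunction C D L R \<eta> \<epsilon>" and R_additive: "additive_functor D C R"

sublocale adj \<subseteq> L: ftr C D L
  by unfold_locales (use adj in \<open>simp add: adjunction_def\<close>)

sublocale adj \<subseteq> R: additive_ftr D C R
  by unfold_locales (rule R_additive)

context adj
begin

lemma unit_nat_trans: "nat_trans C C id_ftor (R \<circ>\<^sub>F L) \<eta>"
  and counit_nat_trans: "nat_trans D D (L \<circ>\<^sub>F R) id_ftor \<epsilon>"
  using adj by (simp_all add: adjunction_def)

lemmas unit_arr [simp] = nat_trans_arr[OF unit_nat_trans, simplified]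
lemmas counit_arr [simp] = nat_trans_arr[OF counit_nat_trans, simplified]
lemmas unit_nat = nat_trans_nat[OF unit_nat_trans, simplified]
lemmas counit_nat = nat_trans_nat[OF counit_nat_trans, simplified]

lemma triangle_L: "X \<in> Ob C \<Longrightarrow> \<epsilon> (fob L X) \<cdot>\<^bsub>D\<^esub> far L (\<eta> X) = Idt D (fob L X)"
  and triangle_R: "Y \<in> Ob D \<Longrightarrow> far R (\<epsilon> Y) \<cdot>\<^bsub>C\<^esub> \<eta> (fob R Y) = Idt C (fob R Y)"
  using adj by (simp_all add: adjunction_def)

lemma transpose_transpose:
  assumes "f \<in> Arr D" "X \<in> Ob C" "Dom D f = fob L X"
  shows "\<epsilon> (Cod D f) \<cdot>\<^bsub>D\<^esub> far L (far R f \<cdot>\<^bsub>C\<^esub> \<eta> X) = f"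
  using assms triangle_L[of X] D.reassoc2[OF counit_nat[of f], of "far L (\<eta> X)"] by simp

lemma adj_unique:
  assumes "far R f \<cdot>\<^bsub>C\<^esub> \<eta> X = far R g \<cdot>\<^bsub>C\<^esub> \<eta> X" "f \<in> Arr D" "g \<in> Arr D" "X \<in> Ob C"
    "Dom D f = fob L X" "Dom D g = fob L X" "Cod D f = Cod D g"
  shows "f = g"
proof -
  have "f = \<epsilon> (Cod D f) \<cdot>\<^bsub>D\<^esub> far L (far R f \<cdot>\<^bsub>C\<^esub> \<eta> X)"
    using transpose_transpose assms(2,4,5) by metis
  also have "\<dots> = g"
    unfolding assms(1,7) using transpose_transpose assms(3,4,6) by metis
  finally show ?thesis .
qed

lemma transpose:
  assumes "g \<in> Arr C" "Cod C g = fob R Y" "Y \<in> Ob D"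
  shows "far R (\<epsilon> Y \<cdot>\<^bsub>D\<^esub> far L g) \<cdot>\<^bsub>C\<^esub> \<eta> (Dom C g) = g"
  using assms triangle_R[of Y] unit_nat[of g] C.reassoc[OF triangle_R[of Y], of g] by simp

lemma L_additive: "additive_functor C D L"
  unfolding additive_functor_def
proof (intro conjI allI ballI)
  fix X Y f g assume "f \<in> Hom C X Y" "g \<in> Hom C X Y"
  then have fg: "f \<in> Arr C" "Dom C f = X" "Cod C f = Y" "g \<in> Arr C" "Dom C g = X" "Cod C g = Y"
    "X \<in> Ob C" "Y \<in> Ob C"
    by (auto simp: Hom_def)
  show "far L (Add C f g) = Add D (far L f) (far L g)"
    by (rule adj_unique[of _ X])
      (use fg unit_nat[of f] unit_nat[of g] unit_nat[of "Add C f g"] in \<open>simp_all flip: unit_nat\<close>)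
qed (rule L.ftr)

end

sublocale adj \<subseteq> L: additive_ftr C D L
  by unfold_locales (rule L_additive)

context adj
begin

lemma L_cokernel:
  assumes "is_cokernel C c f" shows "is_cokernel D (far L c) (far L f)"
proof -
  note c = C.cokernel_arr[OF assms]
  have z: "far L c \<cdot>\<^bsub>D\<^esub> far L f = Zro D (fob L (Dom C f)) (fob L (Cod C c))"
    using arg_cong[OF c(4), of "far L"] c(1-3) by simp
  have "\<exists>h. h \<in> Arr D \<and> Dom D h = Cod D (far L c) \<and> Cod D h = Cod D g \<and> h \<cdot>\<^bsub>D\<^esub> far L c = g"
    if g: "g \<in> Arr D" "Dom D g = Cod D (far L f)" "g \<cdot>\<^bsub>D\<^esub> far L f = Zro D (Dom D (far L f)) (Cod D g)" for g
  proof -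
    have dg: "Dom D g = fob L (Cod C f)" using g c by simp
    let ?g = "far R g \<cdot>\<^bsub>C\<^esub> \<eta> (Cod C f)"
    have g': "?g \<in> Arr C" "Dom C ?g = Cod C f" "Cod C ?g = fob R (Cod D g)"
      using g(1) dg c(2) by simp_all
    have "?g \<cdot>\<^bsub>C\<^esub> f = far R (g \<cdot>\<^bsub>D\<^esub> far L f) \<cdot>\<^bsub>C\<^esub> \<eta> (Dom C f)"
      using g(1) dg c(2) unit_nat[of f] by simp
    also have "\<dots> = Zro C (Dom C f) (fob R (Cod D g))"
      unfolding g(3) using g(1) c(2) by simp
    finally obtain h where h: "h \<in> Arr C" "Dom C h = Cod C c" "Cod C h = fob R (Cod D g)" "h \<cdot>\<^bsub>C\<^esub> c = ?g"
      using C.cokernel_desc[OF assms g'] by blast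
    let ?h = "\<epsilon> (Cod D g) \<cdot>\<^bsub>D\<^esub> far L h"
    have "?h \<cdot>\<^bsub>D\<^esub> far L c = \<epsilon> (Cod D g) \<cdot>\<^bsub>D\<^esub> far L (h \<cdot>\<^bsub>C\<^esub> c)"
      using h(1-3) c(1) g(1) by simp
    also have "\<dots> = g" unfolding h(4) by (rule transpose_transpose) (use g(1) dg c(2) in simp_all)
    finally show ?thesis using h(1-3) c(1) g(1) by (intro exI[of _ ?h]) simp
  qed
  moreover have "is_epi D (far L c)"
  proof (rule D.epiI)
    fix g W assume g: "g \<in> Arr D" "Dom D g = Cod D (far L c)" "Cod D g = W"
      "g \<cdot>\<^bsub>D\<^esub> far L c = Zro D (Dom D (far L c)) W"
    have W: "W \<in> Ob D" using g(1,3) by auto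
    have dg: "Dom D g = fob L (Cod C c)" using g c by simp
    have "(far R g \<cdot>\<^bsub>C\<^esub> \<eta> (Cod C c)) \<cdot>\<^bsub>C\<^esub> c = far R (g \<cdot>\<^bsub>D\<^esub> far L c) \<cdot>\<^bsub>C\<^esub> \<eta> (Dom C c)"
      using g(1) dg c(1) unit_nat[of c] by simp
    also have "\<dots> = Zro C (Dom C c) (fob R W)"
      unfolding g(4) using W c(1) by simp
    finally have "far R g \<cdot>\<^bsub>C\<^esub> \<eta> (Cod C c) = Zro C (Cod C c) (fob R W)"
      by - (rule C.epi_zero[OF C.cokernel_epi[OF assms]]; use g(1,3) dg c(1) in simp)
    then show "g = Zro D (Cod D (far L c)) W"
      by - (rule adj_unique[of g "Cod C c"]; use g(1,3) W dg c(1) in simp)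
  qed (use c in simp)
  ultimately show ?thesis
    using z c(1-3) by - (rule D.cokernelI; simp)
qed

lemma L_Proj:
  assumes "P \<in> Proj C" "\<And>g. is_epi D g \<Longrightarrow> is_epi C (far R g)"
  shows "fob L P \<in> Proj D"
  unfolding Proj_def
proof (intro CollectI conjI allI impI)
  have P: "P \<in> Ob C" using assms(1) by (simp add: Proj_def)
  then show "fob L P \<in> Ob D" by simp
  fix g f assume "is_epi D g \<and> f \<in> Hom D (fob L P) (Cod D g)"
  then have g: "is_epi D g" "g \<in> Arr D" and f: "f \<in> Arr D" "Dom D f = fob L P" "Cod D f = Cod D g"
    using D.epi_arr by (auto simp: Hom_def)
  have "far R f \<cdot>\<^bsub>C\<^esub> \<eta> P \<in> Hom C P (Cod C (far R g))" using f g P by (simp add: Hom_def)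
  then obtain h where "h \<in> Hom C P (Dom C (far R g))" and e: "far R g \<cdot>\<^bsub>C\<^esub> h = far R f \<cdot>\<^bsub>C\<^esub> \<eta> P"
    using assms(1) assms(2)[OF g(1)] unfolding Proj_def by blast
  then have h: "h \<in> Arr C" "Dom C h = P" "Cod C h = fob R (Dom D g)" using g by (auto simp: Hom_def)
  let ?h = "\<epsilon> (Dom D g) \<cdot>\<^bsub>D\<^esub> far L h"
  have t: "far R ?h \<cdot>\<^bsub>C\<^esub> \<eta> P = h" using transpose[of h "Dom D g"] h g by simp
  have "g \<cdot>\<^bsub>D\<^esub> ?h = f"
  proof (rule adj_unique[of _ P])
    have "far R (g \<cdot>\<^bsub>D\<^esub> ?h) \<cdot>\<^bsub>C\<^esub> \<eta> P = far R g \<cdot>\<^bsub>C\<^esub> (far R ?h \<cdot>\<^bsub>C\<^esub> \<eta> P)"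
      using h g P by simp
    then show "far R (g \<cdot>\<^bsub>D\<^esub> ?h) \<cdot>\<^bsub>C\<^esub> \<eta> P = far R f \<cdot>\<^bsub>C\<^esub> \<eta> P"
      unfolding t e .
  qed (use h g f P in simp_all)
  then show "\<exists>h \<in> Hom D (fob L P) (Dom D g). g \<cdot>\<^bsub>D\<^esub> h = f"
    using h g by (intro bexI[of _ ?h]) (simp_all add: Hom_def)
qed

end

locale adj_ep = adj C D L R \<eta> \<epsilon> + C: abelian_cat_ep C + D: abelian_cat_ep D
  for C :: "('o1, 'm1) catg" and D :: "('o2, 'm2) catg" and L R \<eta> \<epsilon>
begin

lemma L_right_exact:
  assumes "exact_at C f g" "is_epi C g"
  shows "exact_at D (far L f) (far L g)" "is_epi D (far L g)"
  using L_cokernel[OF C.exact_epi_cokernel[OF assms]] D.cokernel_exact by blast+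

lemma L_epi: assumes "is_epi C g" shows "is_epi D (far L g)"
proof -
  obtain k where "is_kernel C k g" using C.ex_kernel[OF C.epi_arr[OF assms]] by blast
  then have "is_cokernel C g k" using C.epi_is_cokernel_of_kernel assms by blast
  then show ?thesis using L_cokernel D.cokernel_epi by blast
qed

end

section \<open>Complete resolutions and Gorenstein projective objects\<close>

definition extends :: "('o, 'm) catg \<Rightarrow> 'm \<Rightarrow> 'o \<Rightarrow> bool" where
  "extends C m Z \<longleftrightarrow> (\<forall>\<phi> \<in> Hom C (Dom C m) Z. \<exists>\<psi> \<in> Hom C (Cod C m) Z. \<psi> \<cdot>\<^bsub>C\<^esub> m = \<phi>)"

lemma extendsD:
  assumes "extends C m Z" "\<phi> \<in> Arr C" "Dom C \<phi> = Dom C m" "Cod C \<phi> = Z"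
  obtains \<psi> where "\<psi> \<in> Arr C" "Dom C \<psi> = Cod C m" "Cod C \<psi> = Z" "\<psi> \<cdot>\<^bsub>C\<^esub> m = \<phi>"
  using assms unfolding extends_def Hom_def by blast

context abelian_cat
begin

lemma exact_complexD:
  assumes "exact_complex C P d"
  shows "d n \<in> Arr C" "Dom C (d n) = P n" "Cod C (d n) = P (n + 1)" "P n \<in> Ob C"
    "exact_at C (d (n - 1)) (d n)"
  using assms by (auto simp: exact_complex_def Hom_def)

lemma complete_resolutionD:
  assumes "complete_resolution C P d"
  shows "exact_complex C P d" "P n \<in> Proj C" "Q \<in> Proj C \<Longrightarrow> hom_exact C P d Q"
  using assms by (auto simp: complete_resolution_def)

lemma hom_exactD:
  assumes "hom_exact C P d Q" "f \<in> Arr C" "Dom C f = P n" "Cod C f = Q"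
    "f \<cdot> d (n - 1) = Zro C (P (n - 1)) Q"
  obtains g where "g \<in> Arr C" "Dom C g = P (n + 1)" "Cod C g = Q" "g \<cdot> d n = f"
proof -
  have "f \<in> kernel (hom_group C (P n) Q) (hom_group C (P (n - 1)) Q) (\<lambda>f. f \<cdot> d (n - 1))"
    using assms by (simp add: kernel_def hom_group_simps Hom_def)
  then have "f \<in> (\<lambda>g. g \<cdot> d n) ` Hom C (P (n + 1)) Q"
    using assms(1) unfolding hom_exact_def by blast
  then show ?thesis using that unfolding Hom_def by blast
qed

lemma hom_exactI:
  assumes "exact_complex C P d" "Q \<in> Ob C"
    and 0: "\<And>f n. \<lbrakk>f \<in> Arr C; Dom C f = P n; Cod C f = Q; f \<cdot> d (n - 1) = Zro C (P (n - 1)) Q\<rbrakk>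
      \<Longrightarrow> \<exists>g. g \<in> Arr C \<and> Dom C g = P (n + 1) \<and> Cod C g = Q \<and> g \<cdot> d n = f"
  shows "hom_exact C P d Q"
  unfolding hom_exact_def
proof (intro allI equalityI subsetI)
  fix n f
  assume "f \<in> kernel (hom_group C (P n) Q) (hom_group C (P (n - 1)) Q) (\<lambda>f. f \<cdot> d (n - 1))"
  then have "f \<in> Arr C" "Dom C f = P n" "Cod C f = Q" "f \<cdot> d (n - 1) = Zro C (P (n - 1)) Q"
    by (auto simp: kernel_def hom_group_simps Hom_def)
  from 0[OF this] show "f \<in> (\<lambda>g. g \<cdot> d n) ` Hom C (P (n + 1)) Q"
    unfolding Hom_def by blast
next
  fix n f assume "f \<in> (\<lambda>g. g \<cdot> d n) ` Hom C (P (n + 1)) Q"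
  then obtain g where g: "g \<in> Arr C" "Dom C g = P (n + 1)" "Cod C g = Q" "f = g \<cdot> d n"
    unfolding Hom_def by blast
  note dn = exact_complexD[OF assms(1)]
  note ex = exact_at_arr[OF dn(5)[of n]]
  have "g \<cdot> (d n \<cdot> d (n - 1)) = Zro C (P (n - 1)) Q"
    unfolding ex(4) using g(1-3) dn(1-4)[of n] dn(1-4)[of "n - 1"] by simp
  then have "f \<cdot> d (n - 1) = Zro C (P (n - 1)) Q"
    using g dn(1-3)[of n] dn(1-3)[of "n - 1"] by simp
  then show "f \<in> kernel (hom_group C (P n) Q) (hom_group C (P (n - 1)) Q) (\<lambda>f. f \<cdot> d (n - 1))"
    using g dn(1-3)[of n] by (simp add: kernel_def hom_group_simps Hom_def)
qed

lemma hom_exact_iso: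
  assumes "exact_complex C P d" "hom_exact C P d Q" "is_iso_arr C h" "Dom C h = Q" "Cod C h = Q'"
  shows "hom_exact C P d Q'"
proof (rule hom_exactI[OF assms(1)])
  note h = iso_inverse[OF assms(3)]
  note dn = exact_complexD[OF assms(1)]
  show "Q' \<in> Ob C" using h assms(5) by auto
  fix f n assume f: "f \<in> Arr C" "Dom C f = P n" "Cod C f = Q'" "f \<cdot> d (n - 1) = Zro C (P (n - 1)) Q'"
  have "(inv_arr C h \<cdot> f) \<cdot> d (n - 1) = Zro C (P (n - 1)) Q"
    using f dn[of "n - 1"] h assms(4,5) by simp
  then obtain g where g: "g \<in> Arr C" "Dom C g = P (n + 1)" "Cod C g = Q" "g \<cdot> d n = inv_arr C h \<cdot> f"
    using hom_exactD[OF assms(2), of "inv_arr C h \<cdot> f" n] f(1-3) h assms(4,5) by auto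
  have "(h \<cdot> g) \<cdot> d n = f"
    using g f(1-3) h assms(4,5) dn[of n] reassoc[OF h(6), of f] by simp
  then show "\<exists>g. g \<in> Arr C \<and> Dom C g = P (n + 1) \<and> Cod C g = Q' \<and> g \<cdot> d n = f"
    using g h assms(4,5) by (intro exI[of _ "h \<cdot> g"]) simp
qed

lemma complete_resolution_shift:
  assumes "complete_resolution C P d"
  shows "complete_resolution C (\<lambda>k. P (k + n)) (\<lambda>k. d (k + n))"
proof -
  note dn = exact_complexD[OF complete_resolutionD(1)[OF assms]]
  have e: "exact_complex C (\<lambda>k. P (k + n)) (\<lambda>k. d (k + n))"
    unfolding exact_complex_def
  proof (intro allI conjI)
    fix k
    show "P (k + n) \<in> Ob C" using dn by simp
    show "d (k + n) \<in> Hom C (P (k + n)) (P (k + 1 + n))"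
      using dn[of "k + n"] by (simp add: Hom_def algebra_simps)
    show "exact_at C (d (k - 1 + n)) (d (k + n))"
      using dn(5)[of "k + n"] by (simp add: algebra_simps)
  qed
  moreover have "hom_exact C (\<lambda>k. P (k + n)) (\<lambda>k. d (k + n)) Q" if Q: "Q \<in> Proj C" for Q
  proof (rule hom_exactI[OF e])
    show "Q \<in> Ob C" using Proj_ob Q .
    fix f k assume f: "f \<in> Arr C" "Dom C f = P (k + n)" "Cod C f = Q"
      "f \<cdot> d (k - 1 + n) = Zro C (P (k - 1 + n)) Q"
    have kn: "k - 1 + n = k + n - 1" "k + 1 + n = k + n + 1" by simp_all
    obtain g where "g \<in> Arr C" "Dom C g = P (k + n + 1)" "Cod C g = Q" "g \<cdot> d (k + n) = f"
      using hom_exactD[OF complete_resolutionD(3)[OF assms Q] f(1-3) f(4)[unfolded kn]] .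
    then show "\<exists>g. g \<in> Arr C \<and> Dom C g = P (k + 1 + n) \<and> Cod C g = Q \<and> g \<cdot> d (k + n) = f"
      unfolding kn by blast
  qed
  ultimately show ?thesis using complete_resolutionD(2)[OF assms] by (simp add: complete_resolution_def)
qed

lemma Gorenstein_image:
  assumes "complete_resolution C P d" "is_image C (d n) p m"
  shows "Gorenstein_projective C (Cod C p)"
  using complete_resolution_shift[OF assms(1), of n] assms(2) unfolding Gorenstein_projective_def
  by (metis add_0)

text \<open>Left exactness of \<open>Hom(-, Z)\<close> along the image factorization: a morphism on the image is
  pulled back to the term of the complex covering it, where the hypothesis extends it.\<close>

lemma hom_exact_extends:
  assumes "exact_complex C P d" "hom_exact C P d Z" "is_image C (d n) p m"
  shows "extends C m Z"
  unfolding extends_def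
proof
  note dn = exact_complexD[OF assms(1)]
  note pm = image_arr[OF assms(3)]
  note ex = exact_at_arr[OF dn(5)[of n]]
  fix \<phi> assume "\<phi> \<in> Hom C (Dom C m) Z"
  then have \<phi>: "\<phi> \<in> Arr C" "Dom C \<phi> = Dom C m" "Cod C \<phi> = Z" by (auto simp: Hom_def)
  have "m \<cdot> (p \<cdot> d (n - 1)) = Zro C (P (n - 1)) (Cod C m)"
    using reassoc[OF pm(4), of "d (n - 1)"] pm(1-3,6-8) ex dn[of "n - 1"] by simp
  from mono_zero[OF pm(9) this] have z: "p \<cdot> d (n - 1) = Zro C (P (n - 1)) (Dom C m)"
    using pm(1-3) ex dn[of "n - 1"] by simp
  have "(\<phi> \<cdot> p) \<cdot> d (n - 1) = Zro C (P (n - 1)) Z"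
    using \<phi> pm(1-3) z ex dn[of "n - 1"] by simp
  then obtain \<psi> where \<psi>: "\<psi> \<in> Arr C" "Dom C \<psi> = P (n + 1)" "Cod C \<psi> = Z" "\<psi> \<cdot> d n = \<phi> \<cdot> p"
    using hom_exactD[OF assms(2), of "\<phi> \<cdot> p" n] \<phi> pm(1-3) dn[of n] by auto
  have "(\<psi> \<cdot> m) \<cdot> p = \<phi> \<cdot> p" using \<psi> pm(1-4,6,7) dn[of n] by simp
  then have "\<psi> \<cdot> m = \<phi>"
    by - (rule epi_cancel[OF pm(5)]; use \<psi>(1-3) \<phi> pm(1-3,6,7) dn[of n] in simp)
  then show "\<exists>\<psi> \<in> Hom C (Cod C m) Z. \<psi> \<cdot> m = \<phi>"
    using \<psi>(1-3) pm(7) dn[of n] by (intro bexI[of _ \<psi>]) (simp_all add: Hom_def)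
qed

end

context abelian_cat_ep
begin

lemma short_exact_elt:
  assumes "is_mono C f" "is_epi C g" "Cod C f = Dom C g" "g \<cdot> f = Zro C (Dom C f) (Cod C g)"
    and "\<And>y. \<lbrakk>elt C y (Dom C g); g \<cdot> y = Zro C (Dom C y) (Cod C g)\<rbrakk>
      \<Longrightarrow> \<exists>x. x \<in> Arr C \<and> Cod C x = Dom C f \<and> f \<cdot> x = y"
  shows "short_exact C f g"
  unfolding short_exact_def using assms mono_arr epi_arr exact_elt[of f g] by blast

lemma image_short_exact:
  assumes "exact_complex C P d" "is_image C (d (n - 1)) p m" "is_image C (d n) p' m'"
  shows "short_exact C m p'" "Cod C m = P n"
proof -
  note dn = exact_complexD[OF assms(1)]
  note ex = exact_at_arr[OF dn(5)[of n]]
  note pm = image_arr[OF assms(2)] and pm' = image_arr[OF assms(3)]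
  show c: "Cod C m = P n" using pm(7) ex(3) dn[of n] by simp
  show "short_exact C m p'"
  proof (rule short_exact_elt[OF pm(9) pm'(5)])
    show c': "Cod C m = Dom C p'" using c pm'(2) dn[of n] by simp
    have "(m' \<cdot> (p' \<cdot> m)) \<cdot> p = Zro C (Dom C p) (Cod C m')"
      using reassoc[OF pm'(4), of "d (n - 1)"] pm(1-4,6) pm'(1-3,6,7) c' ex by simp
    from epi_zero[OF pm(5) this] have "m' \<cdot> (p' \<cdot> m) = Zro C (Dom C m) (Cod C m')"
      using pm(1-4,6) pm'(1-3,6,7) c' by simp
    from mono_zero[OF pm'(9) this] show "p' \<cdot> m = Zro C (Dom C m) (Cod C p')"
      using pm(6) pm'(1-3,6,7) c' by simp
    fix y assume y: "elt C y (Dom C p')" "p' \<cdot> y = Zro C (Dom C y) (Cod C p')"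
    note y' = elt_arr[OF y(1)]
    have "d n \<cdot> y = Zro C (Dom C y) (Cod C (d n))"
      using reassoc[OF pm'(4), of y] y(2) y' pm'(1-3,6-8) by simp
    then obtain x where x: "elt C x (Dom C (d (n - 1)))" "d (n - 1) \<cdot> x = y"
      using exact_lift[OF dn(5)[of n], of y] y(1) pm'(2) by metis
    note x' = elt_arr[OF x(1)]
    have "m \<cdot> (p \<cdot> x) = y" using reassoc[OF pm(4), of x] x(2) x' pm(1-3,6-8) by simp
    then show "\<exists>x. x \<in> Arr C \<and> Cod C x = Dom C m \<and> m \<cdot> x = y"
      using x' pm(1-3) by (intro exI[of _ "p \<cdot> x"]) simp
  qed
qed

text \<open>Splicing syzygies on the left and cosyzygies on the right gives an exact complex of projectives.  It
  is \<open>Hom(-, Q)\<close>-exact because each of the short exact sequences is.\<close>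

lemma Gorenstein_splice:
  assumes X: "W X"
    and syzygy: "\<And>X. W X \<Longrightarrow> \<exists>x f. short_exact C x f \<and> Cod C f = X \<and> Dom C f \<in> Proj C \<and>
      W (Dom C x) \<and> (\<forall>Q \<in> Proj C. extends C x Q)"
    and cosyzygy: "\<And>X. W X \<Longrightarrow> \<exists>x f. short_exact C x f \<and> Dom C x = X \<and> Dom C f \<in> Proj C \<and>
      W (Cod C f) \<and> (\<forall>Q \<in> Proj C. extends C x Q)"
  shows "Gorenstein_projective C X"
proof -
  let ?P = "\<lambda>x f. short_exact C x f \<and> Dom C f \<in> Proj C \<and> (\<forall>Q \<in> Proj C. extends C x Q)"
  have "\<exists>Y. W Y \<and> (\<exists>x f. ?P x f \<and> Dom C x = Y \<and> Cod C f = X)" if "W X" for X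
    using syzygy[OF that] by blast
  then have "\<forall>X. \<exists>Y. W X \<longrightarrow> W Y \<and> (\<exists>x f. ?P x f \<and> Dom C x = Y \<and> Cod C f = X)" by blast
  from choice[OF this] obtain pv
    where pv: "\<And>X. W X \<Longrightarrow> W (pv X) \<and> (\<exists>x f. ?P x f \<and> Dom C x = pv X \<and> Cod C f = X)" by blast
  have "\<exists>Y. W Y \<and> (\<exists>x f. ?P x f \<and> Dom C x = X \<and> Cod C f = Y)" if "W X" for X
    using cosyzygy[OF that] by blast
  then have "\<forall>X. \<exists>Y. W X \<longrightarrow> W Y \<and> (\<exists>x f. ?P x f \<and> Dom C x = X \<and> Cod C f = Y)" by blast
  from choice[OF this] obtain nx
    where nx: "\<And>X. W X \<Longrightarrow> W (nx X) \<and> (\<exists>x f. ?P x f \<and> Dom C x = X \<and> Cod C f = nx X)" by blast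
  have Wpv: "W ((pv ^^ k) X)" for k by (induction k) (use X pv in auto)
  have Wnx: "W ((nx ^^ k) X)" for k by (induction k) (use X nx in auto)
  \<comment> \<open>The object itself is placed in degree \<open>1\<close>, to become the image of the differential \<open>d 0\<close>.\<close>
  define obj where "obj n = (if n \<ge> 1 then (nx ^^ nat (n - 1)) X else (pv ^^ nat (1 - n)) X)" for n :: int
  have "\<exists>x f. ?P x f \<and> Dom C x = obj n \<and> Cod C f = obj (n + 1)" for n
  proof (cases "n \<ge> 1")
    case True
    then have "nat (n + 1 - 1) = Suc (nat (n - 1))" by simp
    then have "obj (n + 1) = nx (obj n)" using True by (simp add: obj_def)
    then show ?thesis using nx[of "obj n"] Wnx True by (simp add: obj_def)
  next
    case False
    then have "nat (1 - n) = Suc (nat (1 - (n + 1)))" by simp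
    then have "obj n = pv ((pv ^^ nat (1 - (n + 1))) X)" using False by (simp add: obj_def)
    moreover have "(pv ^^ nat (1 - (n + 1))) X = obj (n + 1)" using False by (auto simp: obj_def)
    moreover have "W (obj (n + 1))" unfolding obj_def using Wpv Wnx by simp
    ultimately show ?thesis using pv[of "obj (n + 1)"] by simp
  qed
  then have "\<forall>n. \<exists>xf. ?P (fst xf) (snd xf) \<and> Dom C (fst xf) = obj n \<and> Cod C (snd xf) = obj (n + 1)"
    by simp
  from choice[OF this] obtain xf
    where "\<And>n. ?P (fst (xf n)) (snd (xf n)) \<and> Dom C (fst (xf n)) = obj n \<and>
      Cod C (snd (xf n)) = obj (n + 1)" by blast
  then obtain x f where xf: "\<And>n. ?P (x n) (f n) \<and> Dom C (x n) = obj n \<and> Cod C (f n) = obj (n + 1)"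
    by (rule that[of "\<lambda>n. fst (xf n)" "\<lambda>n. snd (xf n)"])
  then have se: "short_exact C (x n) (f n)" and proj: "Dom C (f n) \<in> Proj C"
    and ext: "Q \<in> Proj C \<Longrightarrow> extends C (x n) Q"
    and ob: "Dom C (x n) = obj n" "Cod C (f n) = obj (n + 1)" for n Q
    by blast+
  note sa = short_exact_arr[OF se]
  define P where "P n = Dom C (f n)" for n
  define d where "d n = x (n + 1) \<cdot> f n" for n
  have P: "P n \<in> Proj C" "P n \<in> Ob C" for n using proj Proj_ob by (auto simp: P_def)
  have fn: "f n \<in> Arr C" "Dom C (f n) = P n" "Cod C (f n) = obj (n + 1)"
    and xn: "x n \<in> Arr C" "Dom C (x n) = obj n" "Cod C (x n) = P n" for n
    using sa[of n] ob by (simp_all add: P_def)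
  have d: "d n \<in> Arr C" "Dom C (d n) = P n" "Cod C (d n) = P (n + 1)" for n
    using fn xn by (simp_all add: d_def)
  have obj: "obj n \<in> Ob C" for n using fn[of "n - 1"] arr_ob(2) by (metis diff_add_cancel)
  have fx: "f n \<cdot> x n = Zro C (obj n) (obj (n + 1))" for n using sa(4)[of n] fn xn by simp
  have d1: "d (n - 1) = x n \<cdot> f (n - 1)" for n by (simp add: d_def)
  have fn1: "Cod C (f (n - 1)) = obj n" for n using fn(3)[of "n - 1"] by simp
  have "exact_at C (d (n - 1)) (d n)" for n
  proof (rule exact_elt)
    show "Cod C (d (n - 1)) = Dom C (d n)" using d[of n] d[of "n - 1"] by simp
    show "d n \<cdot> d (n - 1) = Zro C (Dom C (d (n - 1))) (Cod C (d n))"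
      using fn[of n] xn[of n] xn[of "n + 1"] fn(1,2)[of "n - 1"] fn1[of n] P obj
        reassoc[OF fx[of n], of "f (n - 1)"] by (simp add: d1 d_def[of n])
    fix y assume y: "elt C y (Dom C (d n))" "d n \<cdot> y = Zro C (Dom C y) (Cod C (d n))"
    note y' = elt_arr[OF y(1)]
    have "x (n + 1) \<cdot> (f n \<cdot> y) = Zro C (Dom C y) (P (n + 1))"
      using y(2) y' fn[of n] xn[of "n + 1"] d[of n] by (simp add: d_def[of n])
    from mono_zero[OF sa(5) this] have "f n \<cdot> y = Zro C (Dom C y) (Cod C (f n))"
      using y' fn[of n] xn[of "n + 1"] d[of n] by simp
    then obtain z where z: "elt C z (obj n)" "x n \<cdot> z = y"
      using exact_lift[OF sa(7)[of n], of y] y(1) d[of n] fn[of n] xn[of n] by metis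
    then obtain w where w: "elt C w (P (n - 1))" "f (n - 1) \<cdot> w = z"
      using epi_lift[OF sa(6)[of "n - 1"], of z] fn[of "n - 1"] fn1[of n] by metis
    have "d (n - 1) \<cdot> w = y"
      using w(2) z(2) elt_arr[OF w(1)] fn(1,2)[of "n - 1"] fn1[of n] xn[of n] by (simp add: d1)
    then show "\<exists>w. w \<in> Arr C \<and> Cod C w = Dom C (d (n - 1)) \<and> d (n - 1) \<cdot> w = y"
      using elt_arr[OF w(1)] d by metis
  qed (use d in simp_all)
  then have ec: "exact_complex C P d"
    using d P by (simp add: exact_complex_def Hom_def)
  moreover have "hom_exact C P d Q" if Q: "Q \<in> Proj C" for Q
  proof (rule hom_exactI[OF ec Proj_ob[OF Q]])
    fix g n assume g: "g \<in> Arr C" "Dom C g = P n" "Cod C g = Q" "g \<cdot> d (n - 1) = Zro C (P (n - 1)) Q"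
    have "(g \<cdot> x n) \<cdot> f (n - 1) = Zro C (P (n - 1)) Q"
      using g fn(1,2)[of "n - 1"] fn1[of n] xn[of n] by (simp add: d1)
    from epi_zero[OF sa(6) this] have "g \<cdot> x n = Zro C (obj n) Q"
      using g fn(1,2)[of "n - 1"] fn1[of n] xn[of n] by simp
    then obtain h where h: "h \<in> Arr C" "Dom C h = obj (n + 1)" "Cod C h = Q" "h \<cdot> f n = g"
      using cokernel_desc[OF short_exact_cokernel[OF se[of n]], of g Q] g fn[of n] xn[of n] by auto
    obtain \<psi> where \<psi>: "\<psi> \<in> Arr C" "Dom C \<psi> = P (n + 1)" "Cod C \<psi> = Q" "\<psi> \<cdot> x (n + 1) = h"
      using extendsD[OF ext[OF Q, of "n + 1"] h(1)] h xn[of "n + 1"] by metis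
    have "\<psi> \<cdot> d n = g"
      using reassoc[OF \<psi>(4), of "f n"] \<psi>(1-3) h(4) fn[of n] xn[of "n + 1"] by (simp add: d_def)
    then show "\<exists>g'. g' \<in> Arr C \<and> Dom C g' = P (n + 1) \<and> Cod C g' = Q \<and> g' \<cdot> d n = g"
      using \<psi> by blast
  qed
  ultimately have "complete_resolution C P d" using P by (simp add: complete_resolution_def)
  moreover have "is_image C (d 0) (f 0) (x 1)"
    using sa(5)[of 1] sa(6)[of 0] fn[of 0] xn[of 1] d[of 0] by (simp add: is_image_def d_def[of 0])
  moreover have "Cod C (f 0) = X" using fn[of 0] by (simp add: obj_def)
  ultimately show ?thesis unfolding Gorenstein_projective_def by blast
qed

end

section \<open>Objects over an augmented monad\<close>

locale faithful_adj = B: abelian_cat_ep B + A: abelian_cat_ep A + e: exact_ftr A B e + adj B A l e \<sigma> lam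
  for B :: "('ob, 'mb) catg" (structure) and A :: "('oa, 'ma) catg"
    and e :: "('oa, 'ma, 'ob, 'mb) ftor" and l :: "('ob, 'mb, 'oa, 'ma) ftor"
    and \<sigma> :: "'ob \<Rightarrow> 'mb" and lam :: "'oa \<Rightarrow> 'ma" +
  assumes faithful: "faithful_functor A B e"

sublocale faithful_adj \<subseteq> adj_ep B A l e \<sigma> lam
  by unfold_locales

context faithful_adj
begin

lemma e_inj: "\<lbrakk>far e f = far e g; f \<in> Arr A; g \<in> Arr A; Dom A f = Dom A g; Cod A f = Cod A g\<rbrakk> \<Longrightarrow> f = g"
  using faithful inj_onD[of "far e" "Hom A (Dom A f) (Cod A f)" f g]
  by (simp add: faithful_functor_def Hom_def)

lemma e_reflects_zero:
  "\<lbrakk>far e f = Zro B (fob e X) (fob e Y); f \<in> Arr A; Dom A f = X; Cod A f = Y\<rbrakk> \<Longrightarrow> f = Zro A X Y"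
  using A.arr_ob[of f] by (intro e_inj) auto

lemma e_reflects_epi:
  assumes "is_epi B (far e f)" "f \<in> Arr A" shows "is_epi A f"
proof (rule A.epiI)
  fix g W assume g: "g \<in> Arr A" "Dom A g = Cod A f" "Cod A g = W" "g \<cdot>\<^bsub>A\<^esub> f = Zro A (Dom A f) W"
  have W: "W \<in> Ob A" using g(1,3) by auto
  have "far e g \<cdot> far e f = Zro B (fob e (Dom A f)) (fob e W)"
    using arg_cong[OF g(4), of "far e"] g(1,2) assms(2) W by simp
  from B.epi_zero[OF assms(1) this] show "g = Zro A (Cod A f) W"
    using g(1-3) assms(2) by (intro e_reflects_zero) simp_all
qed fact

lemma e_reflects_mono:
  assumes "is_mono B (far e f)" "f \<in> Arr A" shows "is_mono A f"
proof (rule A.monoI)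
  fix g W assume g: "g \<in> Arr A" "Dom A g = W" "Cod A g = Dom A f" "f \<cdot>\<^bsub>A\<^esub> g = Zro A W (Cod A f)"
  have W: "W \<in> Ob A" using g(1,2) by auto
  have "far e f \<cdot> far e g = Zro B (fob e W) (fob e (Cod A f))"
    using arg_cong[OF g(4), of "far e"] g(1,3) assms(2) W by simp
  from B.mono_zero[OF assms(1) this] show "g = Zro A W (Dom A f)"
    using g(1-3) assms(2) by (intro e_reflects_zero) simp_all
qed fact

lemma lam_epi: assumes "X \<in> Ob A" shows "is_epi A (lam X)"
proof (rule e_reflects_epi)
  show "is_epi B (far e (lam X))"
    by (rule B.split_epi[of _ "\<sigma> (fob e X)"]) (use assms triangle_R[OF assms] in simp_all)
qed (use assms in simp)

lemma l_Proj: "P \<in> Proj B \<Longrightarrow> fob l P \<in> Proj A"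
  using L_Proj e.far_epi by blast

end

locale augmented = faithful_adj B A e l \<sigma> lam
  for B :: "('ob, 'mb) catg" (structure) and A :: "('oa, 'ma) catg"
    and e :: "('oa, 'ma, 'ob, 'mb) ftor" and l :: "('ob, 'mb, 'oa, 'ma) ftor"
    and \<sigma> :: "'ob \<Rightarrow> 'mb" and lam :: "'oa \<Rightarrow> 'ma" +
  fixes F :: "('ob, 'mb, 'ob, 'mb) ftor" and \<nu> \<nu>' \<pi> :: "'ob \<Rightarrow> 'mb"
  assumes \<nu>_nt: "nat_trans B B F (e \<circ>\<^sub>F l) \<nu>"
    and \<nu>'_nt: "nat_trans B B (e \<circ>\<^sub>F l) F \<nu>'"
    and \<pi>_nt: "nat_trans B B (e \<circ>\<^sub>F l) id_ftor \<pi>"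
    and \<nu>'_\<nu>: "Y \<in> Ob B \<Longrightarrow> \<nu>' Y \<cdot> \<nu> Y = Idt B (fob F Y)"
    and \<pi>_\<sigma>: "Y \<in> Ob B \<Longrightarrow> \<pi> Y \<cdot> \<sigma> Y = Idt B Y"
    and \<nu>_kernel: "Y \<in> Ob B \<Longrightarrow> is_kernel B (\<nu> Y) (\<pi> Y)"

sublocale augmented \<subseteq> F: ftr B B F
  by unfold_locales (use \<nu>_nt in \<open>simp add: nat_trans_def\<close>)

context augmented
begin

lemmas \<nu>_arr [simp] = nat_trans_arr[OF \<nu>_nt, simplified]
lemmas \<nu>'_arr [simp] = nat_trans_arr[OF \<nu>'_nt, simplified]
lemmas \<pi>_arr [simp] = nat_trans_arr[OF \<pi>_nt, simplified]
lemmas \<nu>_nat = nat_trans_nat[OF \<nu>_nt, simplified]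
lemmas \<nu>'_nat = nat_trans_nat[OF \<nu>'_nt, simplified]
lemmas \<pi>_nat = nat_trans_nat[OF \<pi>_nt, simplified]

lemma \<pi>_\<nu>: "Y \<in> Ob B \<Longrightarrow> \<pi> Y \<cdot> \<nu> Y = Zro B (fob F Y) Y"
  using B.kernel_arr(4)[OF \<nu>_kernel] by simp

lemma \<nu>_mono: "Y \<in> Ob B \<Longrightarrow> is_mono B (\<nu> Y)"
  using B.kernel_mono[OF \<nu>_kernel] .

text \<open>The splitting \<open>el Y = Y \<oplus> F Y\<close>.  The retraction \<open>\<nu>'\<close> need not vanish on the image of \<open>\<sigma>\<close>,
  so the second projection is obtained from the kernel property of \<open>\<nu>\<close> instead.\<close>

lemma el_decomposition:
  assumes "Y \<in> Ob B"
  obtains r where "r \<in> Arr B" "Dom B r = fob e (fob l Y)" "Cod B r = fob F Y"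
    "Add B (\<nu> Y \<cdot> r) (\<sigma> Y \<cdot> \<pi> Y) = Idt B (fob e (fob l Y))"
proof -
  let ?s = "Sub B (Idt B (fob e (fob l Y))) (\<sigma> Y \<cdot> \<pi> Y)"
  have "\<pi> Y \<cdot> ?s = Zro B (fob e (fob l Y)) Y"
    using assms B.reassoc[OF \<pi>_\<sigma>, of Y "\<pi> Y"] by simp
  then obtain r where "r \<in> Arr B" "Dom B r = fob e (fob l Y)" "Cod B r = fob F Y" "\<nu> Y \<cdot> r = ?s"
    by - (rule B.kernel_lift[OF \<nu>_kernel[OF assms], of ?s "fob e (fob l Y)"]; use assms in simp)
  then show ?thesis using that assms by simp
qed

lemma el_ext:
  assumes "f \<cdot> \<sigma> Y = g \<cdot> \<sigma> Y" "f \<cdot> \<nu> Y = g \<cdot> \<nu> Y"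
    and fg: "f \<in> Arr B" "g \<in> Arr B" "Dom B f = fob e (fob l Y)" "Dom B g = fob e (fob l Y)"
      "Cod B f = Cod B g" and Y: "Y \<in> Ob B"
  shows "f = g"
proof -
  obtain r where r: "r \<in> Arr B" "Dom B r = fob e (fob l Y)" "Cod B r = fob F Y"
    and i: "Add B (\<nu> Y \<cdot> r) (\<sigma> Y \<cdot> \<pi> Y) = Idt B (fob e (fob l Y))"
    using el_decomposition[OF Y] .
  have "h = Add B ((h \<cdot> \<nu> Y) \<cdot> r) ((h \<cdot> \<sigma> Y) \<cdot> \<pi> Y)"
    if h: "h \<in> Arr B" "Dom B h = fob e (fob l Y)" for h
  proof -
    have "h \<cdot> Add B (\<nu> Y \<cdot> r) (\<sigma> Y \<cdot> \<pi> Y) = h" unfolding i using h Y by simp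
    then show ?thesis using h r Y by simp
  qed
  from this[of f] this[of g] show ?thesis unfolding assms(1,2) using fg by simp
qed

lemma F_additive: "additive_functor B B F"
  unfolding additive_functor_def
proof (intro conjI allI ballI)
  fix X Y f g assume "f \<in> Hom B X Y" "g \<in> Hom B X Y"
  then have fg: "f \<in> Arr B" "Dom B f = X" "Cod B f = Y" "g \<in> Arr B" "Dom B g = X" "Cod B g = Y"
    "X \<in> Ob B" "Y \<in> Ob B"
    by (auto simp: Hom_def)
  show "far F (Add B f g) = Add B (far F f) (far F g)"
    by (rule B.mono_cancel[OF \<nu>_mono[of Y]])
      (use fg \<nu>_nat[of f] \<nu>_nat[of g] \<nu>_nat[of "Add B f g"] in simp_all)
qed (rule F.ftr)

end

sublocale augmented \<subseteq> F: additive_ftr B B F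
  by unfold_locales (rule F_additive)

context augmented
begin

text \<open>\<open>F\<close> inherits right exactness from \<open>e l\<close>, of which it is a natural retract.\<close>

lemma F_epi:
  assumes "is_epi B g" shows "is_epi B (far F g)"
proof (rule B.epi_elt)
  note g = B.epi_arr[OF assms]
  show "far F g \<in> Arr B" using g by simp
  fix y assume "elt B y (Cod B (far F g))"
  then have y: "elt B y (fob F (Cod B g))" using g by simp
  note y' = B.elt_arr[OF y]
  have "is_epi B (far e (far l g))" using e.far_epi[OF L_epi[OF assms]] .
  moreover have "elt B (\<nu> (Cod B g) \<cdot> y) (Cod B (far e (far l g)))"
    using y' g by (simp add: elt_def)
  ultimately obtain w where w: "elt B w (fob e (fob l (Dom B g)))"
    "far e (far l g) \<cdot> w = \<nu> (Cod B g) \<cdot> y"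
    by - (rule B.epi_lift[of "far e (far l g)" "\<nu> (Cod B g) \<cdot> y"]; use g in simp)
  note w' = B.elt_arr[OF w(1)]
  have "far F g \<cdot> (\<nu>' (Dom B g) \<cdot> w) = \<nu>' (Cod B g) \<cdot> (far e (far l g) \<cdot> w)"
    by (rule B.reassoc2[OF \<nu>'_nat[symmetric]]) (use g w' in simp_all)
  also have "\<dots> = y" unfolding w(2) using B.reassoc[OF \<nu>'_\<nu>, of "Cod B g" y] g y' by simp
  finally show "\<exists>x. x \<in> Arr B \<and> Cod B x = Dom B (far F g) \<and> far F g \<cdot> x = y"
    using g w' by (intro exI[of _ "\<nu>' (Dom B g) \<cdot> w"]) simp
qed

lemma F_right_exact:
  assumes "exact_at B f g" "is_epi B g" shows "exact_at B (far F f) (far F g)"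
proof (rule B.exact_elt)
  note fg = B.exact_at_arr[OF assms(1)]
  show "far F f \<in> Arr B" "far F g \<in> Arr B" "Cod B (far F f) = Dom B (far F g)" using fg by simp_all
  show "far F g \<cdot> far F f = Zro B (Dom B (far F f)) (Cod B (far F g))"
    using arg_cong[OF fg(4), of "far F"] fg(1-3) by simp
  fix y assume "elt B y (Dom B (far F g))" and "far F g \<cdot> y = Zro B (Dom B y) (Cod B (far F g))"
  then have y: "elt B y (fob F (Dom B g))" and z: "far F g \<cdot> y = Zro B (Dom B y) (fob F (Cod B g))"
    using fg by simp_all
  note y' = B.elt_arr[OF y]
  have ex: "exact_at B (far e (far l f)) (far e (far l g))"
    using e.far_exact_at[OF L_right_exact(1)[OF assms]] .
  have "far e (far l g) \<cdot> (\<nu> (Dom B g) \<cdot> y) = \<nu> (Cod B g) \<cdot> (far F g \<cdot> y)"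
    by (rule B.reassoc2[OF \<nu>_nat[symmetric]]) (use fg y' in simp_all)
  then have "far e (far l g) \<cdot> (\<nu> (Dom B g) \<cdot> y) = Zro B (Dom B y) (Cod B (far e (far l g)))"
    unfolding z using fg y' by simp
  then obtain w where w: "w \<in> Arr B" "Cod B w = fob e (fob l (Dom B f))"
    "far e (far l f) \<cdot> w = \<nu> (Dom B g) \<cdot> y"
    using B.exact_at_lift[OF ex, of "\<nu> (Dom B g) \<cdot> y" "Dom B y"] y' fg by auto
  have "far F f \<cdot> (\<nu>' (Dom B f) \<cdot> w) = \<nu>' (Cod B f) \<cdot> (far e (far l f) \<cdot> w)"
    by (rule B.reassoc2[OF \<nu>'_nat[symmetric]]) (use fg w in simp_all)
  also have "\<dots> = y" unfolding w(3) fg(3) using B.reassoc[OF \<nu>'_\<nu>, of "Dom B g" y] fg y' by simp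
  finally show "\<exists>x. x \<in> Arr B \<and> Cod B x = Dom B (far F f) \<and> far F f \<cdot> x = y"
    using fg w by (intro exI[of _ "\<nu>' (Dom B f) \<cdot> w"]) simp
qed

text \<open>The action \<open>F e X \<rightarrow> e X\<close> determines \<open>X\<close>: objects of \<open>A\<close> behave as objects of \<open>B\<close> with an
  action of the nonunital monad \<open>F\<close>.\<close>

definition act :: "'oa \<Rightarrow> 'mb" where
  "act X = far e (lam X) \<cdot> \<nu> (fob e X)"

lemma act_arr [simp]:
  assumes "X \<in> Ob A"
  shows "act X \<in> Arr B" "Dom B (act X) = fob F (fob e X)" "Cod B (act X) = fob e X"
  using assms by (simp_all add: act_def)

lemma act_nat:
  assumes "f \<in> Arr A"
  shows "act (Cod A f) \<cdot> far F (far e f) = far e f \<cdot> act (Dom A f)"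
proof -
  have n: "far e (lam (Cod A f)) \<cdot> far e (far l (far e f)) = far e f \<cdot> far e (lam (Dom A f))"
    using arg_cong[OF counit_nat[of f], of "far e"] assms by simp
  show ?thesis
    using assms \<nu>_nat[of "far e f"] B.reassoc2[OF n, of "\<nu> (fob e (Dom A f))"] by (simp add: act_def)
qed

lemma free_map:
  assumes "t \<in> Arr B" "Cod B t = fob e X" "X \<in> Ob A"
  shows "far e (lam X \<cdot>\<^bsub>A\<^esub> far l t) \<cdot> \<sigma> (Dom B t) = t"
    and "far e (lam X \<cdot>\<^bsub>A\<^esub> far l t) \<cdot> \<nu> (Dom B t) = act X \<cdot> far F t"
  using assms transpose[of t X] \<nu>_nat[of t] by (simp_all add: act_def)

text \<open>A morphism compatible with the actions is compatible with the counits, by the splitting of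
  \<open>e l\<close>, and so descends from the free objects.\<close>

lemma act_fullness:
  assumes g: "g \<in> Arr B" "Dom B g = fob e X" "Cod B g = fob e X'" and X: "X \<in> Ob A" "X' \<in> Ob A"
    and c: "act X' \<cdot> far F g = g \<cdot> act X"
  obtains f where "f \<in> Arr A" "Dom A f = X" "Cod A f = X'" "far e f = g"
proof -
  let ?h = "lam X' \<cdot>\<^bsub>A\<^esub> far l g"
  have h: "?h \<in> Arr A" "Dom A ?h = fob l (fob e X)" "Cod A ?h = X'" using g X by simp_all
  have eh: "far e ?h = g \<cdot> far e (lam X)"
  proof (rule el_ext[of _ "fob e X"])
    have "far e ?h \<cdot> \<sigma> (fob e X) = g" using free_map(1)[OF g(1,3) X(2)] unfolding g(2) .
    then show "far e ?h \<cdot> \<sigma> (fob e X) = (g \<cdot> far e (lam X)) \<cdot> \<sigma> (fob e X)"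
      using g X triangle_R[OF X(1)] by simp
    have "far e ?h \<cdot> \<nu> (fob e X) = g \<cdot> act X"
      using free_map(2)[OF g(1,3) X(2)] unfolding g(2) c .
    then show "far e ?h \<cdot> \<nu> (fob e X) = (g \<cdot> far e (lam X)) \<cdot> \<nu> (fob e X)"
      using g X by (simp add: act_def)
  qed (use g X in simp_all)
  obtain k where k: "is_kernel A k (lam X)" using A.ex_kernel X by fastforce
  note k' = A.kernel_arr[OF k]
  have ek: "far e (lam X) \<cdot> far e k = Zro B (fob e (Dom A k)) (fob e X)"
    using arg_cong[OF k'(4), of "far e"] k'(1-3) X by simp
  have "far e (?h \<cdot>\<^bsub>A\<^esub> k) = far e ?h \<cdot> far e k"
    by (rule e.far_cmp) (use h k' X in simp_all)
  also have "\<dots> = Zro B (fob e (Dom A k)) (fob e X')"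
    unfolding eh using ek g X k' by simp
  finally have "?h \<cdot>\<^bsub>A\<^esub> k = Zro A (Dom A k) X'"
    using h k' X by (intro e_reflects_zero) simp_all
  then obtain f where f: "f \<in> Arr A" "Dom A f = X" "Cod A f = X'" "f \<cdot>\<^bsub>A\<^esub> lam X = ?h"
    using A.cokernel_desc[OF A.epi_is_cokernel_of_kernel[OF lam_epi[OF X(1)] k], of ?h X'] h k' X
    by auto
  have "far e f \<cdot> far e (lam X) = g \<cdot> far e (lam X)"
    using e.far_cmp[of "lam X" f] f X unfolding eh[symmetric] by simp
  then have "far e f = g"
    by - (rule B.epi_cancel[OF e.far_epi[OF lam_epi[OF X(1)]]]; use f g X in simp)
  then show ?thesis using f that by blast
qed

end

section \<open>Gorenstein projective objects over a square-zero extension\<close>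

text \<open>The composite assumed to vanish is \<open>\<nu>\<close> after \<open>\<eta>\<close>: it takes values in the kernel of the
  augmentation, which is \<open>F Y\<close>.\<close>

locale square_zero = augmented B A e l \<sigma> lam F \<nu> \<nu>' \<pi>
  for B :: "('ob, 'mb) catg" (structure) and A :: "('oa, 'ma) catg" and e l \<sigma> lam F \<nu> \<nu>' \<pi> +
  assumes square_zero: "Y \<in> Ob B \<Longrightarrow>
    far e (lam (fob l Y)) \<cdot> (far e (far l (\<nu> Y)) \<cdot> \<nu> (fob F Y)) = Zro B (fob F (fob F Y)) (fob e (fob l Y))"
begin

text \<open>On a free object \<open>F\<close> acts by moving the summand \<open>Y\<close> to the summand \<open>F Y\<close> and killing the latter;
  the second part is the assumption on the multiplication.\<close>

lemma act_free:
  assumes "Y \<in> Ob B" shows "act (fob l Y) = \<nu> Y \<cdot> far F (\<pi> Y)"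
proof -
  let ?T = "fob e (fob l Y)"
  have T: "?T \<in> Ob B" using assms by simp
  obtain r where r: "r \<in> Arr B" "Dom B r = ?T" "Cod B r = fob F Y"
    and i: "Add B (\<nu> Y \<cdot> r) (\<sigma> Y \<cdot> \<pi> Y) = Idt B ?T"
    using el_decomposition[OF assms] .
  have I: "Add B (far F (\<nu> Y) \<cdot> far F r) (far F (\<sigma> Y) \<cdot> far F (\<pi> Y)) = Idt B (fob F ?T)"
    using arg_cong[OF i, of "far F"] assms r by simp
  have "far e (lam (fob l Y)) \<cdot> far e (far l (\<sigma> Y)) = Idt B ?T"
    using arg_cong[OF triangle_L[OF assms], of "far e"] assms by simp
  then have s: "act (fob l Y) \<cdot> far F (\<sigma> Y) = \<nu> Y"
    using \<nu>_nat[of "\<sigma> Y"] assms B.reassoc[of "far e (lam (fob l Y))" "far e (far l (\<sigma> Y))" _ "\<nu> Y"]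
    by (simp add: act_def)
  have n: "act (fob l Y) \<cdot> far F (\<nu> Y) = Zro B (fob F (fob F Y)) ?T"
    using \<nu>_nat[of "\<nu> Y"] assms square_zero[OF assms] by (simp add: act_def)
  have "act (fob l Y) = act (fob l Y) \<cdot> Idt B (fob F ?T)"
    using assms by simp
  also have "\<dots> = \<nu> Y \<cdot> far F (\<pi> Y)"
    unfolding I[symmetric] using assms r B.reassoc[OF s, of "far F (\<pi> Y)"] B.reassoc[OF n, of "far F r"]
    by simp
  finally show ?thesis .
qed

text \<open>If \<open>X\<close> satisfies condition (2) then \<open>0 \<rightarrow> F Y \<rightarrow> e X \<rightarrow> Y \<rightarrow> 0\<close> is exact for \<open>Y = q X\<close>, and the
  action of \<open>X\<close> is the composite of \<open>F e X \<rightarrow> F Y\<close> with the first map.  This structure is what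
  syzygies and cosyzygies inherit, and it does not mention \<open>q\<close>.\<close>

definition extension_structure :: "'oa \<Rightarrow> 'ob \<Rightarrow> 'mb \<Rightarrow> 'mb \<Rightarrow> bool" where
  "extension_structure X Y j p \<longleftrightarrow> X \<in> Ob A \<and> short_exact B j p \<and> Dom B j = fob F Y \<and>
     Cod B j = fob e X \<and> Cod B p = Y \<and> j \<cdot> far F p = act X"

lemma extension_structureD:
  assumes "extension_structure X Y j p"
  shows "X \<in> Ob A" "Y \<in> Ob B" "short_exact B j p"
    "j \<in> Arr B" "Dom B j = fob F Y" "Cod B j = fob e X"
    "p \<in> Arr B" "Dom B p = fob e X" "Cod B p = Y"
    "is_mono B j" "is_epi B p" "p \<cdot> j = Zro B (fob F Y) Y" "j \<cdot> far F p = act X"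
proof -
  from assms have a: "X \<in> Ob A" "short_exact B j p" "Dom B j = fob F Y" "Cod B j = fob e X"
    "Cod B p = Y" "j \<cdot> far F p = act X" by (simp_all add: extension_structure_def)
  note s = B.short_exact_arr[OF a(2)]
  show "X \<in> Ob A" "Y \<in> Ob B" "short_exact B j p"
    "j \<in> Arr B" "Dom B j = fob F Y" "Cod B j = fob e X"
    "p \<in> Arr B" "Dom B p = fob e X" "Cod B p = Y"
    "is_mono B j" "is_epi B p" "p \<cdot> j = Zro B (fob F Y) Y" "j \<cdot> far F p = act X"
    using a s B.arr_ob(2)[of p] by simp_all
qed

lemma extension_structureI:
  assumes "X \<in> Ob A" "is_mono B j" "is_epi B p" "Dom B j = fob F Y" "Cod B j = fob e X"
    "Dom B p = fob e X" "Cod B p = Y" "p \<cdot> j = Zro B (fob F Y) Y" "j \<cdot> far F p = act X"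
    and "\<And>y. \<lbrakk>elt B y (fob e X); p \<cdot> y = Zro B (Dom B y) Y\<rbrakk>
      \<Longrightarrow> \<exists>x. x \<in> Arr B \<and> Cod B x = fob F Y \<and> j \<cdot> x = y"
  shows "extension_structure X Y j p"
proof -
  have "short_exact B j p"
    by (rule B.short_exact_elt) (use assms in simp_all)
  then show ?thesis using assms unfolding extension_structure_def by simp
qed

text \<open>The short exact sequences cut out of a complete resolution of \<open>B\<close>, with what (C1) says about them:
  \<open>F\<close> keeps the sequence exact, and \<open>Ext\<^sup>1\<close> from the last term to \<open>Q\<close> and \<open>F Q\<close> vanishes.\<close>

definition admissible :: "'mb \<Rightarrow> 'mb \<Rightarrow> bool" where
  "admissible m p \<longleftrightarrow> short_exact B m p \<and> Dom B p \<in> Proj B \<and> is_mono B (far F m) \<and>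
     (\<forall>Q \<in> Proj B. extends B m Q \<and> extends B m (fob F Q))"

lemma admissibleD:
  assumes "admissible m p"
  shows "short_exact B m p" "Dom B p \<in> Proj B" "Dom B p \<in> Ob B" "is_mono B (far F m)"
    "m \<in> Arr B" "Cod B m = Dom B p" "p \<in> Arr B" "is_mono B m" "is_epi B p"
    "p \<cdot> m = Zro B (Dom B m) (Cod B p)"
    "far F p \<cdot> far F m = Zro B (fob F (Dom B m)) (fob F (Cod B p))"
    "exact_at B (far F m) (far F p)"
proof -
  from assms have a: "short_exact B m p" "Dom B p \<in> Proj B" "is_mono B (far F m)"
    by (simp_all add: admissible_def)
  note s = B.short_exact_arr[OF a(1)]
  show "short_exact B m p" "Dom B p \<in> Proj B" "Dom B p \<in> Ob B" "is_mono B (far F m)"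
    "m \<in> Arr B" "Cod B m = Dom B p" "p \<in> Arr B" "is_mono B m" "is_epi B p"
    "p \<cdot> m = Zro B (Dom B m) (Cod B p)"
    using a s by simp_all
  show "exact_at B (far F m) (far F p)" using F_right_exact s by blast
  show "far F p \<cdot> far F m = Zro B (fob F (Dom B m)) (fob F (Cod B p))"
    using arg_cong[OF s(4), of "far F"] s(1-3) by simp
qed

lemma admissible_image:
  assumes "compatible_C1 B F" "complete_resolution B P d"
    "is_image B (d (n - 1)) p m" "is_image B (d n) p' m'"
  shows "admissible m p'"
proof -
  note ec = B.complete_resolutionD(1)[OF assms(2)]
  note dn = B.exact_complexD[OF ec]
  note pm = B.image_arr[OF assms(3)]
  from assms(1,2) have Fc: "exact_complex B (fob F \<circ> P) (far F \<circ> d)"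
    and Fh: "\<And>Q. Q \<in> Proj B \<Longrightarrow> hom_exact B P d (fob F Q)"
    by (auto simp: compatible_C1_def exact_image_def)
  note s = B.image_short_exact[OF ec assms(3,4)]
  have "extends B m Q \<and> extends B m (fob F Q)" if "Q \<in> Proj B" for Q
    using B.hom_exact_extends[OF ec _ assms(3)] Fh B.complete_resolutionD(3)[OF assms(2)] that by blast
  moreover have "is_mono B (far F m)"
  proof (rule B.mono_elt)
    let ?d = "d (n - 1)" and ?d' = "d (n - 1 - 1)"
    note e = B.exact_at_arr[OF dn(5)[of "n - 1"]]
    have D: "Cod B ?d' = Dom B p" "?d' \<in> Arr B" using e(1,3) pm(2) by simp_all
    have "m \<cdot> (p \<cdot> ?d') = Zro B (Dom B ?d') (Cod B m)"
      using B.reassoc[OF pm(4), of ?d'] e pm(1-3,6,7) by simp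
    from B.mono_zero[OF pm(9) this] have "p \<cdot> ?d' = Zro B (Dom B ?d') (Dom B m)"
      using D pm(1-3,6) by simp
    then have z: "far F p \<cdot> far F ?d' = Zro B (fob F (Dom B ?d')) (fob F (Dom B m))"
      using F.far_cmp[of ?d' p] D pm(1,6) by simp
    have Fpm: "far F m \<cdot> far F p = far F ?d" using F.far_cmp[of p m] pm(1-4,6) by simp
    show "far F m \<in> Arr B" using pm(6) by simp
    fix x assume "elt B x (Dom B (far F m))" and 0: "far F m \<cdot> x = Zro B (Dom B x) (Cod B (far F m))"
    then have x: "elt B x (Cod B (far F p))" using pm by simp
    obtain w where w: "elt B w (Dom B (far F p))" "Dom B w = Dom B x" "far F p \<cdot> w = x"
      using B.epi_lift[OF F_epi[OF pm(5)] x] .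
    note w' = B.elt_arr[OF w(1)] and x' = B.elt_arr[OF x]
    have "far F ?d \<cdot> w = Zro B (Dom B w) (Cod B (far F ?d))"
      using B.reassoc[OF Fpm, of w] 0 w w' pm(1-3,6-8) by simp
    then obtain v where v: "elt B v (Dom B (far F ?d'))" "far F ?d' \<cdot> v = w"
      using B.exact_lift[OF B.exact_complexD(5)[OF Fc, of "n - 1"], of w] w(1) pm(1,2,8) by auto
    note v' = B.elt_arr[OF v(1)]
    have dv: "Dom B v = Dom B x" using arg_cong[OF v(2), of "Dom B"] v' w(2) D by simp
    have "far F p \<cdot> w = Zro B (Dom B v) (fob F (Dom B m))"
      using B.reassoc[OF z, of v] v v' D pm(1,6) by simp
    then show "x = Zro B (Dom B x) (Dom B (far F m))" using w(3) dv pm(6) by simp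
  qed
  ultimately show ?thesis
    using s B.complete_resolutionD(2)[OF assms(2)] B.short_exact_arr(3)[OF s(1)]
    unfolding admissible_def by metis
qed

lemma Gorenstein_admissible:
  assumes "compatible_C1 B F" "Gorenstein_projective B Y"
  shows "\<exists>m p. admissible m p \<and> Cod B p = Y \<and> Gorenstein_projective B (Dom B m)"
    and "\<exists>m p. admissible m p \<and> Dom B m = Y \<and> Gorenstein_projective B (Cod B p)"
proof -
  obtain P d p m where r: "complete_resolution B P d" and i: "is_image B (d 0) p m" "Cod B p = Y"
    using assms(2) unfolding Gorenstein_projective_def by blast
  note dn = B.exact_complexD[OF B.complete_resolutionD(1)[OF r]]
  obtain p0 m0 where i0: "is_image B (d (0 - 1)) p0 m0" using B.image_exists dn(1) by blast
  obtain p1 m1 where i1: "is_image B (d 1) p1 m1" using B.image_exists dn(1) by blast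
  have i': "is_image B (d (1 - 1)) p m" using i by simp
  show "\<exists>m p. admissible m p \<and> Cod B p = Y \<and> Gorenstein_projective B (Dom B m)"
    using admissible_image[OF assms(1) r i0 i(1)] i(2) B.Gorenstein_image[OF r i0]
      B.image_arr(3)[OF i0] by metis
  show "\<exists>m p. admissible m p \<and> Dom B m = Y \<and> Gorenstein_projective B (Cod B p)"
    using admissible_image[OF assms(1) r i' i1] i(2) B.Gorenstein_image[OF r i1]
      B.image_arr(3)[OF i(1)] by metis
qed

text \<open>A lift \<open>P \<rightarrow> e X\<close> of the cover \<open>P \<rightarrow> Y\<close> corresponds to \<open>f : l P \<rightarrow> X\<close>.  Under \<open>e\<close> it is a morphism from
  the extension of \<open>P\<close> by \<open>F P\<close> to that of \<open>Y\<close> by \<open>F Y\<close>, inducing \<open>P \<rightarrow> Y\<close> and \<open>F P \<rightarrow> F Y\<close> on the outer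
  terms, so the kernels form an extension of the same kind.\<close>

lemma syzygy_structure:
  assumes s: "extension_structure X Y j p" and a: "admissible m p0" and Y: "Cod B p0 = Y"
  shows "\<exists>x f j' p'. short_exact A x f \<and> Cod A f = X \<and> Dom A f = fob l (Dom B p0) \<and>
    extension_structure (Dom A x) (Dom B m) j' p' \<and> \<pi> (Dom B p0) \<cdot> far e x = m \<cdot> p'"
proof -
  note s' = extension_structureD[OF s] and a' = admissibleD[OF a]
  let ?P = "Dom B p0" and ?Y = "Dom B m"
  have P: "?P \<in> Ob B" "?Y \<in> Ob B" using a' by simp_all
  obtain t where t: "t \<in> Arr B" "Dom B t = ?P" "Cod B t = fob e X" "p \<cdot> t = p0"
    using B.Proj_lift[OF a'(2) s'(11) a'(7) refl] Y s'(8,9) by auto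
  let ?f = "lam X \<cdot>\<^bsub>A\<^esub> far l t"
  have f: "?f \<in> Arr A" "Dom A ?f = fob l ?P" "Cod A ?f = X" using t s'(1) by simp_all
  obtain f where fd: "f = ?f" by blast
  note f = f[folded fd]
  have fs: "far e f \<cdot> \<sigma> ?P = t" using free_map(1)[OF t(1,3) s'(1)] t(2) fd by simp
  have Fp: "far F p \<cdot> far F t = far F p0" using F.far_cmp[of t p] t s' by simp
  have fn: "far e f \<cdot> \<nu> ?P = j \<cdot> far F p0"
    using free_map(2)[OF t(1,3) s'(1)] t(1-3) fd B.reassoc[OF s'(13), of "far F t"] Fp s'(4-9) by simp
  have ef: "far e f \<in> Arr B" "Dom B (far e f) = fob e (fob l ?P)" "Cod B (far e f) = fob e X"
    using f by simp_all
  have fepi: "is_epi A f"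
  proof (rule e_reflects_epi[OF B.epi_elt])
    fix y assume "elt B y (Cod B (far e f))"
    then have y: "elt B y (fob e X)" using ef by simp
    note y' = B.elt_arr[OF y]
    have "elt B (p \<cdot> y) (Cod B p0)" using y' s' Y by (simp add: elt_def)
    then obtain w where w: "elt B w ?P" "Dom B w = Dom B y" "p0 \<cdot> w = p \<cdot> y"
      using B.epi_lift[OF a'(9)] s'(7,8) y' by (metis B.cmp_arr(2))
    note w' = B.elt_arr[OF w(1)]
    let ?z = "Sub B y (t \<cdot> w)"
    have z: "elt B ?z (Dom B p)" using y' w' w(2) t s'(8) by (simp add: elt_def)
    have "p \<cdot> ?z = Zro B (Dom B ?z) (Cod B p)"
      using y' w' w(2,3) t(1-3) s'(7-9) B.reassoc[OF t(4), of w] by simp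
    then obtain z where z: "elt B z (fob F Y)" "Dom B z = Dom B ?z" "j \<cdot> z = ?z"
      using B.exact_lift[OF B.short_exact_arr(7)[OF s'(3)] z] s'(5) by metis
    then obtain v where v: "elt B v (fob F ?P)" "Dom B v = Dom B z" "far F p0 \<cdot> v = z"
      using B.epi_lift[OF F_epi[OF a'(9)], of z] a'(7) Y by auto
    note v' = B.elt_arr[OF v(1)]
    have dv: "Dom B v = Dom B y" using v(2) z(2) w' w(2) y' t by simp
    have "far e f \<cdot> Add B (\<nu> ?P \<cdot> v) (\<sigma> ?P \<cdot> w) = Add B ?z (t \<cdot> w)"
      using B.reassoc[OF fs, of w] B.reassoc[OF fn, of v] ef w' v' dv w(2) P v(3) z(3) s'(4-9) a'(7) Y
      by simp
    also have "\<dots> = y" by (rule B.sub_add_cancel) (use y' w' w(2) t in simp_all)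
    finally show "\<exists>x. x \<in> Arr B \<and> Cod B x = Dom B (far e f) \<and> far e f \<cdot> x = y"
      using ef w' v' dv w(2) P by (intro exI[of _ "Add B (\<nu> ?P \<cdot> v) (\<sigma> ?P \<cdot> w)"]) simp
  qed (use f in simp_all)
  obtain x where k: "is_kernel A x f" using A.ex_kernel f(1) by blast
  have se: "short_exact A x f" using A.kernel_epi_short_exact[OF k fepi] .
  have sB: "short_exact B (far e x) (far e f)" using e.far_short_exact[OF se] .
  have kB: "is_kernel B (far e x) (far e f)" using B.short_exact_kernel[OF sB] .
  note k' = A.kernel_arr[OF k]
  let ?X = "Dom A x"
  have x: "x \<in> Arr A" "Cod A x = fob l ?P" "?X \<in> Ob A" using k' f by simp_all
  have ex: "far e x \<in> Arr B" "Dom B (far e x) = fob e ?X" "Cod B (far e x) = fob e (fob l ?P)"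
    using x by simp_all
  have efx: "far e f \<cdot> far e x = Zro B (fob e ?X) (fob e X)"
    using B.kernel_arr(4)[OF kB] ex ef by simp
  have pf: "p \<cdot> far e f = p0 \<cdot> \<pi> ?P"
  proof (rule el_ext[of _ ?P])
    show "(p \<cdot> far e f) \<cdot> \<sigma> ?P = (p0 \<cdot> \<pi> ?P) \<cdot> \<sigma> ?P"
      using fs t \<pi>_\<sigma>[OF P(1)] ef s'(7-9) P a'(7) by simp
    show "(p \<cdot> far e f) \<cdot> \<nu> ?P = (p0 \<cdot> \<pi> ?P) \<cdot> \<nu> ?P"
      using fn B.reassoc[OF s'(12), of "far F p0"] \<pi>_\<nu>[OF P(1)] ef s'(2,4-9) P a'(7) Y by simp
  qed (use ef s'(7-9) P a'(7) Y in simp_all)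
  have "p0 \<cdot> (\<pi> ?P \<cdot> far e x) = Zro B (fob e ?X) (Cod B p0)"
    using B.reassoc2[OF pf[symmetric], of "far e x"] efx ex ef s'(1,2,7-9) P a'(7) Y x(3) by simp
  then obtain p' where p': "p' \<in> Arr B" "Dom B p' = fob e ?X" "Cod B p' = ?Y"
    "m \<cdot> p' = \<pi> ?P \<cdot> far e x"
    by - (rule B.kernel_lift[OF B.short_exact_kernel[OF a'(1)], of "\<pi> ?P \<cdot> far e x" "fob e ?X"];
      use ex P in simp)
  have "far e f \<cdot> (\<nu> ?P \<cdot> far F m) = Zro B (fob F ?Y) (fob e X)"
    using B.reassoc[OF fn, of "far F m"] ef P a'(5-7,11) s'(1,2,4-6) Y by simp
  then obtain j' where j': "j' \<in> Arr B" "Dom B j' = fob F ?Y" "Cod B j' = fob e ?X"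
    "far e x \<cdot> j' = \<nu> ?P \<cdot> far F m"
    by - (rule B.kernel_lift[OF kB, of "\<nu> ?P \<cdot> far F m" "fob F ?Y"]; use ex ef P a'(5-7) in simp)
  have exm: "is_mono B (far e x)" using B.kernel_mono[OF kB] .
  have num: "is_mono B (\<nu> ?P \<cdot> far F m)"
    by (rule B.mono_cmp[OF a'(4) \<nu>_mono[OF P(1)]]) (use a'(5-7) P in simp)
  have "extension_structure ?X ?Y j' p'"
  proof (rule extension_structureI)
    show "is_mono B j'"
    proof (rule B.monoI[OF j'(1)])
      fix g W assume g: "g \<in> Arr B" "Dom B g = W" "Cod B g = Dom B j'" "j' \<cdot> g = Zro B W (Cod B j')"
      have W: "W \<in> Ob B" using g(1,2) by auto
      have "(\<nu> ?P \<cdot> far F m) \<cdot> g = far e x \<cdot> (j' \<cdot> g)"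
        using B.reassoc[OF j'(4), of g] g(1-3) j'(1-3) ex by simp
      also have "\<dots> = Zro B W (fob e (fob l ?P))" unfolding g(4) using W j' ex by simp
      finally show "g = Zro B W (Dom B j')"
        by - (rule B.mono_zero[OF num]; use g(1-3) j'(2) P a'(5-7) in simp)
    qed
    show "is_epi B p'"
    proof (rule B.epi_elt[OF p'(1)])
      fix y assume "elt B y (Cod B p')"
      then have y: "elt B y ?Y" using p' by simp
      note y' = B.elt_arr[OF y]
      have tm: "p \<cdot> (t \<cdot> (m \<cdot> y)) = Zro B (Dom B y) (Cod B p)"
        using B.reassoc[OF t(4), of "m \<cdot> y"] B.reassoc[OF a'(10), of y] t(1-3) a'(5-7) y' s'(2,7-9) Y
        by simp
      obtain z where z: "elt B z (fob F Y)" "Dom B z = Dom B y" "j \<cdot> z = t \<cdot> (m \<cdot> y)"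
        by (rule B.exact_lift[OF B.short_exact_arr(7)[OF s'(3)], of "t \<cdot> (m \<cdot> y)"])
          (use tm t(1-3) a'(5-7) y' s'(5,8) in \<open>auto simp: elt_def\<close>)
      obtain v where v: "elt B v (fob F ?P)" "Dom B v = Dom B z" "far F p0 \<cdot> v = z"
        using B.epi_lift[OF F_epi[OF a'(9)], of z] z(1) a'(7) Y by auto
      note v' = B.elt_arr[OF v(1)]
      let ?u = "Sub B (\<sigma> ?P \<cdot> (m \<cdot> y)) (\<nu> ?P \<cdot> v)"
      have u: "?u \<in> Arr B" "Dom B ?u = Dom B y" "Cod B ?u = fob e (fob l ?P)"
        using v' v(2) z(2) y' a'(5,6) P by simp_all
      have "far e f \<cdot> ?u = Zro B (Dom B y) (fob e X)"
        using B.reassoc[OF fs, of "m \<cdot> y"] B.reassoc[OF fn, of v] ef v' v(2,3) z(2,3) y' a'(5-7) P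
          s'(4-6) t(1-3) Y by simp
      then obtain c where c: "c \<in> Arr B" "Dom B c = Dom B y" "Cod B c = fob e ?X" "far e x \<cdot> c = ?u"
        by - (rule B.kernel_lift[OF kB, of ?u "Dom B y"]; use u ef ex in simp)
      have "\<pi> ?P \<cdot> ?u = m \<cdot> y"
        using B.reassoc[OF \<pi>_\<sigma>[OF P(1)], of "m \<cdot> y"] B.reassoc[OF \<pi>_\<nu>[OF P(1)], of v]
          v' v(2) z(2) y' a'(5-7) P by simp
      then have "m \<cdot> (p' \<cdot> c) = m \<cdot> y"
        using B.reassoc2[OF p'(4), of c] c p'(1-3) a'(5,6) P ex by simp
      then have "p' \<cdot> c = y"
        by - (rule B.mono_cancel[OF a'(8)]; use c(1-3) p'(1-3) y' in simp)
      then show "\<exists>x. x \<in> Arr B \<and> Cod B x = Dom B p' \<and> p' \<cdot> x = y"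
        using c p'(2) by auto
    qed
    have "m \<cdot> (p' \<cdot> j') = Zro B (fob F ?Y) ?P"
      using B.reassoc2[OF p'(4), of j'] B.reassoc[OF \<pi>_\<nu>[OF P(1)], of "far F m"] j' p'(1-3) ex P a'(5-7)
      by simp
    then show "p' \<cdot> j' = Zro B (fob F ?Y) ?Y"
      by - (rule B.mono_zero[OF a'(8)]; use j'(1-3) p'(1-3) a'(5,6) in simp)
    have "far e x \<cdot> (j' \<cdot> far F p') = \<nu> ?P \<cdot> (far F m \<cdot> far F p')"
      by (rule B.reassoc2[OF j'(4)]) (use j'(1-3) p'(1-3) ex P a'(5-7) in simp_all)
    also have "\<dots> = \<nu> ?P \<cdot> (far F (\<pi> ?P) \<cdot> far F (far e x))"
      using F.far_cmp[of p' m] F.far_cmp[of "far e x" "\<pi> ?P"] p' a'(5,6) ex P by simp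
    also have "\<dots> = act (fob l ?P) \<cdot> far F (far e x)"
      unfolding act_free[OF P(1)] using ex P by simp
    also have "\<dots> = far e x \<cdot> act ?X" using act_nat[OF x(1)] x(2) by simp
    finally show "j' \<cdot> far F p' = act ?X"
      by - (rule B.mono_cancel[OF exm]; use j'(1-3) p'(1-3) x ex in simp)
    fix y assume y: "elt B y (fob e ?X)" "p' \<cdot> y = Zro B (Dom B y) ?Y"
    note y' = B.elt_arr[OF y(1)]
    have py: "\<pi> ?P \<cdot> (far e x \<cdot> y) = Zro B (Dom B y) ?P"
      using B.reassoc2[OF p'(4), of y] y y' p'(1-3) a'(5,6) P ex by simp
    obtain z where z: "z \<in> Arr B" "Dom B z = Dom B y" "Cod B z = fob F ?P" "\<nu> ?P \<cdot> z = far e x \<cdot> y"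
      by (rule B.kernel_lift[OF \<nu>_kernel[OF P(1)], of "far e x \<cdot> y" "Dom B y"])
        (use py ex y' P in auto)
    have "far e f \<cdot> (\<nu> ?P \<cdot> z) = Zro B (Dom B y) (fob e X)"
      unfolding z(4) using B.reassoc[OF efx, of y] ef ex y' s'(1) by simp
    then have "j \<cdot> (far F p0 \<cdot> z) = Zro B (Dom B y) (fob e X)"
      using B.reassoc[OF fn, of z] z(1-3) ef P a'(7) s'(4-6) Y by simp
    then have "far F p0 \<cdot> z = Zro B (Dom B z) (Cod B (far F p0))"
      by - (rule B.mono_zero[OF s'(10)]; use z(1-3) a'(7) Y s'(4-6) in simp)
    then obtain w where w: "elt B w (fob F ?Y)" "Dom B w = Dom B z" "far F m \<cdot> w = z"
      using B.exact_lift[OF a'(12), of z] z(1-3) y' a'(5-7) by (auto simp: elt_def)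
    note w' = B.elt_arr[OF w(1)]
    have "far e x \<cdot> (j' \<cdot> w) = \<nu> ?P \<cdot> (far F m \<cdot> w)"
      by (rule B.reassoc2[OF j'(4)]) (use j'(1-3) w' ex P a'(5-7) in simp_all)
    then have "j' \<cdot> w = y"
      unfolding w(3) z(4) by - (rule B.mono_cancel[OF exm]; use j'(1-3) w' w(2) z(2) y' ex in simp)
    then show "\<exists>x. x \<in> Arr B \<and> Cod B x = fob F ?Y \<and> j' \<cdot> x = y" using w' by auto
  qed (use x j' p' in simp_all)
  then show ?thesis using se f p'(4) by metis
qed

end

context square_zero
begin

text \<open>The vanishing of \<open>Ext\<^sup>1(Y, Z)\<close> is available only as extendability along the first map of an
  admissible sequence ending in \<open>Y\<close>.  To use it for the sequence \<open>F Y \<rightarrow> e X \<rightarrow> Y\<close>, the latter is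
  presented as a quotient of the direct sum of \<open>F Y\<close> and the middle term of the former.\<close>

lemma extends_along_structure:
  assumes s: "extension_structure X Y j p" and a: "admissible m p1" "Cod B p1 = Y" "extends B m Z"
    and \<phi>: "\<phi> \<in> Arr B" "Dom B \<phi> = fob F Y" "Cod B \<phi> = Z"
  obtains h where "h \<in> Arr B" "Dom B h = fob e X" "Cod B h = Z" "h \<cdot> j = \<phi>"
proof -
  note s' = extension_structureD[OF s] and a' = admissibleD[OF a(1)]
  let ?P = "Dom B p1" and ?Y = "Dom B m"
  have P: "?P \<in> Ob B" "?Y \<in> Ob B" using a' by simp_all
  have Z: "Z \<in> Ob B" using \<phi> by auto
  obtain t where t: "t \<in> Arr B" "Dom B t = ?P" "Cod B t = fob e X" "p \<cdot> t = p1"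
    using B.Proj_lift[OF a'(2) s'(11) a'(7) refl] a(2) s'(8,9) by auto
  have "p \<cdot> (t \<cdot> m) = Zro B ?Y Y"
    using B.reassoc[OF t(4), of m] a'(5-7,10) t(1-3) s'(7-9) a(2) by simp
  then obtain s where sm: "s \<in> Arr B" "Dom B s = ?Y" "Cod B s = fob F Y" "j \<cdot> s = t \<cdot> m"
    by - (rule B.kernel_lift[OF B.short_exact_kernel[OF s'(3)], of "t \<cdot> m" ?Y];
      use t(1-3) a'(5-7) s' in simp)
  obtain g where g: "g \<in> Arr B" "Dom B g = ?P" "Cod B g = Z" "g \<cdot> m = \<phi> \<cdot> s"
    by (rule extendsD[OF a(3), of "\<phi> \<cdot> s"]) (use \<phi> sm a'(6) in auto)
  have mp: "exact_at B m p1" "is_epi B p1" "Cod B p1 = Cod B p"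
    using B.short_exact_arr[OF a'(1)] s'(9) a(2) by simp_all
  have "Dom B p = Cod B t" "Dom B s = Dom B m" "Cod B s = Dom B j" using t(3) sm s'(5,8) by simp_all
  from B.mapping_cone_exact[OF s'(3) mp t(1,2) this(1)[symmetric] t(4) sm(1) this(2,3) sm(4)]
  obtain S r1 r2 i1 b c where r: "r1 \<in> Arr B" "Dom B r1 = S" "Cod B r1 = fob F Y"
    "r2 \<in> Arr B" "Dom B r2 = S" "Cod B r2 = ?P"
    "i1 \<in> Arr B" "Dom B i1 = fob F Y" "Cod B i1 = S"
    "r1 \<cdot> i1 = Idt B (fob F Y)" "r2 \<cdot> i1 = Zro B (fob F Y) ?P"
    and b: "b \<in> Arr B" "Dom B b = ?Y" "Cod B b = S" "r1 \<cdot> b = Neg B s" "r2 \<cdot> b = m"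
    and c: "c \<in> Arr B" "Dom B c = S" "Cod B c = fob e X" "c \<cdot> i1 = j" "exact_at B b c" "is_epi B c"
    unfolding s'(5,8) by blast
  let ?f = "Add B (\<phi> \<cdot> r1) (g \<cdot> r2)"
  have f: "?f \<in> Arr B" "Dom B ?f = S" "Cod B ?f = Z" using r(1-6) \<phi> g(1-3) by simp_all
  have \<phi>s: "\<phi> \<cdot> s \<in> Arr B" "Dom B (\<phi> \<cdot> s) = ?Y" "Cod B (\<phi> \<cdot> s) = Z" using \<phi> sm by simp_all
  have "?f \<cdot> b = Add B (Neg B (\<phi> \<cdot> s)) (\<phi> \<cdot> s)"
    using r(1-6) \<phi> g b sm(1-3) by simp
  also have "\<dots> = Zro B ?Y Z" using B.add_neg[OF \<phi>s(1)] \<phi>s(2,3) by simp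
  finally obtain h where h: "h \<in> Arr B" "Dom B h = fob e X" "Cod B h = Z" "h \<cdot> c = ?f"
    by - (rule B.cokernel_desc[OF B.exact_epi_cokernel[OF c(5,6)], of ?f Z]; use b(1-3) c(1-3) f in simp)
  have "?f \<cdot> i1 = \<phi>" using r \<phi> g(1-3) Z P s'(2) by simp
  then have "h \<cdot> j = \<phi>"
    using B.reassoc[OF h(4), of i1] h(1-3) c(1-4) r(7-9) by simp
  then show ?thesis using h that by blast
qed

text \<open>Dually, \<open>F Y \<rightarrow> F P\<close> is extended to \<open>h : e X \<rightarrow> F P\<close>, and \<open>h\<close> together with \<open>e X \<rightarrow> Y \<rightarrow> P\<close> is a morphism
  \<open>X \<rightarrow> l P\<close> inducing \<open>Y \<rightarrow> P\<close> and \<open>F Y \<rightarrow> F P\<close>.  Both are mono, and the cokernels form an extension of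
  the same kind.\<close>

lemma cosyzygy_structure:
  assumes s: "extension_structure X Y j p" and a: "admissible m p0" and Y: "Dom B m = Y"
    and a1: "admissible m1 p1" "Cod B p1 = Y"
  shows "\<exists>x f j' p'. short_exact A x f \<and> Dom A x = X \<and> Dom A f = fob l (Dom B p0) \<and>
    extension_structure (Cod A f) (Cod B p0) j' p' \<and> \<pi> (Dom B p0) \<cdot> far e x = m \<cdot> p"
proof -
  note s' = extension_structureD[OF s] and a' = admissibleD[OF a]
  let ?P = "Dom B p0" and ?Y = "Cod B p0"
  have P: "?P \<in> Ob B" "?Y \<in> Ob B" using a' by simp_all
  have m: "m \<in> Arr B" "Dom B m = Y" "Cod B m = ?P" using a' Y by simp_all
  have Fm: "far F m \<in> Arr B" "Dom B (far F m) = fob F Y" "Cod B (far F m) = fob F ?P" using m by simp_all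
  have "extends B m1 (fob F ?P)" using a1(1) a'(2) by (simp add: admissible_def)
  then obtain h where h: "h \<in> Arr B" "Dom B h = fob e X" "Cod B h = fob F ?P" "h \<cdot> j = far F m"
    using extends_along_structure[OF s a1 _ Fm] by blast
  obtain g where gd: "g = Add B (\<nu> ?P \<cdot> h) (\<sigma> ?P \<cdot> (m \<cdot> p))" by blast
  have g: "g \<in> Arr B" "Dom B g = fob e X" "Cod B g = fob e (fob l ?P)"
    using h(1-3) m s'(7-9) P gd by simp_all
  have \<pi>g: "\<pi> ?P \<cdot> g = m \<cdot> p"
    using B.reassoc[OF \<pi>_\<nu>[OF P(1)], of h] B.reassoc[OF \<pi>_\<sigma>[OF P(1)], of "m \<cdot> p"]
      h(1-3) m s'(1,7-9) P gd by simp
  have gj: "g \<cdot> j = \<nu> ?P \<cdot> far F m"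
    using h m s'(2,4-9,12) P gd by simp
  have "act (fob l ?P) \<cdot> far F g = \<nu> ?P \<cdot> far F (m \<cdot> p)"
    unfolding act_free[OF P(1)] \<pi>g[symmetric] using g P by simp
  also have "\<dots> = g \<cdot> act X"
    unfolding s'(13)[symmetric]
    using B.reassoc2[OF gj, of "far F p"] g m P s'(4-9) by simp
  finally obtain x where x: "x \<in> Arr A" "Dom A x = X" "Cod A x = fob l ?P" "far e x = g"
    using act_fullness[OF g s'(1), of] P by (metis L.fob_ob)
  have zero: "v = Zro B (Dom B v) (fob e X)"
    if v: "elt B v (fob e X)" "g \<cdot> v = Zro B (Dom B v) (fob e (fob l ?P))" for v
  proof -
    note v' = B.elt_arr[OF v(1)]
    have "m \<cdot> (p \<cdot> v) = Zro B (Dom B v) ?P"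
      using B.reassoc2[OF \<pi>g, of v] v(2) v' g m s'(7-9) P by simp
    then have "p \<cdot> v = Zro B (Dom B v) (Cod B p)"
      by - (rule B.mono_zero[OF a'(8)]; use v' m s'(7-9) in simp)
    then obtain z where z: "elt B z (fob F Y)" "Dom B z = Dom B v" "j \<cdot> z = v"
      using B.exact_lift[OF B.short_exact_arr(7)[OF s'(3)], of v] v(1) s'(5,8) by metis
    note z' = B.elt_arr[OF z(1)]
    have "\<nu> ?P \<cdot> (far F m \<cdot> z) = Zro B (Dom B v) (fob e (fob l ?P))"
      using B.reassoc2[OF gj, of z] z z' v(2) g m P s'(4-6) by simp
    then have "far F m \<cdot> z = Zro B (Dom B v) (fob F ?P)"
      by - (rule B.mono_zero[OF \<nu>_mono[OF P(1)]]; use z' z(2) m P in simp)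
    then have "z = Zro B (Dom B v) (fob F Y)"
      by - (rule B.mono_zero[OF a'(4)]; use z' z(2) m in simp)
    then have "j \<cdot> z = Zro B (Dom B v) (fob e X)" using s'(4-6) v' by simp
    then show ?thesis unfolding z(3) .
  qed
  have xm: "is_mono A x"
  proof (rule e_reflects_mono[OF B.mono_elt])
    fix v assume "elt B v (Dom B (far e x))" "far e x \<cdot> v = Zro B (Dom B v) (Cod B (far e x))"
    then show "v = Zro B (Dom B v) (Dom B (far e x))" using zero[of v] x g by simp
  qed (use x g in simp_all)
  obtain f where c: "is_cokernel A f x" using A.ex_cokernel x(1) by blast
  have se: "short_exact A x f" using A.mono_cokernel_short_exact[OF c xm] .
  have sB: "short_exact B g (far e f)" using e.far_short_exact[OF se] x(4) by simp
  have cB: "is_cokernel B (far e f) g" using B.short_exact_cokernel[OF sB] .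
  note c' = A.cokernel_arr[OF c]
  let ?X = "Cod A f"
  have f: "f \<in> Arr A" "Dom A f = fob l ?P" "?X \<in> Ob A" using c' x by simp_all
  have ef: "far e f \<in> Arr B" "Dom B (far e f) = fob e (fob l ?P)" "Cod B (far e f) = fob e ?X"
    using f by simp_all
  note sB' = B.short_exact_arr[OF sB]
  have fg: "far e f \<cdot> g = Zro B (fob e X) (fob e ?X)" using sB'(4) g ef by simp
  have fepi: "is_epi B (far e f)" using sB' by simp
  have "(p0 \<cdot> \<pi> ?P) \<cdot> g = Zro B (fob e X) ?Y"
    using \<pi>g B.reassoc[OF a'(10), of p] g m a'(7) s'(7-9) P by simp
  then obtain p' where p': "p' \<in> Arr B" "Dom B p' = fob e ?X" "Cod B p' = ?Y"
    "p' \<cdot> far e f = p0 \<cdot> \<pi> ?P"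
    by - (rule B.cokernel_desc[OF cB, of "p0 \<cdot> \<pi> ?P" ?Y]; use g ef a'(7) P in simp)
  have "far e f \<cdot> (\<nu> ?P \<cdot> far F m) = Zro B (fob F Y) (fob e ?X)"
    unfolding gj[symmetric] using B.reassoc[OF fg, of j] ef g s'(1,4-6) f(3) by simp
  then have fz: "(far e f \<cdot> \<nu> ?P) \<cdot> far F m = Zro B (Dom B (far F m)) (fob e ?X)"
    using ef m P by simp
  have Fp0: "is_cokernel B (far F p0) (far F m)"
    using B.exact_epi_cokernel[OF a'(12) F_epi[OF a'(9)]] .
  obtain j' where j': "j' \<in> Arr B" "Dom B j' = fob F ?Y" "Cod B j' = fob e ?X"
    "j' \<cdot> far F p0 = far e f \<cdot> \<nu> ?P"
    by (rule B.cokernel_desc[OF Fp0, of "far e f \<cdot> \<nu> ?P" "fob e ?X"])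
      (use fz ef m P a'(7) in auto)
  have "extension_structure ?X ?Y j' p'"
  proof (rule extension_structureI)
    show "is_mono B j'"
    proof (rule B.mono_elt[OF j'(1)])
      fix z assume "elt B z (Dom B j')" "j' \<cdot> z = Zro B (Dom B z) (Cod B j')"
      then have z: "elt B z (fob F ?Y)" "j' \<cdot> z = Zro B (Dom B z) (fob e ?X)" using j' by simp_all
      note z' = B.elt_arr[OF z(1)]
      obtain w where w: "elt B w (fob F ?P)" "Dom B w = Dom B z" "far F p0 \<cdot> w = z"
        using B.epi_lift[OF F_epi[OF a'(9)], of z] z(1) a'(7) by auto
      note w' = B.elt_arr[OF w(1)]
      have "far e f \<cdot> (\<nu> ?P \<cdot> w) = j' \<cdot> (far F p0 \<cdot> w)"
        by (rule B.reassoc2[OF j'(4)[symmetric]]) (use ef w' P j'(1-3) a'(7) in simp_all)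
      then have "far e f \<cdot> (\<nu> ?P \<cdot> w) = Zro B (Dom B z) (fob e ?X)" unfolding w(3) z(2) .
      then obtain v where v: "elt B v (fob e X)" "Dom B v = Dom B z" "g \<cdot> v = \<nu> ?P \<cdot> w"
        using B.exact_lift[OF sB'(7), of "\<nu> ?P \<cdot> w"] w' w(2) P g ef by (auto simp: elt_def)
      note v' = B.elt_arr[OF v(1)]
      have "m \<cdot> (p \<cdot> v) = Zro B (Dom B z) ?P"
        using B.reassoc2[OF \<pi>g, of v] v(2,3) v' g m s'(7-9) P B.reassoc[OF \<pi>_\<nu>[OF P(1)], of w] w' w(2)
        by simp
      then have "p \<cdot> v = Zro B (Dom B v) (Cod B p)"
        by - (rule B.mono_zero[OF a'(8)]; use v' v(2) m s'(7-9) in simp)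
      then obtain z1 where z1: "elt B z1 (fob F Y)" "Dom B z1 = Dom B v" "j \<cdot> z1 = v"
        using B.exact_lift[OF B.short_exact_arr(7)[OF s'(3)], of v] v(1) s'(5,8) by metis
      note z1' = B.elt_arr[OF z1(1)]
      have "\<nu> ?P \<cdot> (far F m \<cdot> z1) = \<nu> ?P \<cdot> w"
        using B.reassoc2[OF gj, of z1] z1 z1' v(3) g m P s'(4-6) by simp
      then have "far F m \<cdot> z1 = w"
        by - (rule B.mono_cancel[OF \<nu>_mono[OF P(1)]]; use z1' z1(2) v(2) w' w(2) m P in simp)
      then have "z = far F p0 \<cdot> (far F m \<cdot> z1)" using w(3) by simp
      also have "\<dots> = Zro B (Dom B z) (Dom B j')"
        using B.reassoc[OF a'(11), of z1] z1' z1(2) v(2) m a'(7) P j'(2) by simp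
      finally show "z = Zro B (Dom B z) (Dom B j')" .
    qed
    have "is_epi B (\<pi> ?P)"
      by (rule B.split_epi[of _ "\<sigma> ?P"]) (use P \<pi>_\<sigma> in simp_all)
    then have pp: "is_epi B (p' \<cdot> far e f)"
      unfolding p'(4) by (rule B.epi_cmp[OF _ a'(9)]) (use P in simp)
    show "is_epi B p'"
    proof (rule B.epiI[OF p'(1)])
      fix k W assume k: "k \<in> Arr B" "Dom B k = Cod B p'" "Cod B k = W" "k \<cdot> p' = Zro B (Dom B p') W"
      have W: "W \<in> Ob B" using k(1,3) by auto
      have "k \<cdot> (p' \<cdot> far e f) = Zro B (fob e (fob l ?P)) W"
        using B.reassoc[OF k(4), of "far e f"] k(1-3) p'(1-3) ef W by simp
      then show "k = Zro B (Cod B p') W"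
        by - (rule B.epi_zero[OF pp]; use k(1-3) p'(1-3) ef in simp)
    qed
    have "(p' \<cdot> j') \<cdot> far F p0 = Zro B (fob F ?P) ?Y"
      using j' p'(1-3) B.reassoc2[OF p'(4), of "\<nu> ?P"] \<pi>_\<nu>[OF P(1)] ef a'(7) P by simp
    then show "p' \<cdot> j' = Zro B (fob F ?Y) ?Y"
      by - (rule B.epi_zero[OF F_epi[OF a'(9)]]; use j'(1-3) p'(1-3) a'(7) in simp)
    have "(j' \<cdot> far F p') \<cdot> far F (far e f) = j' \<cdot> (far F p0 \<cdot> far F (\<pi> ?P))"
      using F.far_cmp[of "far e f" p'] F.far_cmp[of "\<pi> ?P" p0] p' ef a'(7) P j'(1-3) by simp
    also have "\<dots> = far e f \<cdot> (\<nu> ?P \<cdot> far F (\<pi> ?P))"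
      by (rule B.reassoc2[OF j'(4)]) (use j'(1-3) ef P a'(7) in simp_all)
    also have "\<dots> = act ?X \<cdot> far F (far e f)"
      using act_nat[OF f(1)] act_free[OF P(1)] f(2) by simp
    finally show "j' \<cdot> far F p' = act ?X"
      by - (rule B.epi_cancel[OF F_epi[OF fepi]]; use j'(1-3) p'(1-3) f ef in simp)
    fix y assume y: "elt B y (fob e ?X)" "p' \<cdot> y = Zro B (Dom B y) ?Y"
    note y' = B.elt_arr[OF y(1)]
    obtain w where w: "elt B w (fob e (fob l ?P))" "Dom B w = Dom B y" "far e f \<cdot> w = y"
      using B.epi_lift[OF fepi, of y] y(1) ef by auto
    note w' = B.elt_arr[OF w(1)]
    have "p0 \<cdot> (\<pi> ?P \<cdot> w) = p' \<cdot> (far e f \<cdot> w)"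
      by (rule B.reassoc2[OF p'(4)[symmetric]]) (use p'(1-3) w' ef P a'(7) in simp_all)
    then have "p0 \<cdot> (\<pi> ?P \<cdot> w) = Zro B (Dom B y) ?Y" unfolding w(3) y(2) .
    then obtain y0 where y0: "elt B y0 Y" "Dom B y0 = Dom B y" "m \<cdot> y0 = \<pi> ?P \<cdot> w"
      using B.exact_lift[OF B.short_exact_arr(7)[OF a'(1)], of "\<pi> ?P \<cdot> w"] w' w(2) m P
      by (auto simp: elt_def)
    then obtain v where v: "elt B v (fob e X)" "Dom B v = Dom B y" "p \<cdot> v = y0"
      using B.epi_lift[OF s'(11), of y0] s'(8,9) by metis
    note v' = B.elt_arr[OF v(1)]
    let ?w = "Sub B w (g \<cdot> v)"
    have w2: "?w \<in> Arr B" "Dom B ?w = Dom B y" "Cod B ?w = fob e (fob l ?P)"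
      using w' w(2) v' v(2) g by simp_all
    have "\<pi> ?P \<cdot> ?w = Zro B (Dom B y) ?P"
      using B.reassoc2[OF \<pi>g, of v] v v' w' w(2) y0(3)[symmetric] B.elt_arr[OF y0(1)] y0(2) g m s'(7-9) P
      by simp
    then obtain z where z: "z \<in> Arr B" "Dom B z = Dom B y" "Cod B z = fob F ?P" "\<nu> ?P \<cdot> z = ?w"
      by - (rule B.kernel_lift[OF \<nu>_kernel[OF P(1)], of ?w "Dom B y"]; use w2 P in simp)
    have "j' \<cdot> (far F p0 \<cdot> z) = far e f \<cdot> (\<nu> ?P \<cdot> z)"
      by (rule B.reassoc2[OF j'(4)]) (use j'(1-3) z(1-3) ef P a'(7) in simp_all)
    also have "\<dots> = y"
      unfolding z(4) using B.reassoc[OF fg, of v] w w' v' v(2) ef g s'(1) f(3) y' by simp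
    finally show "\<exists>x. x \<in> Arr B \<and> Cod B x = fob F ?Y \<and> j' \<cdot> x = y"
      using z(1-3) a'(7) by (intro exI[of _ "far F p0 \<cdot> z"]) simp
  qed (use f j' p' in simp_all)
  then show ?thesis using se x f(2) \<pi>g by metis
qed

text \<open>A morphism into \<open>l Q\<close> is first corrected so that its component in \<open>Q\<close> vanishes.  What is left
  takes values in the subobject \<open>F Q\<close>, on which \<open>F\<close> acts as zero, so it too descends to \<open>Y\<close>.\<close>

lemma extends_free:
  assumes s: "extension_structure X Y j p" and x: "x \<in> Arr A" "Dom A x = X" "Cod A x = fob l P"
    and m: "m \<in> Arr B" "Dom B m = Y" "Cod B m = P" "\<pi> P \<cdot> far e x = m \<cdot> p"
    and ext: "extends B m Q" "extends B m (fob F Q)" and Q: "Q \<in> Ob B"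
  shows "extends A x (fob l Q)"
  unfolding extends_def
proof
  note s' = extension_structureD[OF s]
  have P: "P \<in> Ob B" using m by auto
  let ?LQ = "fob l Q"
  have cok: "is_cokernel B p j" using B.short_exact_cokernel[OF s'(3)] .
  have ex: "far e x \<in> Arr B" "Dom B (far e x) = fob e X" "Cod B (far e x) = fob e (fob l P)" using x by simp_all
  fix \<phi> assume "\<phi> \<in> Hom A (Dom A x) ?LQ"
  then have \<phi>: "\<phi> \<in> Arr A" "Dom A \<phi> = X" "Cod A \<phi> = ?LQ" using x by (auto simp: Hom_def)
  have act_mor: "\<nu> Q \<cdot> (far F (\<pi> Q) \<cdot> far F (far e \<psi>)) = far e \<psi> \<cdot> act X"
    if "\<psi> \<in> Arr A" "Dom A \<psi> = X" "Cod A \<psi> = ?LQ" for \<psi>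
    using act_nat[OF that(1)] that act_free[OF Q] Q by simp
  have "(\<pi> Q \<cdot> (far e \<phi> \<cdot> j)) \<cdot> far F p = \<pi> Q \<cdot> (far e \<phi> \<cdot> act X)"
    unfolding s'(13)[symmetric] using \<phi> Q s'(4-9) by simp
  also have "\<dots> = Zro B (fob F (fob e X)) Q"
    unfolding act_mor[OF \<phi>, symmetric]
    using B.reassoc[OF \<pi>_\<nu>[OF Q], of "far F (\<pi> Q) \<cdot> far F (far e \<phi>)"] Q \<phi> s'(1) by simp
  finally have "\<pi> Q \<cdot> (far e \<phi> \<cdot> j) = Zro B (fob F Y) Q"
    by - (rule B.epi_zero[OF F_epi[OF s'(11)]]; use Q \<phi> s'(4-9) in simp)
  then obtain f0 where f0: "f0 \<in> Arr B" "Dom B f0 = Y" "Cod B f0 = Q" "f0 \<cdot> p = \<pi> Q \<cdot> far e \<phi>"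
    by - (rule B.cokernel_desc[OF cok, of "\<pi> Q \<cdot> far e \<phi>" Q]; use Q \<phi> s'(4-9) in simp)
  obtain f1 where f1: "f1 \<in> Arr B" "Dom B f1 = P" "Cod B f1 = Q" "f1 \<cdot> m = f0"
    using extendsD[OF ext(1) f0(1) _ f0(3)] f0(2) m by auto
  let ?\<phi> = "Sub A \<phi> (far l f1 \<cdot>\<^bsub>A\<^esub> x)"
  obtain \<phi>1 where \<phi>1d: "\<phi>1 = ?\<phi>" by blast
  have lx: "far l f1 \<cdot>\<^bsub>A\<^esub> x \<in> Arr A" "Dom A (far l f1 \<cdot>\<^bsub>A\<^esub> x) = X" "Cod A (far l f1 \<cdot>\<^bsub>A\<^esub> x) = ?LQ"
    using f1 x by simp_all
  have \<phi>1: "\<phi>1 \<in> Arr A" "Dom A \<phi>1 = X" "Cod A \<phi>1 = ?LQ"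
    using \<phi> lx A.sub_arr[OF \<phi>(1) lx(1)] by (simp_all add: \<phi>1d)
  have "\<pi> Q \<cdot> (far e (far l f1) \<cdot> far e x) = f1 \<cdot> (\<pi> P \<cdot> far e x)"
    using B.reassoc2[OF \<pi>_nat[OF f1(1)], of "far e x"] f1 ex P Q by simp
  also have "\<dots> = \<pi> Q \<cdot> far e \<phi>"
    unfolding m(4) using B.reassoc[OF f1(4), of p] f0 f1 m s'(7-9) by simp
  finally have "\<pi> Q \<cdot> far e \<phi>1 = Zro B (fob e X) Q"
    using \<phi> f1 x Q by (simp add: \<phi>1d)
  then obtain w where w: "w \<in> Arr B" "Dom B w = fob e X" "Cod B w = fob F Q" "\<nu> Q \<cdot> w = far e \<phi>1"
    by - (rule B.kernel_lift[OF \<nu>_kernel[OF Q], of "far e \<phi>1" "fob e X"]; use \<phi>1 Q in simp)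
  have F\<pi>: "far F (\<pi> Q) \<cdot> far F (far e \<phi>1) = Zro B (fob F (fob e X)) (fob F Q)"
    using F.far_cmp[of "far e \<phi>1" "\<pi> Q"] \<open>\<pi> Q \<cdot> far e \<phi>1 = Zro B (fob e X) Q\<close> \<phi>1 Q s'(1) by simp
  have "\<nu> Q \<cdot> ((w \<cdot> j) \<cdot> far F p) = far e \<phi>1 \<cdot> act X"
    unfolding s'(13)[symmetric] using B.reassoc[OF w(4), of "j \<cdot> far F p"] w(1-3) Q s'(4-9) by simp
  also have "\<dots> = Zro B (fob F (fob e X)) (fob e ?LQ)"
    unfolding act_mor[OF \<phi>1, symmetric] F\<pi> using Q s'(1) by simp
  finally have "(w \<cdot> j) \<cdot> far F p = Zro B (fob F (fob e X)) (fob F Q)"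
    by - (rule B.mono_zero[OF \<nu>_mono[OF Q]]; use w(1-3) Q s'(4-9) in simp)
  then have "w \<cdot> j = Zro B (fob F Y) (fob F Q)"
    by - (rule B.epi_zero[OF F_epi[OF s'(11)]]; use w(1-3) s'(4-9) in simp)
  then obtain w0 where w0: "w0 \<in> Arr B" "Dom B w0 = Y" "Cod B w0 = fob F Q" "w0 \<cdot> p = w"
    by - (rule B.cokernel_desc[OF cok, of w "fob F Q"]; use w(1-3) s'(4-9) in simp)
  obtain w1 where w1: "w1 \<in> Arr B" "Dom B w1 = P" "Cod B w1 = fob F Q" "w1 \<cdot> m = w0"
    using extendsD[OF ext(2) w0(1) _ w0(3)] w0(2) m by auto
  let ?t = "\<nu> Q \<cdot> w1"
  have t: "?t \<in> Arr B" "Dom B ?t = P" "Cod B ?t = fob e ?LQ" using w1(1-3) Q by simp_all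
  obtain \<psi> where \<psi>d: "\<psi> = lam ?LQ \<cdot>\<^bsub>A\<^esub> far l ?t" by blast
  have \<psi>: "\<psi> \<in> Arr A" "Dom A \<psi> = fob l P" "Cod A \<psi> = ?LQ" unfolding \<psi>d using t Q by simp_all
  have "far e \<psi> = ?t \<cdot> \<pi> P"
  proof (rule el_ext[of _ P])
    show "far e \<psi> \<cdot> \<sigma> P = (?t \<cdot> \<pi> P) \<cdot> \<sigma> P"
      using free_map(1)[OF t(1,3)] t(2) Q \<psi>d w1(1-3) \<pi>_\<sigma>[OF P] P by simp
    have "far e \<psi> \<cdot> \<nu> P = act ?LQ \<cdot> far F ?t"
      using free_map(2)[OF t(1,3)] t(2) Q \<psi>d by simp
    also have "\<dots> = Zro B (fob F P) (fob e ?LQ)"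
    proof -
      have "far F (\<pi> Q) \<cdot> far F (\<nu> Q) = Zro B (fob F (fob F Q)) (fob F Q)"
        using F.far_cmp[of "\<nu> Q" "\<pi> Q"] \<pi>_\<nu>[OF Q] Q by simp
      from B.reassoc[OF this, of "far F w1"] show ?thesis
        unfolding act_free[OF Q] using Q w1(1-3) P by simp
    qed
    finally show "far e \<psi> \<cdot> \<nu> P = (?t \<cdot> \<pi> P) \<cdot> \<nu> P"
      using w1(1-3) \<pi>_\<nu>[OF P] P Q by simp
  qed (use \<psi> t P Q w1(1-3) in simp_all)
  then have "far e (\<psi> \<cdot>\<^bsub>A\<^esub> x) = ?t \<cdot> (m \<cdot> p)"
    using e.far_cmp[of x \<psi>] \<psi> x w1(1-3) Q P ex m s'(7-9) by simp
  also have "\<dots> = far e \<phi>1"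
    using B.reassoc[OF w1(4), of p] w0(4) w(4) w1(1-3) m s'(7-9) Q by simp
  finally have \<psi>x: "\<psi> \<cdot>\<^bsub>A\<^esub> x = \<phi>1" using \<psi> x \<phi>1 by (intro e_inj) simp_all
  have "Add A \<psi> (far l f1) \<cdot>\<^bsub>A\<^esub> x = Add A \<phi>1 (far l f1 \<cdot>\<^bsub>A\<^esub> x)"
    using \<psi> x f1(1-3) \<psi>x by simp
  also have "\<dots> = \<phi>"
    unfolding \<phi>1d by (rule A.sub_add_cancel) (use \<phi> lx in simp_all)
  finally show "\<exists>\<psi> \<in> Hom A (Cod A x) ?LQ. \<psi> \<cdot>\<^bsub>A\<^esub> x = \<phi>"
    using \<psi> f1(1-3) x by (intro bexI[of _ "Add A \<psi> (far l f1)"]) (simp_all add: Hom_def)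
qed

lemma Proj_retract_free:
  assumes Q: "Q \<in> Proj A"
  obtains P r s where "P \<in> Proj B" "r \<in> Arr A" "Dom A r = fob l P" "Cod A r = Q"
    "s \<in> Arr A" "Dom A s = Q" "Cod A s = fob l P" "r \<cdot>\<^bsub>A\<^esub> s = Idt A Q"
proof -
  have Q': "Q \<in> Ob A" using A.Proj_ob Q .
  obtain c where c: "elt B c (fob e Q)" "is_epi B c" using B.cover[of "fob e Q"] Q' by auto
  note c' = B.elt_arr[OF c(1)]
  let ?r = "lam Q \<cdot>\<^bsub>A\<^esub> far l c"
  have r: "?r \<in> Arr A" "Dom A ?r = fob l (Dom B c)" "Cod A ?r = Q" using c' Q' by simp_all
  have "is_epi A ?r" by (rule A.epi_cmp[OF L_epi[OF c(2)] lam_epi[OF Q']]) (use c' Q' in simp)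
  then obtain s where "s \<in> Arr A" "Dom A s = Q" "Cod A s = Dom A ?r" "?r \<cdot>\<^bsub>A\<^esub> s = Idt A Q"
    by (rule A.Proj_lift[OF Q, of ?r "Idt A Q"]) (use r Q' in auto)
  then show ?thesis using that[of "Dom B c" ?r s] c' r by simp
qed

lemma extends_Proj:
  assumes "\<And>P. P \<in> Proj B \<Longrightarrow> extends A x (fob l P)" "Q \<in> Proj A" "x \<in> Arr A"
  shows "extends A x Q"
  unfolding extends_def
proof
  obtain P r s where P: "P \<in> Proj B" and rs: "r \<in> Arr A" "Dom A r = fob l P" "Cod A r = Q"
    "s \<in> Arr A" "Dom A s = Q" "Cod A s = fob l P" "r \<cdot>\<^bsub>A\<^esub> s = Idt A Q"
    using Proj_retract_free[OF assms(2)] .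
  fix \<phi> assume "\<phi> \<in> Hom A (Dom A x) Q"
  then have \<phi>: "\<phi> \<in> Arr A" "Dom A \<phi> = Dom A x" "Cod A \<phi> = Q" by (auto simp: Hom_def)
  obtain \<psi> where \<psi>: "\<psi> \<in> Arr A" "Dom A \<psi> = Cod A x" "Cod A \<psi> = fob l P" "\<psi> \<cdot>\<^bsub>A\<^esub> x = s \<cdot>\<^bsub>A\<^esub> \<phi>"
    by (rule extendsD[OF assms(1)[OF P], of "s \<cdot>\<^bsub>A\<^esub> \<phi>"]) (use \<phi> rs in auto)
  have "(r \<cdot>\<^bsub>A\<^esub> \<psi>) \<cdot>\<^bsub>A\<^esub> x = \<phi>" using \<psi> \<phi> rs A.reassoc[OF rs(7), of \<phi>] assms(3) by simp
  then show "\<exists>\<psi> \<in> Hom A (Cod A x) Q. \<psi> \<cdot>\<^bsub>A\<^esub> x = \<phi>"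
    using \<psi>(1-3) rs by (intro bexI[of _ "r \<cdot>\<^bsub>A\<^esub> \<psi>"]) (simp_all add: Hom_def)
qed

theorem Gorenstein_of_structure:
  assumes C1: "compatible_C1 B F" and "extension_structure X Y j p" "Gorenstein_projective B Y"
  shows "Gorenstein_projective A X"
proof -
  define W where "W X \<longleftrightarrow> (\<exists>Y j p. extension_structure X Y j p \<and> Gorenstein_projective B Y)" for X
  have ext: "extends A x Q"
    if "extension_structure X Y j p" "x \<in> Arr A" "Dom A x = X" "Cod A x = fob l (Dom B p0)"
      "admissible m p0" "Dom B m = Y" "\<pi> (Dom B p0) \<cdot> far e x = m \<cdot> p" "Q \<in> Proj A"
    for X Y j p x m p0 Q
  proof (rule extends_Proj[OF _ that(8,2)])
    fix P assume P: "P \<in> Proj B"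
    note a' = admissibleD[OF that(5)]
    have "extends B m P" "extends B m (fob F P)" using that(5) P by (simp_all add: admissible_def)
    then show "extends A x (fob l P)"
      by (rule extends_free[OF that(1-4) a'(5) that(6) a'(6) that(7) _ _ B.Proj_ob[OF P]])
  qed
  have "W X" using assms unfolding W_def by blast
  then show ?thesis
  proof (rule A.Gorenstein_splice)
    fix X assume "W X"
    then obtain Y j p where s: "extension_structure X Y j p" "Gorenstein_projective B Y"
      unfolding W_def by blast
    obtain m p0 where a: "admissible m p0" "Cod B p0 = Y" "Gorenstein_projective B (Dom B m)"
      using Gorenstein_admissible(1)[OF C1 s(2)] by blast
    obtain m1 p1 where b: "admissible m1 p1" "Dom B m1 = Y" "Gorenstein_projective B (Cod B p1)"
      using Gorenstein_admissible(2)[OF C1 s(2)] by blast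
    obtain x f j' p' where x: "short_exact A x f" "Cod A f = X" "Dom A f = fob l (Dom B p0)"
      "extension_structure (Dom A x) (Dom B m) j' p'" "\<pi> (Dom B p0) \<cdot> far e x = m \<cdot> p'"
      using syzygy_structure[OF s(1) a(1,2)] by blast
    note x' = A.short_exact_arr[OF x(1)]
    have "Cod A x = fob l (Dom B p0)" using x' x(3) by simp
    then have "\<forall>Q \<in> Proj A. extends A x Q"
      using ext[OF x(4) x'(1) refl _ a(1) refl x(5)] by blast
    moreover have "Dom A f \<in> Proj A" using l_Proj[OF admissibleD(2)[OF a(1)]] x(3) by simp
    moreover have "W (Dom A x)" unfolding W_def using x(4) a(3) by blast
    ultimately show "\<exists>x f. short_exact A x f \<and> Cod A f = X \<and> Dom A f \<in> Proj A \<and>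
        W (Dom A x) \<and> (\<forall>Q \<in> Proj A. extends A x Q)"
      using x(1,2) by blast
    obtain x f j' p' where y: "short_exact A x f" "Dom A x = X" "Dom A f = fob l (Dom B p1)"
      "extension_structure (Cod A f) (Cod B p1) j' p'" "\<pi> (Dom B p1) \<cdot> far e x = m1 \<cdot> p"
      using cosyzygy_structure[OF s(1) b(1,2) a(1,2)] by blast
    note y' = A.short_exact_arr[OF y(1)]
    have "Cod A x = fob l (Dom B p1)" using y' y(3) by simp
    then have "\<forall>Q \<in> Proj A. extends A x Q"
      using ext[OF s(1) y'(1) y(2) _ b(1,2) y(5)] by blast
    moreover have "Dom A f \<in> Proj A" using l_Proj[OF admissibleD(2)[OF b(1)]] y(3) by simp
    moreover have "W (Cod A f)" unfolding W_def using y(4) b(3) by blast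
    ultimately show "\<exists>x f. short_exact A x f \<and> Dom A x = X \<and> Dom A f \<in> Proj A \<and>
        W (Cod A f) \<and> (\<forall>Q \<in> Proj A. extends A x Q)"
      using y(1,2) by blast
  qed
qed

end

section \<open>The augmented monad of a cleft extension\<close>

locale cleft = faithful_adj B A e l \<sigma> lam
  for B :: "('ob, 'mb) catg" (structure) and A :: "('oa, 'ma) catg"
    and e :: "('oa, 'ma, 'ob, 'mb) ftor" and l :: "('ob, 'mb, 'oa, 'ma) ftor"
    and \<sigma> :: "'ob \<Rightarrow> 'mb" and lam :: "'oa \<Rightarrow> 'ma" +
  fixes i :: "('ob, 'mb, 'oa, 'ma) ftor" and \<rho> :: "'ob \<Rightarrow> 'mb"
    and G :: "('oa, 'ma, 'oa, 'ma) ftor" and u :: "'oa \<Rightarrow> 'ma" and \<nu>' :: "'ob \<Rightarrow> 'mb"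
    and q :: "('oa, 'ma, 'ob, 'mb) ftor" and \<theta> :: "'oa \<Rightarrow> 'ma" and \<tau> :: "'ob \<Rightarrow> 'mb"
  assumes functor_i: "is_functor B A i"
    and \<rho>_iso: "nat_iso B B (e \<circ>\<^sub>F i) id_ftor \<rho>"
    and G: "kernel_of_counit A e l lam G u"
    and retraction: "natural_retraction B (cleft_F e i G) (e \<circ>\<^sub>F l) (cleft_nu B e i l \<rho> u) \<nu>'"
    and q_i: "adjunction A B q i \<theta> \<tau>"

sublocale cleft \<subseteq> i: ftr B A i
  by unfold_locales (rule functor_i)

sublocale cleft \<subseteq> G: ftr A A G
  by unfold_locales (use G in \<open>simp add: kernel_of_counit_def nat_trans_def\<close>)

context cleft
begin

lemmas \<rho>_nt = nat_iso_nat_trans[OF \<rho>_iso]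
lemmas \<rho>_arr [simp] = nat_trans_arr[OF \<rho>_nt, simplified]
lemmas \<rho>_nat = nat_trans_nat[OF \<rho>_nt, simplified]

lemma u_nt: "nat_trans A A G (l \<circ>\<^sub>F e) u"
  and u_kernel: "X \<in> Ob A \<Longrightarrow> is_kernel A (u X) (lam X)"
  using G by (simp_all add: kernel_of_counit_def)

lemmas u_arr [simp] = nat_trans_arr[OF u_nt, simplified]
lemmas u_nat = nat_trans_nat[OF u_nt, simplified]

lemma u_mono: "X \<in> Ob A \<Longrightarrow> is_mono A (u X)"
  using A.kernel_mono[OF u_kernel] .

lemma lam_u: "X \<in> Ob A \<Longrightarrow> lam X \<cdot>\<^bsub>A\<^esub> u X = Zro A (fob G X) X"
  using A.kernel_arr(4)[OF u_kernel] by simp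

lemma u_lam_short_exact: "X \<in> Ob A \<Longrightarrow> short_exact A (u X) (lam X)"
  using A.kernel_epi_short_exact[OF u_kernel lam_epi] .

lemma G_additive: "additive_functor A A G"
  unfolding additive_functor_def
proof (intro conjI allI ballI)
  fix X Y f g assume "f \<in> Hom A X Y" "g \<in> Hom A X Y"
  then have fg: "f \<in> Arr A" "Dom A f = X" "Cod A f = Y" "g \<in> Arr A" "Dom A g = X" "Cod A g = Y"
    "X \<in> Ob A" "Y \<in> Ob A"
    by (auto simp: Hom_def)
  show "far G (Add A f g) = Add A (far G f) (far G g)"
    by (rule A.mono_cancel[OF u_mono[of Y]])
      (use fg u_nat[of f] u_nat[of g] u_nat[of "Add A f g"] in simp_all)
qed (rule G.ftr)

lemma \<rho>_inverse:
  assumes "Y \<in> Ob B"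
  shows "inv_arr B (\<rho> Y) \<in> Arr B" "Dom B (inv_arr B (\<rho> Y)) = Y"
    "Cod B (inv_arr B (\<rho> Y)) = fob e (fob i Y)"
    "inv_arr B (\<rho> Y) \<cdot> \<rho> Y = Idt B (fob e (fob i Y))" "\<rho> Y \<cdot> inv_arr B (\<rho> Y) = Idt B Y"
    "is_mono B (\<rho> Y)" "is_epi B (\<rho> Y)" "is_iso_arr B (\<rho> Y)"
  using B.iso_inverse[OF nat_iso_iso[OF \<rho>_iso assms]] B.iso_mono B.iso_epi
    nat_iso_iso[OF \<rho>_iso assms] assms by simp_all

lemma \<rho>_inverse_nat:
  assumes "f \<in> Arr B"
  shows "inv_arr B (\<rho> (Cod B f)) \<cdot> f = far e (far i f) \<cdot> inv_arr B (\<rho> (Dom B f))"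
proof -
  note c = \<rho>_inverse[of "Cod B f"] and d = \<rho>_inverse[of "Dom B f"]
  show ?thesis
  proof (rule B.mono_cancel[OF c(6)])
    have "\<rho> (Cod B f) \<cdot> (far e (far i f) \<cdot> inv_arr B (\<rho> (Dom B f))) =
        f \<cdot> (\<rho> (Dom B f) \<cdot> inv_arr B (\<rho> (Dom B f)))"
      by (rule B.reassoc2[OF \<rho>_nat]) (use assms d in simp_all)
    also have "\<dots> = f" using d(5) assms by simp
    finally show "\<rho> (Cod B f) \<cdot> (inv_arr B (\<rho> (Cod B f)) \<cdot> f) =
        \<rho> (Cod B f) \<cdot> (far e (far i f) \<cdot> inv_arr B (\<rho> (Dom B f)))"
      using B.reassoc[OF c(5), of f] c(1-3) assms by simp
  qed (use assms c d in simp_all)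
qed

lemma e_reflects_zero_ob:
  assumes "zero_object B (fob e X)" "X \<in> Ob A" shows "zero_object A X"
proof (rule A.idt_zro_zero_ob[OF assms(2)])
  have "far e (Idt A X) = Zro B (fob e X) (fob e X)"
    by (rule B.zero_ob_zro[OF assms(1)]) (use assms(2) in simp_all)
  then show "Idt A X = Zro A X X" using assms(2) by (intro e_reflects_zero) simp_all
qed

lemma i_additive: "additive_functor B A i"
  unfolding additive_functor_def
proof (intro conjI allI ballI)
  fix X Y f g assume "f \<in> Hom B X Y" "g \<in> Hom B X Y"
  then have fg: "f \<in> Arr B" "Dom B f = X" "Cod B f = Y" "g \<in> Arr B" "Dom B g = X" "Cod B g = Y"
    "X \<in> Ob B" "Y \<in> Ob B"
    by (auto simp: Hom_def)
  have "far e (far i (Add B f g)) = far e (Add A (far i f) (far i g))"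
    by (rule B.mono_cancel[OF \<rho>_inverse(6)[of Y]])
      (use fg \<rho>_nat[of f] \<rho>_nat[of g] \<rho>_nat[of "Add B f g"] in simp_all)
  then show "far i (Add B f g) = Add A (far i f) (far i g)"
    by (rule e_inj) (use fg in simp_all)
qed (rule i.ftr)

lemma i_epi: assumes "is_epi B f" shows "is_epi A (far i f)"
proof (rule e_reflects_epi)
  have f: "f \<in> Arr B" using B.epi_arr[OF assms] .
  note d = \<rho>_inverse[of "Dom B f"] and c = \<rho>_inverse[of "Cod B f"]
  have "far e (far i f) = inv_arr B (\<rho> (Cod B f)) \<cdot> (f \<cdot> \<rho> (Dom B f))"
    using \<rho>_nat[OF f] B.reassoc[OF c(4), of "far e (far i f)"] f c(1-3) by simp
  moreover have "is_epi B (f \<cdot> \<rho> (Dom B f))"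
    by (rule B.epi_cmp[OF d(7) assms]) (use f in simp_all)
  moreover have "is_epi B (inv_arr B (\<rho> (Cod B f)))"
    using B.iso_epi[OF B.iso_inv_iso[OF c(8)]] f by simp
  ultimately show "is_epi B (far e (far i f))"
    using B.epi_cmp[of "f \<cdot> \<rho> (Dom B f)" "inv_arr B (\<rho> (Cod B f))"] f c(1-3) by simp
qed (use B.epi_arr[OF assms] in simp)

abbreviation F where "F \<equiv> cleft_F e i G"
abbreviation \<nu> where "\<nu> \<equiv> cleft_nu B e i l \<rho> u"

text \<open>The augmentation \<open>e l \<rightarrow> Id\<close>: the counit at \<open>i Y\<close>, with \<open>e i Y\<close> identified with \<open>Y\<close>.\<close>

definition aug :: "'ob \<Rightarrow> 'mb" where
  "aug Y = \<rho> Y \<cdot> (far e (lam (fob i Y)) \<cdot> far e (far l (inv_arr B (\<rho> Y))))"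

lemma \<nu>_eq: "\<nu> Y = far e (far l (\<rho> Y)) \<cdot> far e (u (fob i Y))"
  by (simp add: cleft_nu_def)

lemma aug_arr [simp]:
  assumes "Y \<in> Ob B"
  shows "aug Y \<in> Arr B" "Dom B (aug Y) = fob e (fob l Y)" "Cod B (aug Y) = Y"
  using assms \<rho>_inverse(1-3)[OF assms] by (simp_all add: aug_def)

lemma el_\<rho>_inverse:
  assumes "Y \<in> Ob B"
  shows "far e (far l (inv_arr B (\<rho> Y))) \<cdot> far e (far l (\<rho> Y)) = Idt B (fob e (fob l (fob e (fob i Y))))"
    and "far e (far l (\<rho> Y)) \<cdot> far e (far l (inv_arr B (\<rho> Y))) = Idt B (fob e (fob l Y))"
  using arg_cong[OF \<rho>_inverse(4)[OF assms], of "\<lambda>f. far e (far l f)"]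
    arg_cong[OF \<rho>_inverse(5)[OF assms], of "\<lambda>f. far e (far l f)"] \<rho>_inverse(1-3)[OF assms] assms
  by simp_all

lemma aug_\<rho>:
  assumes "Y \<in> Ob B"
  shows "aug Y \<cdot> far e (far l (\<rho> Y)) = \<rho> Y \<cdot> far e (lam (fob i Y))"
  using el_\<rho>_inverse(1)[OF assms] \<rho>_inverse(1-3)[OF assms] assms by (simp add: aug_def)

lemma aug_nt: "nat_trans B B (e \<circ>\<^sub>F l) id_ftor aug"
  unfolding nat_trans_def
proof (intro conjI allI ballI)
  show "is_functor B B (e \<circ>\<^sub>F l)" using is_functor_comp[OF L.ftr e.ftr] .
  show "is_functor B B id_ftor" by (rule is_functor_id)
  show "aug X \<in> Hom B (fob (e \<circ>\<^sub>F l) X) (fob id_ftor X)" if "X \<in> Ob B" for X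
    using that by (simp add: Hom_def)
  fix X Y f assume "f \<in> Hom B X Y"
  then have f: "f \<in> Arr B" "Dom B f = X" "Cod B f = Y" "X \<in> Ob B" "Y \<in> Ob B" by (auto simp: Hom_def)
  note x = \<rho>_inverse[OF f(4)] and y = \<rho>_inverse[OF f(5)]
  let ?X = "inv_arr B (\<rho> X)" and ?Y = "inv_arr B (\<rho> Y)"
  have "aug Y \<cdot> far e (far l f) = \<rho> Y \<cdot> (far e (lam (fob i Y)) \<cdot> far e (far l (?Y \<cdot> f)))"
    using f y(1-3) by (simp add: aug_def)
  also have "?Y \<cdot> f = far e (far i f) \<cdot> ?X" using \<rho>_inverse_nat[OF f(1)] f by simp
  also have "far e (lam (fob i Y)) \<cdot> far e (far l (far e (far i f) \<cdot> ?X)) =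
      far e ((lam (fob i Y) \<cdot>\<^bsub>A\<^esub> far l (far e (far i f))) \<cdot>\<^bsub>A\<^esub> far l ?X)"
    using f x(1-3) by simp
  also have "lam (fob i Y) \<cdot>\<^bsub>A\<^esub> far l (far e (far i f)) = far i f \<cdot>\<^bsub>A\<^esub> lam (fob i X)"
    using counit_nat[of "far i f"] f by simp
  also have "\<rho> Y \<cdot> far e ((far i f \<cdot>\<^bsub>A\<^esub> lam (fob i X)) \<cdot>\<^bsub>A\<^esub> far l ?X) =
      f \<cdot> (\<rho> X \<cdot> (far e (lam (fob i X)) \<cdot> far e (far l ?X)))"
    using B.reassoc2[OF \<rho>_nat[OF f(1)], of "far e (lam (fob i X)) \<cdot> far e (far l ?X)"] f x(1-3) by simp
  also have "\<dots> = far id_ftor f \<cdot> aug X" by (simp add: aug_def)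
  finally show "aug Y \<cdot> far (e \<circ>\<^sub>F l) f = far id_ftor f \<cdot> aug X" by simp
qed

lemma aug_unit:
  assumes "Y \<in> Ob B" shows "aug Y \<cdot> \<sigma> Y = Idt B Y"
proof -
  note r = \<rho>_inverse[OF assms]
  have n: "far e (far l (inv_arr B (\<rho> Y))) \<cdot> \<sigma> Y = \<sigma> (fob e (fob i Y)) \<cdot> inv_arr B (\<rho> Y)"
    using unit_nat[OF r(1)] r(2,3) by simp
  have "far e (lam (fob i Y)) \<cdot> (\<sigma> (fob e (fob i Y)) \<cdot> inv_arr B (\<rho> Y)) = inv_arr B (\<rho> Y)"
    using B.reassoc[OF triangle_R[of "fob i Y"], of "inv_arr B (\<rho> Y)"] r assms by simp
  then show ?thesis using n r assms by (simp add: aug_def)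
qed

lemma \<nu>_kernel_aug:
  assumes Y: "Y \<in> Ob B" shows "is_kernel B (\<nu> Y) (aug Y)"
proof -
  note r = \<rho>_inverse[OF Y] and er = el_\<rho>_inverse[OF Y]
  let ?lr = "far e (far l (\<rho> Y))" and ?li = "far e (far l (inv_arr B (\<rho> Y)))"
  have iY: "fob i Y \<in> Ob A" using Y by simp
  have k: "is_kernel B (far e (u (fob i Y))) (far e (lam (fob i Y)))"
    using B.short_exact_kernel[OF e.far_short_exact[OF u_lam_short_exact[OF iY]]] .
  have k4: "far e (lam (fob i Y)) \<cdot> far e (u (fob i Y)) = Zro B (fob e (fob G (fob i Y))) (fob e (fob i Y))"
    using B.kernel_arr(4)[OF k] iY by simp
  have lm: "is_mono B ?lr" by (rule B.split_mono[of _ ?li]) (use er r Y in simp_all)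
  show ?thesis
  proof (rule B.kernelI)
    show "is_mono B (\<nu> Y)"
      unfolding \<nu>_eq by (rule B.mono_cmp[OF B.kernel_mono[OF k] lm]) (use Y in simp)
    have "aug Y \<cdot> \<nu> Y = \<rho> Y \<cdot> (far e (lam (fob i Y)) \<cdot> far e (u (fob i Y)))"
      unfolding \<nu>_eq using B.reassoc2[OF aug_\<rho>[OF Y], of "far e (u (fob i Y))"] Y by simp
    then show "aug Y \<cdot> \<nu> Y = Zro B (Dom B (\<nu> Y)) (Cod B (aug Y))"
      unfolding k4 using Y by (simp add: \<nu>_eq)
    fix g assume "g \<in> Arr B" "Cod B g = Dom B (aug Y)" "aug Y \<cdot> g = Zro B (Dom B g) (Cod B (aug Y))"
    then have g: "g \<in> Arr B" "Cod B g = fob e (fob l Y)" "aug Y \<cdot> g = Zro B (Dom B g) Y"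
      using Y by simp_all
    have "\<rho> Y \<cdot> (far e (lam (fob i Y)) \<cdot> (?li \<cdot> g)) = Zro B (Dom B g) Y"
      using g r(1-3) Y by (simp add: aug_def)
    then have "far e (lam (fob i Y)) \<cdot> (?li \<cdot> g) = Zro B (Dom B g) (fob e (fob i Y))"
      by - (rule B.mono_zero[OF r(6)]; use g r(1-3) Y in simp)
    then obtain h where h: "h \<in> Arr B" "Dom B h = Dom B g" "Cod B h = fob e (fob G (fob i Y))"
      "far e (u (fob i Y)) \<cdot> h = ?li \<cdot> g"
      by - (rule B.kernel_lift[OF k, of "?li \<cdot> g" "Dom B g"]; use g r(1-3) Y in simp)
    have "\<nu> Y \<cdot> h = g"
      using h g r(1-3) Y B.reassoc[OF er(2), of g] by (simp add: \<nu>_eq)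
    then show "\<exists>h. h \<in> Arr B \<and> Dom B h = Dom B g \<and> Cod B h = Dom B (\<nu> Y) \<and> \<nu> Y \<cdot> h = g"
      using h Y by (intro exI[of _ h]) (simp add: \<nu>_eq)
  qed (use Y in \<open>simp_all add: \<nu>_eq\<close>)
qed

lemma \<nu>_nat_trans: "nat_trans B B F (e \<circ>\<^sub>F l) \<nu>"
  unfolding nat_trans_def
proof (intro conjI allI ballI)
  show "is_functor B B (e \<circ>\<^sub>F l)" using is_functor_comp[OF L.ftr e.ftr] .
  show "is_functor B B F" using is_functor_comp[OF i.ftr is_functor_comp[OF G.ftr e.ftr]] .
  show "\<nu> X \<in> Hom B (fob F X) (fob (e \<circ>\<^sub>F l) X)" if "X \<in> Ob B" for X
    using that by (simp add: Hom_def \<nu>_eq)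
  fix X Y f assume "f \<in> Hom B X Y"
  then have f: "f \<in> Arr B" "Dom B f = X" "Cod B f = Y" "X \<in> Ob B" "Y \<in> Ob B" by (auto simp: Hom_def)
  have u: "far e (u (fob i Y)) \<cdot> far e (far G (far i f)) =
      far e (far l (far e (far i f))) \<cdot> far e (u (fob i X))"
    using arg_cong[OF u_nat[of "far i f"], of "far e"] f by simp
  have r: "far e (far l (\<rho> Y)) \<cdot> far e (far l (far e (far i f))) =
      far e (far l f) \<cdot> far e (far l (\<rho> X))"
    using arg_cong[OF \<rho>_nat[OF f(1)], of "\<lambda>f. far e (far l f)"] f by simp
  show "\<nu> Y \<cdot> far F f = far (e \<circ>\<^sub>F l) f \<cdot> \<nu> X"
    using u B.reassoc2[OF r, of "far e (u (fob i X))"] f by (simp add: \<nu>_eq)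
qed

end

sublocale cleft \<subseteq> augmented B A e l \<sigma> lam "cleft_F e i G" "cleft_nu B e i l \<rho> u" \<nu>' aug
  by unfold_locales
    (use \<nu>_nat_trans retraction aug_nt aug_unit \<nu>_kernel_aug in
      \<open>auto simp: natural_retraction_def simp del: comp_ftor_simps\<close>)

sublocale cleft \<subseteq> q: adj_ep A B q i \<theta> \<tau>
  by unfold_locales (rule q_i, rule i_additive)

sublocale cleft \<subseteq> G: additive_ftr A A G
  by unfold_locales (rule G_additive)

context cleft
begin

lemma act_i: "Z \<in> Ob B \<Longrightarrow> act (fob i Z) = Zro B (fob F (fob e (fob i Z))) (fob e (fob i Z))"
proof (rule B.mono_zero[OF \<rho>_inverse(6)[of Z]])
  assume Z: "Z \<in> Ob B"
  let ?Y = "fob e (fob i Z)"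
  have Y: "?Y \<in> Ob B" using Z by simp
  have n: "far e (far l (\<rho> Z)) \<cdot> \<nu> ?Y = \<nu> Z \<cdot> far F (\<rho> Z)"
    using \<nu>_nat[of "\<rho> Z"] Z by simp
  have "\<rho> Z \<cdot> act (fob i Z) = aug Z \<cdot> (far e (far l (\<rho> Z)) \<cdot> \<nu> ?Y)"
    using B.reassoc2[OF aug_\<rho>[OF Z], of "\<nu> ?Y"] \<nu>_arr[OF Y] Z
    by (simp add: act_def del: comp_ftor_simps)
  also have "\<dots> = Zro B (fob F ?Y) Z"
    unfolding n using B.reassoc[OF \<pi>_\<nu>[OF Z], of "far F (\<rho> Z)"] \<nu>_arr[OF Z] Z
    by (simp del: comp_ftor_simps)
  finally show "\<rho> Z \<cdot> act (fob i Z) = Zro B (fob F ?Y) Z" .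
qed simp_all

end

section \<open>The functor q as cokernel of the action\<close>

context cleft
begin

text \<open>The unit of \<open>(q, i)\<close> seen in \<open>B\<close>.\<close>

definition quot :: "'oa \<Rightarrow> 'mb" where
  "quot X = \<rho> (fob q X) \<cdot> far e (\<theta> X)"

lemma quot_arr [simp]:
  assumes "X \<in> Ob A"
  shows "quot X \<in> Arr B" "Dom B (quot X) = fob e X" "Cod B (quot X) = fob q X"
  using assms by (simp_all add: quot_def)

lemma quot_nat:
  assumes "f \<in> Arr A"
  shows "quot (Cod A f) \<cdot> far e f = far q f \<cdot> quot (Dom A f)"
proof -
  have t: "far e (\<theta> (Cod A f)) \<cdot> far e f = far e (far i (far q f)) \<cdot> far e (\<theta> (Dom A f))"
    using arg_cong[OF q.unit_nat[OF assms], of "far e"] assms by simp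
  have r: "\<rho> (fob q (Cod A f)) \<cdot> far e (far i (far q f)) = far q f \<cdot> \<rho> (fob q (Dom A f))"
    using \<rho>_nat[of "far q f"] assms by simp
  show ?thesis
    using t B.reassoc2[OF r, of "far e (\<theta> (Dom A f))"] assms by (simp add: quot_def)
qed

text \<open>A morphism \<open>e X \<rightarrow> Z\<close> killing the action is a morphism \<open>X \<rightarrow> i Z\<close>, hence \<open>q X \<rightarrow> Z\<close>.\<close>

lemma quot_cokernel:
  assumes X: "X \<in> Ob A" shows "is_cokernel B (quot X) (act X)"
proof (rule B.cokernelI)
  have aX: "act X \<in> Arr B" "Dom B (act X) = fob F (fob e X)" "Cod B (act X) = fob e X"
    using act_arr[OF X] by simp_all
  have qX: "fob q X \<in> Ob B" using X by simp
  have "far e (\<theta> X) \<cdot> act X = act (fob i (fob q X)) \<cdot> far F (far e (\<theta> X))"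
    using act_nat[of "\<theta> X"] X by simp
  also have "\<dots> = Zro B (fob F (fob e X)) (fob e (fob i (fob q X)))"
    unfolding act_i[OF qX] using X by simp
  finally show "quot X \<cdot> act X = Zro B (Dom B (act X)) (Cod B (quot X))"
    using X aX by (simp add: quot_def)
  show "is_epi B (quot X)"
  proof (rule B.epiI)
    fix k W assume "k \<in> Arr B" "Dom B k = Cod B (quot X)" "Cod B k = W" "k \<cdot> quot X = Zro B (Dom B (quot X)) W"
    then have k: "k \<in> Arr B" "Dom B k = fob q X" "Cod B k = W" "k \<cdot> quot X = Zro B (fob e X) W"
      using X by simp_all
    have W: "W \<in> Ob B" using k(1,3) by auto
    have "\<rho> W \<cdot> far e (far i k \<cdot>\<^bsub>A\<^esub> \<theta> X) = k \<cdot> quot X"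
      using B.reassoc2[OF \<rho>_nat[OF k(1)], of "far e (\<theta> X)"] k(1-3) X W by (simp add: quot_def)
    then have "\<rho> W \<cdot> far e (far i k \<cdot>\<^bsub>A\<^esub> \<theta> X) = Zro B (fob e X) W" unfolding k(4) .
    from B.mono_zero[OF \<rho>_inverse(6)[OF W] this]
    have "far e (far i k \<cdot>\<^bsub>A\<^esub> \<theta> X) = Zro B (fob e X) (fob e (fob i W))"
      using k(1-3) X W by simp
    then have "far i k \<cdot>\<^bsub>A\<^esub> \<theta> X = Zro A X (fob i W)"
      by (rule e_reflects_zero) (use k(1-3) X in simp_all)
    then have "k = Zro B (fob q X) W"
      by - (rule q.adj_unique[of _ X]; use k(1-3) X W in simp)
    then show "k = Zro B (Cod B (quot X)) W" using X by simp
  qed (use X in simp)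
  fix c assume "c \<in> Arr B" "Dom B c = Cod B (act X)" "c \<cdot> act X = Zro B (Dom B (act X)) (Cod B c)"
  then have c: "c \<in> Arr B" "Dom B c = fob e X" "c \<cdot> act X = Zro B (fob F (fob e X)) (Cod B c)"
    using X by simp_all
  let ?Z = "Cod B c"
  note r = \<rho>_inverse[of ?Z]
  let ?g = "inv_arr B (\<rho> ?Z) \<cdot> c"
  have g: "?g \<in> Arr B" "Dom B ?g = fob e X" "Cod B ?g = fob e (fob i ?Z)" using r(1-3) c by simp_all
  have iZ: "fob i ?Z \<in> Ob A" using c by simp
  have "act (fob i ?Z) \<cdot> far F ?g = Zro B (fob F (fob e X)) (fob e (fob i ?Z))"
    using B.cmp_zro_left[of "fob e (fob i ?Z)" "far F ?g"] g c(1) iZ F.far_arr[OF g(1)] act_i[of ?Z]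
    by (simp del: comp_ftor_simps F.far_cmp)
  also have "\<dots> = ?g \<cdot> act X"
    using c r(1-3) X aX by simp
  finally obtain h where h: "h \<in> Arr A" "Dom A h = X" "Cod A h = fob i ?Z" "far e h = ?g"
    using act_fullness[OF g X iZ] by blast
  let ?h = "\<tau> ?Z \<cdot> far q h"
  have h': "?h \<in> Arr B" "Dom B ?h = fob q X" "Cod B ?h = ?Z" using h c by simp_all
  have t: "far i ?h \<cdot>\<^bsub>A\<^esub> \<theta> X = h" using q.transpose[of h ?Z] h c by simp
  have "?h \<cdot> quot X = \<rho> ?Z \<cdot> (far e (far i ?h) \<cdot> far e (\<theta> X))"
    unfolding quot_def
    by (rule B.reassoc2) (use \<rho>_nat[OF h'(1)] h' c X in simp_all)
  also have "far e (far i ?h) \<cdot> far e (\<theta> X) = far e (far i ?h \<cdot>\<^bsub>A\<^esub> \<theta> X)"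
    using h' X by (intro e.far_cmp[symmetric]) simp_all
  also have "\<rho> ?Z \<cdot> \<dots> = c"
    unfolding t h(4) using B.reassoc[OF r(5), of c] r(1-3) c by simp
  finally show "\<exists>h. h \<in> Arr B \<and> Dom B h = Cod B (quot X) \<and> Cod B h = Cod B c \<and> h \<cdot> quot X = c"
    using h' X by (intro exI[of _ ?h]) simp
qed (use assms act_arr[OF assms] in simp_all)

section \<open>From condition (2) to the extension structure\<close>

text \<open>The augmentation respects multiplication, so the composite defining \<open>\<eta>\<close> before the last map lies in
  its kernel, where any retraction of \<open>\<nu>\<close> is injective.  So \<open>\<eta> = 0\<close> does not depend on the choice of the
  retraction.\<close>

lemma eta_zero_square_zero:
  assumes Y: "Y \<in> Ob B"
    and eta: "cleft_eta B e i l lam \<rho> G u \<nu>' Y = Zro B (fob (pow_ftor F 2) Y) (fob F Y)"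
  shows "far e (lam (fob l Y)) \<cdot> (far e (far l (\<nu> Y)) \<cdot> \<nu> (fob F Y)) =
    Zro B (fob F (fob F Y)) (fob e (fob l Y))"
proof -
  note r = \<rho>_inverse[OF Y]
  let ?\<mu> = "far e (lam (fob l Y)) \<cdot> (far e (far l (\<nu> Y)) \<cdot> \<nu> (fob F Y))"
  have FY: "fob F Y \<in> Ob B" "fob F (fob F Y) \<in> Ob B" using Y by simp_all
  note n = \<nu>_arr[OF Y] \<nu>_arr[OF FY(1)]
  have \<mu>: "?\<mu> \<in> Arr B" "Dom B ?\<mu> = fob F (fob F Y)" "Cod B ?\<mu> = fob e (fob l Y)"
    using n Y by simp_all
  let ?p = "lam (fob i Y) \<cdot>\<^bsub>A\<^esub> far l (inv_arr B (\<rho> Y))"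
  have p: "?p \<in> Arr A" "Dom A ?p = fob l Y" "Cod A ?p = fob i Y" using r(1-3) Y by simp_all
  have ap: "aug Y = \<rho> Y \<cdot> far e ?p" using r(1-3) Y by (simp add: aug_def)
  have "\<rho> Y \<cdot> (far e ?p \<cdot> \<nu> Y) = Zro B (fob F Y) Y"
    using \<pi>_\<nu>[OF Y] p n Y unfolding ap by simp
  from B.mono_zero[OF r(6) this] have pn: "far e ?p \<cdot> \<nu> Y = Zro B (fob F Y) (fob e (fob i Y))"
    using p n Y by simp
  have "aug Y \<cdot> ?\<mu> = \<rho> Y \<cdot> (far e (?p \<cdot>\<^bsub>A\<^esub> lam (fob l Y)) \<cdot> (far e (far l (\<nu> Y)) \<cdot> \<nu> (fob F Y)))"
    unfolding ap using p r(1-3) n Y by simp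
  also have "?p \<cdot>\<^bsub>A\<^esub> lam (fob l Y) = lam (fob i Y) \<cdot>\<^bsub>A\<^esub> far l (far e ?p)"
    using counit_nat[OF p(1)] p(2,3) by simp
  also have "far e (lam (fob i Y) \<cdot>\<^bsub>A\<^esub> far l (far e ?p)) \<cdot> (far e (far l (\<nu> Y)) \<cdot> \<nu> (fob F Y)) =
      far e (lam (fob i Y)) \<cdot> (far e (far l (far e ?p \<cdot> \<nu> Y)) \<cdot> \<nu> (fob F Y))"
    using p r(1-3) n Y by simp
  also have "\<rho> Y \<cdot> \<dots> = Zro B (fob F (fob F Y)) Y"
    unfolding pn using n Y by simp
  finally have z: "aug Y \<cdot> ?\<mu> = Zro B (fob F (fob F Y)) Y" .
  obtain w where w: "w \<in> Arr B" "Dom B w = fob F (fob F Y)" "Cod B w = fob F Y" "\<nu> Y \<cdot> w = ?\<mu>"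
    by (rule B.kernel_lift[OF \<nu>_kernel_aug[OF Y] \<mu>(1,2)]) (use \<mu>(3) z n Y in auto)
  have v: "\<nu>' Y \<cdot> \<nu> Y = Idt B (fob F Y)" using \<nu>'_\<nu>[OF Y] .
  have "w = \<nu>' Y \<cdot> (\<nu> Y \<cdot> w)"
    using B.reassoc[OF v, of w] w(1-3) n \<nu>'_arr[OF Y] by simp
  also have "\<dots> = Zro B (fob F (fob F Y)) (fob F Y)"
    unfolding w(4) using eta by (simp add: cleft_eta_def numeral_2_eq_2)
  finally show ?thesis unfolding w(4)[symmetric] using n Y FY by simp
qed

end

locale square_zero_cleft =
  cleft B A e l \<sigma> lam i \<rho> G u \<nu>' q \<theta> \<tau> +
  square_zero B A e l \<sigma> lam "cleft_F e i G" "cleft_nu B e i l \<rho> u" \<nu>' "cleft.aug B e l lam i \<rho>"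
  for B :: "('ob, 'mb) catg" (structure) and A :: "('oa, 'ma) catg" and e l \<sigma> lam i \<rho> G u \<nu>' q \<theta> \<tau>
begin

lemma act_F_unit:
  assumes "Y \<in> Ob B"
  shows "act (fob l Y) \<cdot> far F (\<sigma> Y) = \<nu> Y"
proof -
  have "far F (aug Y) \<cdot> far F (\<sigma> Y) = Idt B (fob F Y)"
    using F.far_cmp[of "\<sigma> Y" "aug Y"] aug_unit[OF assms] assms by simp
  from this show ?thesis
    unfolding act_free[OF assms] using assms \<nu>_arr[OF assms] by simp
qed

lemma act_act:
  assumes X: "X \<in> Ob A"
  shows "act X \<cdot> far F (act X) = Zro B (fob F (fob F (fob e X))) (fob e X)"
proof -
  let ?Y = "fob e X"
  have Y: "?Y \<in> Ob B" using X by simp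
  note n = \<nu>_arr[OF Y]
  have FF: "far F (aug ?Y) \<cdot> far F (\<nu> ?Y) = Zro B (fob F (fob F ?Y)) (fob F ?Y)"
    using F.far_cmp[of "\<nu> ?Y" "aug ?Y"] \<pi>_\<nu>[OF Y] n Y by simp
  have "act X \<cdot> far F (act X) = act X \<cdot> (far F (far e (lam X)) \<cdot> far F (\<nu> ?Y))"
    using F.far_cmp[of "\<nu> ?Y" "far e (lam X)"] n X by (simp add: act_def)
  also have "\<dots> = far e (lam X) \<cdot> (act (fob l ?Y) \<cdot> far F (\<nu> ?Y))"
    by (rule B.reassoc2) (use act_nat[of "lam X"] n X act_arr[OF X] act_arr[of "fob l ?Y"] in simp_all)
  also have "\<dots> = Zro B (fob F (fob F ?Y)) ?Y"
    unfolding act_free[OF Y] using FF n X Y by simp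
  finally show ?thesis .
qed

text \<open>An element \<open>v\<close> of \<open>F e X\<close> killed by the action lies in \<open>G X\<close>, and it vanishes in \<open>q(l e X) = e X\<close>.
  As \<open>q(u)\<close> is mono it already vanishes in \<open>q(G X)\<close>, so it comes from the action of \<open>F\<close> on \<open>G X\<close>.  On
  \<open>e G X\<close> the augmentation equals the negative of the action composed with the component in \<open>F e X\<close>,
  which turns this into membership in the image of \<open>F(a)\<close>.\<close>

lemma exact_act:
  assumes X: "X \<in> Ob A" and m: "is_mono B (far q (u X))"
  shows "exact_at B (far F (act X)) (act X)"
proof (rule B.exact_elt)
  let ?Y = "fob e X" and ?GX = "fob G X"
  have Y: "?Y \<in> Ob B" and GX: "?GX \<in> Ob A" and lY: "fob l ?Y \<in> Ob A" using X by simp_all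
  note n = \<nu>_arr[OF Y] and a = act_arr[OF X] act_arr[OF GX] act_arr[OF lY]
  show "far F (act X) \<in> Arr B" "act X \<in> Arr B" "Cod B (far F (act X)) = Dom B (act X)"
    using F.far_arr[of "act X"] a by simp_all
  show "act X \<cdot> far F (act X) = Zro B (Dom B (far F (act X))) (Cod B (act X))"
    using act_act[OF X] a by simp
  fix v assume "elt B v (Dom B (act X))" "act X \<cdot> v = Zro B (Dom B v) (Cod B (act X))"
  then have v: "elt B v (fob F ?Y)" "act X \<cdot> v = Zro B (Dom B v) ?Y" using a by simp_all
  note v' = B.elt_arr[OF v(1)]
  let ?w = "\<nu> ?Y \<cdot> v"
  have w: "elt B ?w (fob e (fob l ?Y))" using v' n by (simp add: elt_def)
  have "far e (lam X) \<cdot> ?w = Zro B (Dom B v) ?Y"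
    using v(2) v' n X by (simp add: act_def)
  moreover have "is_kernel B (far e (u X)) (far e (lam X))"
    using B.short_exact_kernel[OF e.far_short_exact[OF u_lam_short_exact[OF X]]] .
  ultimately obtain w' where w': "w' \<in> Arr B" "Dom B w' = Dom B v" "Cod B w' = fob e ?GX"
    "far e (u X) \<cdot> w' = ?w"
    by - (rule B.kernel_lift[of "far e (u X)" "far e (lam X)" ?w "Dom B v"]; use v' n X in simp)
  have ql: "quot (fob l ?Y) \<cdot> act (fob l ?Y) = Zro B (fob F (fob e (fob l ?Y))) (fob q (fob l ?Y))"
    using B.cokernel_arr(4)[OF quot_cokernel[OF lY]] a lY by simp
  have "?w = act (fob l ?Y) \<cdot> (far F (\<sigma> ?Y) \<cdot> v)"
    using B.reassoc[OF act_F_unit[OF Y], of v] v' F.far_arr[of "\<sigma> ?Y"] a Y by simp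
  then have "quot (fob l ?Y) \<cdot> ?w = Zro B (Dom B v) (fob q (fob l ?Y))"
    using B.reassoc[OF ql, of "far F (\<sigma> ?Y) \<cdot> v"] v' F.far_arr[of "\<sigma> ?Y"] a Y lY by simp
  then have "far q (u X) \<cdot> (quot ?GX \<cdot> w') = Zro B (Dom B v) (fob q (fob l ?Y))"
    using B.reassoc2[OF quot_nat[of "u X"], of w'] w' X GX lY by simp
  then have "quot ?GX \<cdot> w' = Zro B (Dom B w') (Cod B (quot ?GX))"
    by - (rule B.mono_zero[OF m]; use w'(1-3) X GX in simp)
  then obtain v1 where v1: "elt B v1 (fob F (fob e ?GX))" "Dom B v1 = Dom B v" "act ?GX \<cdot> v1 = w'"
    using B.exact_lift[OF B.cokernel_exact(1)[OF quot_cokernel[OF GX]], of w'] w' v' a GX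
    by (auto simp: elt_def)
  note v1' = B.elt_arr[OF v1(1)]
  have eu: "far e (u X) \<in> Arr B" "Dom B (far e (u X)) = fob e ?GX" "Cod B (far e (u X)) = fob e (fob l ?Y)"
    using X by simp_all
  have "far e (u X) \<cdot> (act ?GX \<cdot> v1) = act (fob l ?Y) \<cdot> (far F (far e (u X)) \<cdot> v1)"
    by (rule B.reassoc2) (use act_nat[of "u X"] v1' X a F.far_arr[OF eu(1)] eu in simp_all)
  also have "\<dots> = \<nu> ?Y \<cdot> (far F (aug ?Y \<cdot> far e (u X)) \<cdot> v1)"
    unfolding act_free[OF Y] using v1' n eu Y by simp
  finally have "\<nu> ?Y \<cdot> v = \<nu> ?Y \<cdot> (far F (aug ?Y \<cdot> far e (u X)) \<cdot> v1)"
    unfolding v1(3) w'(4) .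
  then have veq: "v = far F (aug ?Y \<cdot> far e (u X)) \<cdot> v1"
    by - (rule B.mono_cancel[OF \<nu>_mono[OF Y]]; use v' v1' v1(2) n eu Y in simp)
  obtain r where r: "r \<in> Arr B" "Dom B r = fob e (fob l ?Y)" "Cod B r = fob F ?Y"
    and I: "Add B (\<nu> ?Y \<cdot> r) (\<sigma> ?Y \<cdot> aug ?Y) = Idt B (fob e (fob l ?Y))"
    using el_decomposition[OF Y] .
  let ?z = "r \<cdot> far e (u X)"
  have z: "?z \<in> Arr B" "Dom B ?z = fob e ?GX" "Cod B ?z = fob F ?Y" using r eu by simp_all
  have au: "aug ?Y \<cdot> far e (u X) \<in> Arr B" "Dom B (aug ?Y \<cdot> far e (u X)) = fob e ?GX"
    "Cod B (aug ?Y \<cdot> far e (u X)) = ?Y" using eu Y by simp_all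
  have "far e (lam X) \<cdot> (Add B (\<nu> ?Y \<cdot> r) (\<sigma> ?Y \<cdot> aug ?Y) \<cdot> far e (u X)) =
      Add B (act X \<cdot> ?z) (aug ?Y \<cdot> far e (u X))"
    using r eu n X Y B.reassoc[OF triangle_R[OF X], of "aug ?Y \<cdot> far e (u X)"] by (simp add: act_def)
  moreover have "far e (lam X) \<cdot> far e (u X) = Zro B (fob e ?GX) ?Y"
    using arg_cong[OF lam_u[OF X], of "far e"] X by simp
  ultimately have "Add B (act X \<cdot> ?z) (aug ?Y \<cdot> far e (u X)) = Zro B (fob e ?GX) ?Y"
    unfolding I using eu by simp
  then have "act X \<cdot> ?z = Neg B (aug ?Y \<cdot> far e (u X))"
    by - (rule B.add_zero_neg; use z au a in simp)
  then have Fz: "far F (act X) \<cdot> far F ?z = Neg B (far F (aug ?Y \<cdot> far e (u X)))"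
    using F.far_cmp[OF z(1) a(1)] F.far_neg[OF au(1)] z(3) a(2) by simp
  note Ft = F.far_arr[OF z(1)] F.far_arr[OF a(1)] F.far_arr[OF au(1)]
  have "far F (act X) \<cdot> Neg B (far F ?z \<cdot> v1) = Neg B ((far F (act X) \<cdot> far F ?z) \<cdot> v1)"
    using Ft z(2,3) a(2,3) v1' by (simp del: comp_ftor_simps F.far_cmp)
  also have "\<dots> = Neg B (Neg B v)"
    unfolding Fz using veq Ft au(2) v1' by (simp del: comp_ftor_simps F.far_cmp)
  also have "\<dots> = v"
    by (rule B.add_zero_neg[symmetric]) (use v' B.add_neg[OF v'(1)] B.add_comm[of v "Neg B v"] in simp_all)
  finally show "\<exists>x. x \<in> Arr B \<and> Cod B x = Dom B (far F (act X)) \<and> far F (act X) \<cdot> x = v"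
    using Ft z(2,3) a(2,3) v1' by (intro exI[of _ "Neg B (far F ?z \<cdot> v1)"]) (simp del: comp_ftor_simps F.far_cmp)
qed

text \<open>By right exactness \<open>F(q X)\<close> is the cokernel of \<open>F(a)\<close>, hence by \<open>exact_act\<close> the coimage of
  \<open>a\<close>.\<close>

lemma mono_imp_structure:
  assumes X: "X \<in> Ob A" and m: "is_mono B (far q (u X))"
  obtains j where "extension_structure X (fob q X) j (quot X)"
proof -
  let ?Y = "fob e X" and ?Q = "fob q X" and ?p = "quot X"
  have c: "is_cokernel B ?p (act X)" using quot_cokernel[OF X] .
  note a = act_arr[OF X] and c' = B.cokernel_arr[OF c]
  note pe = B.cokernel_exact[OF c]
  have p: "?p \<in> Arr B" "Dom B ?p = ?Y" "Cod B ?p = ?Q" using X by simp_all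
  note Fa = F.far_arr[OF a(1)] and Fp = F.far_arr[OF p(1)]
  have Fc: "is_cokernel B (far F ?p) (far F (act X))"
    using B.exact_epi_cokernel[OF F_right_exact[OF pe] F_epi[OF pe(2)]] .
  note ex = exact_act[OF X m]
  obtain j where j: "j \<in> Arr B" "Dom B j = fob F ?Q" "Cod B j = ?Y" "j \<cdot> far F ?p = act X"
    by (rule B.cokernel_desc[OF Fc, of "act X" ?Y])
      (use a Fa Fp p act_act[OF X] in \<open>auto simp del: comp_ftor_simps\<close>)
  have "extension_structure X ?Q j ?p"
  proof (rule extension_structureI)
    show "is_mono B j"
    proof (rule B.mono_elt[OF j(1)])
      fix z assume "elt B z (Dom B j)" "j \<cdot> z = Zro B (Dom B z) (Cod B j)"
      then have z: "elt B z (Cod B (far F ?p))" "j \<cdot> z = Zro B (Dom B z) ?Y"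
        using j Fp p by (simp_all del: comp_ftor_simps)
      obtain y where y: "elt B y (Dom B (far F ?p))" "Dom B y = Dom B z" "far F ?p \<cdot> y = z"
        using B.epi_lift[OF F_epi[OF pe(2)] z(1)] .
      note y' = B.elt_arr[OF y(1)]
      have "act X \<cdot> y = Zro B (Dom B y) (Cod B (act X))"
        using B.reassoc[OF j(4), of y] y z(2) y' j(1-3) Fp p a by (simp del: comp_ftor_simps)
      moreover have "elt B y (Dom B (act X))" using y(1) Fp p a by (simp del: comp_ftor_simps)
      ultimately obtain x where x: "elt B x (Dom B (far F (act X)))" "Dom B x = Dom B y"
        "far F (act X) \<cdot> x = y"
        using B.exact_lift[OF ex] by metis
      note x' = B.elt_arr[OF x(1)]
      have "far F ?p \<cdot> (far F (act X) \<cdot> x) = Zro B (Dom B z) (fob F ?Q)"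
        using B.reassoc[OF B.cokernel_arr(4)[OF Fc], of x] x' x(2) y(2) Fp Fa p a X
        by (simp del: comp_ftor_simps)
      then show "z = Zro B (Dom B z) (Dom B j)" unfolding x(3) y(3) j(2) .
    qed
    show "is_epi B ?p" using pe(2) .
    have "(?p \<cdot> j) \<cdot> far F ?p = Zro B (fob F ?Y) ?Q"
      using c'(4) j p Fp a by (simp del: comp_ftor_simps)
    then show "?p \<cdot> j = Zro B (fob F ?Q) ?Q"
      by - (rule B.epi_zero[OF F_epi[OF pe(2)]]; use j(1-3) p Fp in \<open>simp del: comp_ftor_simps\<close>)
    fix y assume y: "elt B y ?Y" "?p \<cdot> y = Zro B (Dom B y) ?Q"
    then obtain x where x: "elt B x (Dom B (act X))" "Dom B x = Dom B y" "act X \<cdot> x = y"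
      using B.exact_lift[OF pe(1), of y] p by metis
    note x' = B.elt_arr[OF x(1)]
    have "j \<cdot> (far F ?p \<cdot> x) = y"
      using B.reassoc[OF j(4), of x] x(3) x' j(1-3) Fp p a by (simp del: comp_ftor_simps)
    then show "\<exists>x. x \<in> Arr B \<and> Cod B x = fob F ?Q \<and> j \<cdot> x = y"
      using x' Fp p a by (intro exI[of _ "far F ?p \<cdot> x"]) (simp del: comp_ftor_simps)
  qed (use X j p in \<open>simp_all del: comp_ftor_simps\<close>)
  then show ?thesis using that by blast
qed

end

section \<open>Acyclicity in short exact sequences of complexes\<close>

context abelian_cat
begin

lemma hom_exact_two_of_three:
  assumes ec: "exact_complex C P d" and proj: "\<And>n. P n \<in> Proj C"
    and k: "is_kernel C k f" and f: "is_epi C f"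
    and K: "hom_exact C P d (Dom C k)" and M: "hom_exact C P d (Dom C f)"
  shows "hom_exact C P d (Cod C f)"
proof (rule hom_exactI[OF ec])
  note k' = kernel_arr[OF k] and dn = exact_complexD[OF ec]
  show "Cod C f \<in> Ob C" using k' by simp
  fix g n assume g: "g \<in> Arr C" "Dom C g = P n" "Cod C g = Cod C f" "g \<cdot> d (n - 1) = Zro C (P (n - 1)) (Cod C f)"
  note d0 = dn(1-4)[of "n - 1", simplified] and d1 = dn(1-4)[of n]
  have "n - 1 - 1 + 1 = n - 1" by simp
  note d2 = dn(1-4)[of "n - 1 - 1", unfolded this]
  have dd: "d (n - 1) \<cdot> d (n - 1 - 1) = Zro C (P (n - 1 - 1)) (P n)"
    using exact_at_arr(4)[OF dn(5)[of "n - 1"]] d0 d2 by simp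
  obtain y where y: "y \<in> Arr C" "Dom C y = P n" "Cod C y = Dom C f" "f \<cdot> y = g"
    using Proj_lift[OF proj f g(1-3)] .
  have "f \<cdot> (y \<cdot> d (n - 1)) = Zro C (P (n - 1)) (Cod C f)"
    using reassoc[OF y(4), of "d (n - 1)"] y(1-3) g d0 k' by simp
  then obtain x where x: "x \<in> Arr C" "Dom C x = P (n - 1)" "Cod C x = Dom C k" "k \<cdot> x = y \<cdot> d (n - 1)"
    by - (rule kernel_lift[OF k, of "y \<cdot> d (n - 1)" "P (n - 1)"]; use y(1-3) d0 in simp)
  have "k \<cdot> (x \<cdot> d (n - 1 - 1)) = Zro C (P (n - 1 - 1)) (Cod C k)"
    using reassoc2[OF x(4), of "d (n - 1 - 1)"] x(1-3) y(1-3) d0 d2 dd k' by simp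
  then have "x \<cdot> d (n - 1 - 1) = Zro C (P (n - 1 - 1)) (Dom C k)"
    by - (rule mono_zero[OF kernel_mono[OF k]]; use x(1-3) d2 k' in simp)
  from hom_exactD[OF K x(1-3) this] obtain x1
    where x1: "x1 \<in> Arr C" "Dom C x1 = P n" "Cod C x1 = Dom C k" "x1 \<cdot> d (n - 1) = x"
    by (metis diff_add_cancel)
  let ?y = "Sub C y (k \<cdot> x1)"
  have ky: "?y \<in> Arr C" "Dom C ?y = P n" "Cod C ?y = Dom C f" using y(1-3) x1(1-3) k' by simp_all
  have "?y \<cdot> d (n - 1) = Zro C (P (n - 1)) (Dom C f)"
    using y(1-3) x1 x(4) k' d0 by simp
  from hom_exactD[OF M ky this] obtain y1
    where y1: "y1 \<in> Arr C" "Dom C y1 = P (n + 1)" "Cod C y1 = Dom C f" "y1 \<cdot> d n = ?y" .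
  have "(f \<cdot> y1) \<cdot> d n = f \<cdot> ?y" using y1 d1 k' by simp
  also have "\<dots> = g" using y x1(1-3) k' g(1-3) d1 reassoc[OF k'(4), of x1] by simp
  finally show "\<exists>h. h \<in> Arr C \<and> Dom C h = P (n + 1) \<and> Cod C h = Cod C f \<and> h \<cdot> d n = g"
    using y1(1-3) k' by (intro exI[of _ "f \<cdot> y1"]) simp
qed

lemma hom_exact_zero:
  assumes ec: "exact_complex C P d" and z: "zero_object C Z"
  shows "hom_exact C P d Z"
proof (rule hom_exactI[OF ec])
  note dn = exact_complexD[OF ec]
  show Z: "Z \<in> Ob C" using z by (simp add: zero_object_def)
  fix f n assume f: "f \<in> Arr C" "Dom C f = P n" "Cod C f = Z"
  have "Zro C (P (n + 1)) Z \<cdot> d n = Zro C (P n) Z" using dn[of n] dn(4)[of "n + 1"] Z by simp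
  moreover have "f = Zro C (P n) Z" by (rule zero_ob_zro[OF z]) (use f in simp_all)
  ultimately show "\<exists>g. g \<in> Arr C \<and> Dom C g = P (n + 1) \<and> Cod C g = Z \<and> g \<cdot> d n = f"
    using dn(4)[of "n + 1"] Z by (intro exI[of _ "Zro C (P (n + 1)) Z"]) simp
qed

end

locale complex_image = A: abelian_cat A + B: abelian_cat_ep B
  for A :: "('oa, 'ma) catg" and B :: "('ob, 'mb) catg" (structure) +
  fixes Q :: "int \<Rightarrow> 'oa" and d :: "int \<Rightarrow> 'ma"
  assumes ec: "exact_complex A Q d"
begin

lemmas dn = A.exact_complexD[OF ec]

lemma dd: "d n \<cdot>\<^bsub>A\<^esub> d (n - 1) = Zro A (Q (n - 1)) (Q (n + 1))"
  using A.exact_at_arr(4)[OF dn(5)[of n]] dn(2)[of "n - 1"] dn(3)[of n] by simp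

lemma dn': "Dom A (d (n - 1)) = Q (n - 1)" "Cod A (d (n - 1)) = Q n"
  using dn(2,3)[of "n - 1"] by simp_all

lemma exact_imageI:
  assumes "additive_functor A B T"
    and "\<And>n y. \<lbrakk>elt B y (fob T (Q n)); far T (d n) \<cdot> y = Zro B (Dom B y) (fob T (Q (n + 1)))\<rbrakk>
      \<Longrightarrow> \<exists>x. x \<in> Arr B \<and> Cod B x = fob T (Q (n - 1)) \<and> far T (d (n - 1)) \<cdot> x = y"
  shows "exact_image B T Q d"
proof -
  interpret T: additive_ftr A B T by unfold_locales fact
  have "exact_at B (far T (d (n - 1))) (far T (d n))" for n
  proof (rule B.exact_elt)
    show "far T (d n) \<cdot> far T (d (n - 1)) = Zro B (Dom B (far T (d (n - 1)))) (Cod B (far T (d n)))"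
      using T.far_cmp[of "d (n - 1)" "d n"] dd[of n] dn[of n] dn(1,4)[of "n - 1"] dn' dn(4)[of "n + 1"] by simp
    fix y assume "elt B y (Dom B (far T (d n)))"
      "far T (d n) \<cdot> y = Zro B (Dom B y) (Cod B (far T (d n)))"
    then show "\<exists>x. x \<in> Arr B \<and> Cod B x = Dom B (far T (d (n - 1))) \<and> far T (d (n - 1)) \<cdot> x = y"
      using assms(2)[of y n] dn(1-3)[of n] dn(1)[of "n - 1"] dn' by simp
  qed (use dn dn' in simp_all)
  then show ?thesis
    using dn by (simp add: exact_image_def exact_complex_def Hom_def)
qed

lemma exact_image_lift:
  assumes "is_functor A B T" "exact_image B T Q d"
    and y: "elt B y (fob T (Q n))" "far T (d n) \<cdot> y = Zro B (Dom B y) (fob T (Q (n + 1)))"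
  obtains x where "elt B x (fob T (Q (n - 1)))" "Dom B x = Dom B y" "far T (d (n - 1)) \<cdot> x = y"
proof -
  interpret T: ftr A B T by unfold_locales fact
  have "exact_at B (far T (d (n - 1))) (far T (d n))"
    using assms(2) by (simp add: exact_image_def exact_complex_def)
  from B.exact_lift[OF this, of y] show ?thesis
    using y dn(1-3)[of n] dn(1)[of "n - 1"] dn' that by auto
qed

lemma exact_image_zero:
  assumes "additive_functor A B T" "\<And>X. X \<in> Ob A \<Longrightarrow> zero_object B (fob T X)"
  shows "exact_image B T Q d"
proof (rule exact_imageI[OF assms(1)])
  interpret T: additive_ftr A B T by unfold_locales fact
  fix n y assume y: "elt B y (fob T (Q n))"
  note y' = B.elt_arr[OF y]
  have "y = Zro B (Dom B y) (fob T (Q n))"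
    by (rule B.zero_ob_zro[OF assms(2)[OF dn(4)[of n]]]) (use y' in simp_all)
  moreover have "far T (d (n - 1)) \<cdot> Zro B (Dom B y) (fob T (Q (n - 1))) = Zro B (Dom B y) (fob T (Q n))"
    using dn(1,4)[of "n - 1"] dn' y' by simp
  ultimately show "\<exists>x. x \<in> Arr B \<and> Cod B x = fob T (Q (n - 1)) \<and> far T (d (n - 1)) \<cdot> x = y"
    using dn(4)[of "n - 1"] y' by (intro exI[of _ "Zro B (Dom B y) (fob T (Q (n - 1)))"]) simp
qed

lemma exact_image_iso:
  assumes "additive_functor A B S" "nat_iso A B S T \<mu>" "exact_image B T Q d"
  shows "exact_image B S Q d"
proof (rule exact_imageI[OF assms(1)])
  note nt = nat_iso_nat_trans[OF assms(2)]
  interpret S: additive_ftr A B S by unfold_locales fact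
  interpret T: ftr A B T by unfold_locales (use nt in \<open>simp add: nat_trans_def\<close>)
  note mu = nat_trans_arr[OF nt] and nat = nat_trans_nat[OF nt]
  note iso = nat_iso_iso[OF assms(2)]
  fix n y assume y: "elt B y (fob S (Q n))" "far S (d n) \<cdot> y = Zro B (Dom B y) (fob S (Q (n + 1)))"
  note y' = B.elt_arr[OF y(1)]
  note m = mu[OF dn(4)[of n]] and m1 = mu[OF dn(4)[of "n + 1"]] and m0 = mu[OF dn(4)[of "n - 1"]]
  have nat0: "\<mu> (Q n) \<cdot> far S (d (n - 1)) = far T (d (n - 1)) \<cdot> \<mu> (Q (n - 1))"
    using nat[of "d (n - 1)"] dn(1)[of "n - 1"] dn' by simp
  have "far T (d n) \<cdot> (\<mu> (Q n) \<cdot> y) = \<mu> (Q (n + 1)) \<cdot> (far S (d n) \<cdot> y)"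
    by (rule B.reassoc2) (use nat[of "d n"] dn(1-4)[of n] dn(4)[of "n + 1"] m m1 y' in simp_all)
  also have "\<dots> = Zro B (Dom B y) (fob T (Q (n + 1)))"
    unfolding y(2) using m1 y' by simp
  finally obtain x where x: "elt B x (fob T (Q (n - 1)))" "Dom B x = Dom B y"
    "far T (d (n - 1)) \<cdot> x = \<mu> (Q n) \<cdot> y"
    using exact_image_lift[OF T.ftr assms(3), of "\<mu> (Q n) \<cdot> y" n] y' m by (auto simp: elt_def)
  note x' = B.elt_arr[OF x(1)]
  note v = B.iso_inverse[OF iso[OF dn(4)[of "n - 1"]]]
  let ?x = "inv_arr B (\<mu> (Q (n - 1))) \<cdot> x"
  have xx: "?x \<in> Arr B" "Dom B ?x = Dom B y" "Cod B ?x = fob S (Q (n - 1))" using v m0 x' x(2) by simp_all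
  have "\<mu> (Q n) \<cdot> (far S (d (n - 1)) \<cdot> ?x) = far T (d (n - 1)) \<cdot> (\<mu> (Q (n - 1)) \<cdot> ?x)"
    by (rule B.reassoc2[OF nat0]) (use dn(1,4)[of "n - 1"] dn' m m0 xx in simp_all)
  also have "\<mu> (Q (n - 1)) \<cdot> ?x = x" using B.reassoc[OF v(6), of x] v m0 x' by simp
  finally have "\<mu> (Q n) \<cdot> (far S (d (n - 1)) \<cdot> ?x) = \<mu> (Q n) \<cdot> y" unfolding x(3) .
  then have "far S (d (n - 1)) \<cdot> ?x = y"
    by - (rule B.mono_cancel[OF B.iso_mono[OF iso[OF dn(4)[of n]]]];
      use xx y' m dn(1,4)[of "n - 1"] dn' in simp)
  then show "\<exists>x. x \<in> Arr B \<and> Cod B x = fob S (Q (n - 1)) \<and> far S (d (n - 1)) \<cdot> x = y"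
    using xx by blast
qed

lemma exact_image_two_of_three:
  assumes S1: "is_functor A B S1" and S3: "additive_functor A B S3"
    and m: "nat_trans A B S1 S2 \<mu>" and p: "nat_trans A B S2 S3 \<epsilon>"
    and se: "\<And>n. short_exact B (\<mu> (Q n)) (\<epsilon> (Q n))"
    and ex: "exact_image B S1 Q d" "exact_image B S2 Q d"
  shows "exact_image B S3 Q d"
proof (rule exact_imageI[OF S3])
  interpret S1: ftr A B S1 by unfold_locales fact
  have S2f: "is_functor A B S2" using m by (simp add: nat_trans_def)
  interpret S2: ftr A B S2 by unfold_locales fact
  interpret S3: additive_ftr A B S3 by unfold_locales fact
  note mu = nat_trans_arr[OF m dn(4)] and ep = nat_trans_arr[OF p dn(4)]
  note s = B.short_exact_arr[OF se]
  have dQ: "d k \<in> Arr A" "Dom A (d k) = Q k" "Cod A (d k) = Q (k + 1)" "Q k \<in> Ob A" for k using dn by blast+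
  have mn: "\<mu> (Q (k + 1)) \<cdot> far S1 (d k) = far S2 (d k) \<cdot> \<mu> (Q k)"
    and en: "\<epsilon> (Q (k + 1)) \<cdot> far S2 (d k) = far S3 (d k) \<cdot> \<epsilon> (Q k)" for k
    using nat_trans_nat[OF m dQ(1)[of k]] nat_trans_nat[OF p dQ(1)[of k]] dQ(2,3)[of k] by simp_all
  fix n z assume z: "elt B z (fob S3 (Q n))" "far S3 (d n) \<cdot> z = Zro B (Dom B z) (fob S3 (Q (n + 1)))"
  note z' = B.elt_arr[OF z(1)]
  obtain y where y: "elt B y (fob S2 (Q n))" "Dom B y = Dom B z" "\<epsilon> (Q n) \<cdot> y = z"
    using B.epi_lift[OF s(6)[of n], of z] z(1) ep[of n] by metis
  note y' = B.elt_arr[OF y(1)]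
  let ?y = "far S2 (d n) \<cdot> y"
  have "\<epsilon> (Q (n + 1)) \<cdot> ?y = far S3 (d n) \<cdot> (\<epsilon> (Q n) \<cdot> y)"
    by (rule B.reassoc2[OF en]) (use dQ[of n] ep[of n] ep[of "n + 1"] y' in simp_all)
  then have "\<epsilon> (Q (n + 1)) \<cdot> ?y = Zro B (Dom B ?y) (Cod B (\<epsilon> (Q (n + 1))))"
    unfolding y(3) z(2) using dQ[of n] ep[of "n + 1"] y' y(2) by simp
  moreover have "elt B ?y (Dom B (\<epsilon> (Q (n + 1))))"
    using dQ[of n] ep[of "n + 1"] y' by (simp add: elt_def)
  ultimately obtain k where k: "elt B k (fob S1 (Q (n + 1)))" "Dom B k = Dom B ?y" "\<mu> (Q (n + 1)) \<cdot> k = ?y"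
    using B.exact_lift[OF s(7)[of "n + 1"], of ?y] mu[of "n + 1"] by metis
  note k' = B.elt_arr[OF k(1)]
  have dk: "Dom B k = Dom B z" using k(2) y' y(2) dQ[of n] by simp
  have DD: "far S2 (d (n + 1)) \<cdot> far S2 (d n) = Zro B (fob S2 (Q n)) (fob S2 (Q (n + 1 + 1)))"
  proof -
    have "exact_at B (far S2 (d (n + 1 - 1))) (far S2 (d (n + 1)))"
      using B.exact_complexD(5)[OF ex(2)[unfolded exact_image_def], of "n + 1"] by simp
    from B.exact_at_arr(4)[OF this] show ?thesis using dQ[of n] dQ[of "n + 1"] by simp
  qed
  have "\<mu> (Q (n + 1 + 1)) \<cdot> (far S1 (d (n + 1)) \<cdot> k) = far S2 (d (n + 1)) \<cdot> (\<mu> (Q (n + 1)) \<cdot> k)"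
    by (rule B.reassoc2[OF mn]) (use dQ[of "n + 1"] mu[of "n + 1"] mu[of "n + 1 + 1"] k' in simp_all)
  also have "\<dots> = Zro B (Dom B k) (fob S2 (Q (n + 1 + 1)))"
    unfolding k(3) using B.reassoc[OF DD, of y] dQ[of n] dQ[of "n + 1"] dQ(4)[of "n + 1 + 1"] y' dk y(2) by simp
  finally have "far S1 (d (n + 1)) \<cdot> k = Zro B (Dom B k) (fob S1 (Q (n + 1 + 1)))"
    by - (rule B.mono_zero[OF s(5)]; use dQ[of "n + 1"] mu[of "n + 1 + 1"] k' in simp)
  then obtain k1 where "elt B k1 (fob S1 (Q (n + 1 - 1)))" "Dom B k1 = Dom B k" "far S1 (d (n + 1 - 1)) \<cdot> k1 = k"
    by (rule exact_image_lift[OF S1 ex(1) k(1)])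
  then have k1: "elt B k1 (fob S1 (Q n))" "Dom B k1 = Dom B z" "far S1 (d n) \<cdot> k1 = k"
    using dk by simp_all
  note k1' = B.elt_arr[OF k1(1)]
  let ?w = "Sub B y (\<mu> (Q n) \<cdot> k1)"
  have w: "elt B ?w (fob S2 (Q n))" "Dom B ?w = Dom B z" using y' y(2) k1' k1(2) mu[of n] by (simp_all add: elt_def)
  have "far S2 (d n) \<cdot> (\<mu> (Q n) \<cdot> k1) = \<mu> (Q (n + 1)) \<cdot> (far S1 (d n) \<cdot> k1)"
    by (rule B.reassoc2[OF mn[symmetric]]) (use dQ[of n] mu[of n] mu[of "n + 1"] k1' in simp_all)
  also have "\<dots> = ?y" unfolding k1(3) k(3) ..
  finally have "far S2 (d n) \<cdot> ?w = Zro B (Dom B ?w) (fob S2 (Q (n + 1)))"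
    using y' y(2) k1' k1(2) mu[of n] dQ[of n] by simp
  then obtain v where v: "elt B v (fob S2 (Q (n - 1)))" "Dom B v = Dom B ?w" "far S2 (d (n - 1)) \<cdot> v = ?w"
    by (rule exact_image_lift[OF S2f ex(2) w(1)])
  note v' = B.elt_arr[OF v(1)]
  have en0: "\<epsilon> (Q n) \<cdot> far S2 (d (n - 1)) = far S3 (d (n - 1)) \<cdot> \<epsilon> (Q (n - 1))"
    using en[of "n - 1"] by simp
  have "far S3 (d (n - 1)) \<cdot> (\<epsilon> (Q (n - 1)) \<cdot> v) = \<epsilon> (Q n) \<cdot> (far S2 (d (n - 1)) \<cdot> v)"
    by (rule B.reassoc2[OF en0[symmetric]]) (use dQ(1,4)[of "n - 1"] dn' ep[of n] ep[of "n - 1"] v' in simp_all)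
  also have "\<dots> = z"
    unfolding v(3)
    using B.reassoc[OF s(4)[of n], of k1] y y' k1' k1(2) mu[of n] ep[of n] z' S3.fob_ob[OF dQ(4)[of n]] by simp
  finally show "\<exists>x. x \<in> Arr B \<and> Cod B x = fob S3 (Q (n - 1)) \<and> far S3 (d (n - 1)) \<cdot> x = z"
    using v' ep[of "n - 1"] by (intro exI[of _ "\<epsilon> (Q (n - 1)) \<cdot> v"]) simp
qed

end

section \<open>Conditions (2) and (3)\<close>

context abelian_cat_ep
begin

lemma exact_at_transport:
  assumes ex: "exact_at C f g" and iso: "is_iso_arr C a" "is_iso_arr C b" "is_iso_arr C c"
    and arr: "f' \<in> Arr C" "g' \<in> Arr C" "Cod C f' = Dom C g'"
    and ty: "Dom C a = Dom C f" "Cod C a = Dom C f'" "Dom C b = Cod C f" "Cod C b = Cod C f'"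
      "Dom C c = Cod C g" "Cod C c = Cod C g'"
    and sq: "f' \<cdot> a = b \<cdot> f" "g' \<cdot> b = c \<cdot> g"
  shows "exact_at C f' g'"
proof -
  note fg = exact_at_arr[OF ex]
  note a = iso_inverse[OF iso(1)] and b = iso_inverse[OF iso(2)] and c = iso_inverse[OF iso(3)]
  show ?thesis
  proof (rule exact_elt[OF arr])
    have "(g' \<cdot> f') \<cdot> a = g' \<cdot> (b \<cdot> f)" using arr a ty sq(1) by simp
    also have "\<dots> = c \<cdot> (g \<cdot> f)" by (rule reassoc2[OF sq(2)]) (use arr fg b c ty in simp_all)
    also have "\<dots> = Zro C (Dom C a) (Cod C g')" unfolding fg(4) using fg c ty by simp
    finally show "g' \<cdot> f' = Zro C (Dom C f') (Cod C g')"
      by - (rule epi_zero[OF iso_epi[OF iso(1)]]; use arr a ty in simp)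
    fix y assume y: "elt C y (Dom C g')" "g' \<cdot> y = Zro C (Dom C y) (Cod C g')"
    note y' = elt_arr[OF y(1)]
    let ?y = "inv_arr C b \<cdot> y"
    have yy: "?y \<in> Arr C" "Dom C ?y = Dom C y" "Cod C ?y = Dom C g" using b y' ty arr fg by simp_all
    have byy: "b \<cdot> ?y = y" using reassoc[OF b(6), of y] b y' ty arr by simp
    have "c \<cdot> (g \<cdot> ?y) = g' \<cdot> (b \<cdot> ?y)"
      by (rule reassoc2[OF sq(2)[symmetric]]) (use arr fg b c ty yy in simp_all)
    then have "c \<cdot> (g \<cdot> ?y) = Zro C (Dom C y) (Cod C g')" unfolding byy y(2) .
    then have "g \<cdot> ?y = Zro C (Dom C ?y) (Cod C g)"
      by - (rule mono_zero[OF iso_mono[OF iso(3)]]; use fg c ty yy in simp)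
    then obtain x where x: "elt C x (Dom C f)" "f \<cdot> x = ?y"
      using exact_lift[OF ex, of ?y] yy y' by (metis elt_def)
    note x' = elt_arr[OF x(1)]
    have "f' \<cdot> (a \<cdot> x) = b \<cdot> (f \<cdot> x)"
      by (rule reassoc2[OF sq(1)]) (use arr fg a b ty x' in simp_all)
    then show "\<exists>x. x \<in> Arr C \<and> Cod C x = Dom C f' \<and> f' \<cdot> x = y"
      using x(2) byy x' a ty by (intro exI[of _ "a \<cdot> x"]) simp
  qed
qed

lemma exact_at_conjugate:
  assumes iso: "is_iso_arr C a" "is_iso_arr C b" "is_iso_arr C c"
    and fg: "f \<in> Arr C" "g \<in> Arr C" "Cod C f = Dom C g"
    and ty: "Dom C a = Dom C f" "Dom C b = Cod C f" "Dom C c = Cod C g"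
  shows "exact_at C ((b \<cdot> f) \<cdot> inv_arr C a) ((c \<cdot> g) \<cdot> inv_arr C b) \<longleftrightarrow> exact_at C f g"
proof
  note a = iso_inverse[OF iso(1)] and b = iso_inverse[OF iso(2)] and c = iso_inverse[OF iso(3)]
  let ?f = "(b \<cdot> f) \<cdot> inv_arr C a" and ?g = "(c \<cdot> g) \<cdot> inv_arr C b"
  have t: "?f \<in> Arr C" "Dom C ?f = Cod C a" "Cod C ?f = Cod C b"
    "?g \<in> Arr C" "Dom C ?g = Cod C b" "Cod C ?g = Cod C c" using a b c fg ty by simp_all
  have sq: "?f \<cdot> a = b \<cdot> f" "?g \<cdot> b = c \<cdot> g" using a b c fg ty by simp_all
  {
    assume "exact_at C f g"
    then show "exact_at C ?f ?g"
      by (rule exact_at_transport[OF _ iso t(1,4)]) (use sq t ty in simp_all)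
  next
    assume ex: "exact_at C ?f ?g"
    show "exact_at C f g"
    proof (rule exact_at_transport[OF ex iso(1,2,3)[THEN iso_inv_iso] fg])
      show "f \<cdot> inv_arr C a = inv_arr C b \<cdot> ?f"
        using reassoc[OF b(5), of "f \<cdot> inv_arr C a"] a b fg ty by simp
      show "g \<cdot> inv_arr C b = inv_arr C c \<cdot> ?g"
        using reassoc[OF c(5), of "g \<cdot> inv_arr C b"] b c fg ty by simp
    qed (use a b c t fg ty in simp_all)
  }
qed

end

context cleft
begin

lemma exact_iff_mono:
  assumes X: "X \<in> Ob A"
  shows "exact_at B (far q (u (fob G X)) \<cdot> far q (lam (fob G (fob G X))))
      (far q (u X) \<cdot> far q (lam (fob G X))) \<longleftrightarrow> is_mono B (far q (u X))"
    (is "exact_at B (?a \<cdot> ?e) (?c \<cdot> ?b) \<longleftrightarrow> _")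
proof
  have GX: "fob G X \<in> Ob A" and GGX: "fob G (fob G X) \<in> Ob A" using X by simp_all
  note s = A.short_exact_arr[OF u_lam_short_exact[OF GX]]
  have ab: "exact_at B ?a ?b" and be: "is_epi B ?b" using q.L_right_exact[OF s(7,6)] by blast+
  have ee: "is_epi B ?e" using q.L_epi[OF lam_epi[OF GGX]] .
  have ty: "?a \<in> Arr B" "Dom B ?a = fob q (fob G (fob G X))" "Cod B ?a = fob q (fob l (fob e (fob G X)))"
    "?b \<in> Arr B" "Dom B ?b = fob q (fob l (fob e (fob G X)))" "Cod B ?b = fob q (fob G X)"
    "?c \<in> Arr B" "Dom B ?c = fob q (fob G X)" "Cod B ?c = fob q (fob l (fob e X))"
    "?e \<in> Arr B" "Dom B ?e = fob q (fob l (fob e (fob G (fob G X))))" "Cod B ?e = fob q (fob G (fob G X))"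
    using X GX GGX by simp_all
  have ba: "?b \<cdot> ?a = Zro B (Dom B ?a) (Cod B ?b)" using B.exact_at_arr(4)[OF ab] .
  {
    assume ex: "exact_at B (?a \<cdot> ?e) (?c \<cdot> ?b)"
    show "is_mono B ?c"
    proof (rule B.mono_elt[OF ty(7)])
      fix x assume x: "elt B x (Dom B ?c)" "?c \<cdot> x = Zro B (Dom B x) (Cod B ?c)"
      then have "elt B x (Cod B ?b)" using ty by simp
      then obtain y where y: "elt B y (Dom B ?b)" "Dom B y = Dom B x" "?b \<cdot> y = x"
        using B.epi_lift[OF be] by blast
      note x' = B.elt_arr[OF x(1)] and y' = B.elt_arr[OF y(1)]
      have "(?c \<cdot> ?b) \<cdot> y = Zro B (Dom B y) (Cod B (?c \<cdot> ?b))"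
        using x(2) y y' ty(4-9) by simp
      moreover have "elt B y (Dom B (?c \<cdot> ?b))" using y(1) ty(4-9) by simp
      ultimately obtain z where z: "elt B z (Dom B (?a \<cdot> ?e))" "Dom B z = Dom B y" "(?a \<cdot> ?e) \<cdot> z = y"
        using B.exact_lift[OF ex] by blast
      note z' = B.elt_arr[OF z(1)]
      have zt: "?e \<cdot> z \<in> Arr B" "Dom B (?e \<cdot> z) = Dom B x" "Cod B (?e \<cdot> z) = Dom B ?a"
        using z' z(2) y(2) ty by simp_all
      have "?a \<cdot> (?e \<cdot> z) = y" using z(3) z' ty by simp
      then have "?b \<cdot> y = Zro B (Dom B x) (Dom B ?c)"
        using B.reassoc[OF ba, of "?e \<cdot> z"] zt ty X GX by simp
      then show "x = Zro B (Dom B x) (Dom B ?c)" unfolding y(3) .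
    qed
  next
    assume m: "is_mono B ?c"
    show "exact_at B (?a \<cdot> ?e) (?c \<cdot> ?b)"
    proof (rule B.exact_elt)
      show "(?c \<cdot> ?b) \<cdot> (?a \<cdot> ?e) = Zro B (Dom B (?a \<cdot> ?e)) (Cod B (?c \<cdot> ?b))"
        using B.reassoc[OF ba, of ?e] ty X GX GGX by simp
      fix y assume y: "elt B y (Dom B (?c \<cdot> ?b))"
        "(?c \<cdot> ?b) \<cdot> y = Zro B (Dom B y) (Cod B (?c \<cdot> ?b))"
      note y' = B.elt_arr[OF y(1)]
      have yb: "Cod B y = Dom B ?b" using y' ty by simp
      have "?c \<cdot> (?b \<cdot> y) = Zro B (Dom B y) (Cod B ?c)" using y(2) y'(1) yb ty by simp
      then have "?b \<cdot> y = Zro B (Dom B y) (Cod B ?b)"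
        by - (rule B.mono_zero[OF m]; use y'(1) yb ty in simp)
      then obtain w where w: "elt B w (Dom B ?a)" "?a \<cdot> w = y"
        using B.exact_lift[OF ab, of y] y' yb by (metis elt_def)
      then obtain z where z: "elt B z (Dom B ?e)" "?e \<cdot> z = w"
        using B.epi_lift[OF ee, of w] ty by metis
      show "\<exists>x. x \<in> Arr B \<and> Cod B x = Dom B (?a \<cdot> ?e) \<and> (?a \<cdot> ?e) \<cdot> x = y"
        using z w(2) B.elt_arr[OF z(1)] ty by (intro exI[of _ z]) simp
    qed (use ty in simp_all)
  }
qed

text \<open>The composite \<open>q(u\<^sub>G\<^sub>X) q(\<lambda>)\<close> has the image of \<open>q(u\<^sub>G\<^sub>X)\<close>, which by right exactness of \<open>q\<close> is the
  kernel of \<open>q(\<lambda>\<^sub>G\<^sub>X)\<close>.  The identifications only conjugate the two maps by isomorphisms.\<close>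

lemma alpha_beta_exact_iff_mono:
  assumes id: "identifications B A e i l G q \<kappa> \<phi>1 \<phi>2" and X: "X \<in> Ob A"
  shows "exact_at B (alpha B e lam G u q \<kappa> \<phi>1 \<phi>2 X) (beta B e lam G u q \<kappa> \<phi>1 X) \<longleftrightarrow>
    is_mono B (far q (u X))"
proof -
  have GX: "fob G X \<in> Ob A" and GGX: "fob G (fob G X) \<in> Ob A" using X by simp_all
  from id have \<kappa>: "nat_iso B B (q \<circ>\<^sub>F l) id_ftor \<kappa>" and p1: "nat_iso A B (e \<circ>\<^sub>F G) (F \<circ>\<^sub>F e) \<phi>1"
    and p2: "nat_iso A B (e \<circ>\<^sub>F pow_ftor G 2) (pow_ftor F 2 \<circ>\<^sub>F e) \<phi>2"
    by (simp_all add: identifications_def)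
  have eo: "fob e X \<in> Ob B" "fob e (fob G X) \<in> Ob B" "fob e (fob G (fob G X)) \<in> Ob B" using X by simp_all
  note \<kappa>a = nat_trans_arr[OF nat_iso_nat_trans[OF \<kappa>], simplified] and \<kappa>i = nat_iso_iso[OF \<kappa>]
  note p1a = nat_trans_arr[OF nat_iso_nat_trans[OF p1] X, simplified]
  note p2a = nat_trans_arr[OF nat_iso_nat_trans[OF p2] X, simplified numeral_2_eq_2, simplified]
  let ?a = "\<phi>2 X \<cdot> \<kappa> (fob e (fob G (fob G X)))" and ?b = "\<phi>1 X \<cdot> \<kappa> (fob e (fob G X))"
  have "is_iso_arr B ?a" "is_iso_arr B ?b" "is_iso_arr B (\<kappa> (fob e X))"
    using B.iso_cmp[OF \<kappa>i[OF eo(3)] nat_iso_iso[OF p2 X]] B.iso_cmp[OF \<kappa>i[OF eo(2)] nat_iso_iso[OF p1 X]]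
      \<kappa>i[OF eo(1)] \<kappa>a eo p1a p2a by simp_all
  from B.exact_at_conjugate[OF this, of "far q (u (fob G X)) \<cdot> far q (lam (fob G (fob G X)))"
      "far q (u X) \<cdot> far q (lam (fob G X))"]
  have "exact_at B (alpha B e lam G u q \<kappa> \<phi>1 \<phi>2 X) (beta B e lam G u q \<kappa> \<phi>1 X) \<longleftrightarrow>
      exact_at B (far q (u (fob G X)) \<cdot> far q (lam (fob G (fob G X))))
        (far q (u X) \<cdot> far q (lam (fob G X)))"
    unfolding alpha_def beta_def using X GX GGX \<kappa>a eo p1a p2a by (simp del: B.assoc)
  then show ?thesis using exact_iff_mono[OF X] by simp
qed

section \<open>Reduction of the compatibility condition to its first form\<close>

text \<open>Relative projectivity with respect to \<open>e\<close>: such an object is a retract of a free object.\<close>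

definition rel_proj :: "'oa \<Rightarrow> bool" where
  "rel_proj X \<longleftrightarrow> X \<in> Ob A \<and>
    (\<exists>s. s \<in> Arr A \<and> Dom A s = X \<and> Cod A s = fob l (fob e X) \<and> lam X \<cdot>\<^bsub>A\<^esub> s = Idt A X)"

lemma Proj_rel_proj:
  assumes "Q \<in> Proj A" shows "rel_proj Q"
proof -
  have Q: "Q \<in> Ob A" using A.Proj_ob assms .
  obtain s where "s \<in> Arr A" "Dom A s = Q" "Cod A s = Dom A (lam Q)" "lam Q \<cdot>\<^bsub>A\<^esub> s = Idt A Q"
    by (rule A.Proj_lift[OF assms lam_epi[OF Q], of "Idt A Q"]) (use Q in auto)
  then show ?thesis using Q unfolding rel_proj_def by auto
qed

text \<open>When \<open>\<lambda>\<^sub>X\<close> splits, \<open>G X\<close> is a direct summand of the free object \<open>l e X\<close>, so \<open>\<lambda>\<close> splits at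
  \<open>G X\<close> as well.\<close>

lemma rel_proj_G:
  assumes "rel_proj X"
  shows "rel_proj (fob G X)" "short_exact B (far q (u X)) (far q (lam X))"
proof -
  obtain s where X: "X \<in> Ob A" and s: "s \<in> Arr A" "Dom A s = X" "Cod A s = fob l (fob e X)"
    "lam X \<cdot>\<^bsub>A\<^esub> s = Idt A X" using assms unfolding rel_proj_def by blast
  let ?L = "fob l (fob e X)"
  let ?z = "Sub A (Idt A ?L) (s \<cdot>\<^bsub>A\<^esub> lam X)"
  have z: "?z \<in> Arr A" "Dom A ?z = ?L" "Cod A ?z = ?L" using s X by simp_all
  have "lam X \<cdot>\<^bsub>A\<^esub> ?z = Zro A ?L X" using s X A.reassoc[OF s(4), of "lam X"] by simp
  then obtain r where r: "r \<in> Arr A" "Dom A r = ?L" "Cod A r = fob G X" "u X \<cdot>\<^bsub>A\<^esub> r = ?z"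
    by - (rule A.kernel_lift[OF u_kernel[OF X], of ?z ?L]; use z X in simp)
  have "u X \<cdot>\<^bsub>A\<^esub> (r \<cdot>\<^bsub>A\<^esub> u X) = u X"
    using A.reassoc[OF r(4), of "u X"] r(1-3) s lam_u[OF X] X by simp
  then have ru: "r \<cdot>\<^bsub>A\<^esub> u X = Idt A (fob G X)"
    by - (rule A.mono_cancel[OF u_mono[OF X]]; use r(1-3) X in simp)
  have "far q r \<cdot> far q (u X) = Idt B (fob q (fob G X))"
    using arg_cong[OF ru, of "far q"] r(1-3) X by simp
  then have m: "is_mono B (far q (u X))"
    by - (rule B.split_mono[of _ "far q r"]; use r(1-3) X in simp)
  note se = A.short_exact_arr[OF u_lam_short_exact[OF X]]
  show "short_exact B (far q (u X)) (far q (lam X))"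
    using m q.L_right_exact[OF se(7,6)] by (simp add: short_exact_def)
  let ?s = "far l (far e r) \<cdot>\<^bsub>A\<^esub> (far l (\<sigma> (fob e X)) \<cdot>\<^bsub>A\<^esub> u X)"
  have "lam (fob G X) \<cdot>\<^bsub>A\<^esub> ?s = r \<cdot>\<^bsub>A\<^esub> (lam ?L \<cdot>\<^bsub>A\<^esub> (far l (\<sigma> (fob e X)) \<cdot>\<^bsub>A\<^esub> u X))"
    by (rule A.reassoc2) (use counit_nat[OF r(1)] r(1-3) X in simp_all)
  also have "\<dots> = Idt A (fob G X)"
    using A.reassoc[OF triangle_L[of "fob e X"], of "u X"] ru X by simp
  finally show "rel_proj (fob G X)"
    unfolding rel_proj_def using r(1-3) X by (intro conjI exI[of _ ?s]) simp_all
qed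

lemma G_pow_additive: "additive_functor A A (pow_ftor G n)"
proof (induction n)
  case 0
  show ?case by (simp add: additive_functor_def is_functor_id)
next
  case (Suc n)
  then show ?case using additive_comp[OF Suc G_additive] by simp
qed

lemma G_pow_rel_proj: "rel_proj X \<Longrightarrow> rel_proj (fob (pow_ftor G n) X)"
  by (induction n) (auto intro: rel_proj_G(1))

lemma F_pow_functor: "is_functor B B (pow_ftor F n)"
  by (induction n) (auto intro: is_functor_id is_functor_comp[OF _ F.ftr] simp del: comp_ftor_simps)

lemma eG_pow_iso:
  assumes p1: "nat_iso A B (e \<circ>\<^sub>F G) (F \<circ>\<^sub>F e) \<phi>1"
  shows "\<exists>\<psi>. nat_iso A B (e \<circ>\<^sub>F pow_ftor G n) (pow_ftor F n \<circ>\<^sub>F e) \<psi>"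
proof (induction n)
  case 0
  have "is_iso_arr B (Idt B X)" if "X \<in> Ob B" for X
    using that unfolding is_iso_arr_def
    by (intro exI[of _ "Idt B X"]) (simp add: inverse_arrows_def Hom_def)
  then have "nat_iso A B (e \<circ>\<^sub>F pow_ftor G 0) (pow_ftor F 0 \<circ>\<^sub>F e) (\<lambda>X. Idt B (fob e X))"
    using is_functor_comp[OF is_functor_id[of A] e.ftr] is_functor_comp[OF e.ftr is_functor_id[of B]]
    unfolding nat_iso_def nat_trans_def by (auto simp: Hom_def)
  then show ?case by blast
next
  case (Suc n)
  then obtain \<psi> where \<psi>: "nat_iso A B (e \<circ>\<^sub>F pow_ftor G n) (pow_ftor F n \<circ>\<^sub>F e) \<psi>" by blast
  interpret Gn: additive_ftr A A "pow_ftor G n" by unfold_locales (rule G_pow_additive)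
  interpret Fn: ftr B B "pow_ftor F n" by unfold_locales (rule F_pow_functor)
  note \<psi>a = nat_trans_arr[OF nat_iso_nat_trans[OF \<psi>], simplified]
    and \<psi>n = nat_trans_nat[OF nat_iso_nat_trans[OF \<psi>], simplified]
  note pa = nat_trans_arr[OF nat_iso_nat_trans[OF p1], simplified]
    and pn = nat_trans_nat[OF nat_iso_nat_trans[OF p1], simplified]
  let ?\<chi> = "\<lambda>X. far F (\<psi> X) \<cdot> \<phi>1 (fob (pow_ftor G n) X)"
  have "nat_iso A B (e \<circ>\<^sub>F pow_ftor G (Suc n)) (pow_ftor F (Suc n) \<circ>\<^sub>F e) ?\<chi>"
    unfolding nat_iso_def nat_trans_def
  proof (intro conjI ballI allI)
    show "is_functor A B (e \<circ>\<^sub>F pow_ftor G (Suc n))"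
      using is_functor_comp[OF is_functor_comp[OF Gn.ftr G.ftr] e.ftr] by simp
    show "is_functor A B (pow_ftor F (Suc n) \<circ>\<^sub>F e)"
      using is_functor_comp[OF e.ftr F_pow_functor] .
    show "?\<chi> X \<in> Hom B (fob (e \<circ>\<^sub>F pow_ftor G (Suc n)) X) (fob (pow_ftor F (Suc n) \<circ>\<^sub>F e) X)"
      if "X \<in> Ob A" for X
      using \<psi>a[OF that] pa[of "fob (pow_ftor G n) X"] that by (simp add: Hom_def)
    show "is_iso_arr B (?\<chi> X)" if "X \<in> Ob A" for X
      by (rule B.iso_cmp[OF nat_iso_iso[OF p1] F.far_iso[OF nat_iso_iso[OF \<psi>]]])
        (use \<psi>a[OF that] pa[of "fob (pow_ftor G n) X"] that in simp_all)
    fix X Y f assume "f \<in> Hom A X Y"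
    then have f: "f \<in> Arr A" "Dom A f = X" "Cod A f = Y" "X \<in> Ob A" "Y \<in> Ob A" by (auto simp: Hom_def)
    let ?f = "far (pow_ftor G n) f"
    let ?GX = "fob (pow_ftor G n) X" and ?GY = "fob (pow_ftor G n) Y"
    have gf: "?f \<in> Arr A" "Dom A ?f = ?GX" "Cod A ?f = ?GY" "?GX \<in> Ob A" "?GY \<in> Ob A" using f by simp_all
    have n1: "\<phi>1 ?GY \<cdot> far e (far G ?f) = far F (far e ?f) \<cdot> \<phi>1 ?GX"
      using pn[OF gf(1)] gf by simp
    have n2: "far F (\<psi> Y) \<cdot> far F (far e ?f) = far F (far (pow_ftor F n) (far e f)) \<cdot> far F (\<psi> X)"
      using arg_cong[OF \<psi>n[OF f(1)], of "far F"] f \<psi>a gf by simp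
    have t: "far F (\<psi> Y) \<in> Arr B" "Dom B (far F (\<psi> Y)) = fob F (fob e ?GY)"
      "far F (\<psi> X) \<in> Arr B" "Dom B (far F (\<psi> X)) = fob F (fob e ?GX)"
      "Cod B (far F (\<psi> X)) = fob F (fob (pow_ftor F n) (fob e X))"
      "far F (far e ?f) \<in> Arr B" "Dom B (far F (far e ?f)) = fob F (fob e ?GX)"
      "Cod B (far F (far e ?f)) = fob F (fob e ?GY)"
      using \<psi>a f gf by simp_all
    have "?\<chi> Y \<cdot> far e (far G ?f) = far F (\<psi> Y) \<cdot> (far F (far e ?f) \<cdot> \<phi>1 ?GX)"
      using n1 t(1,2) pa[OF gf(4)] pa[OF gf(5)] gf by simp
    also have "\<dots> = far F (far (pow_ftor F n) (far e f)) \<cdot> ?\<chi> X"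
      by (rule B.reassoc2[OF n2]) (use t pa[OF gf(4)] f in simp_all)
    finally show "?\<chi> Y \<cdot> far (e \<circ>\<^sub>F pow_ftor G (Suc n)) f =
        far (pow_ftor F (Suc n) \<circ>\<^sub>F e) f \<cdot> ?\<chi> X" by simp
  qed
  then show ?case by blast
qed

end

context cleft
begin

lemma G_pow_zero:
  assumes p1: "nat_iso A B (e \<circ>\<^sub>F G) (F \<circ>\<^sub>F e) \<phi>1" and z: "zero_functor B B (pow_ftor F s)" and X: "X \<in> Ob A"
  shows "zero_object A (fob (pow_ftor G s) X)"
proof -
  interpret Gn: additive_ftr A A "pow_ftor G s" by unfold_locales (rule G_pow_additive)
  obtain \<psi> where \<psi>: "nat_iso A B (e \<circ>\<^sub>F pow_ftor G s) (pow_ftor F s \<circ>\<^sub>F e) \<psi>"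
    using eG_pow_iso[OF p1] by blast
  note \<psi>a = nat_trans_arr[OF nat_iso_nat_trans[OF \<psi>] X, simplified]
  note v = B.iso_inverse[OF nat_iso_iso[OF \<psi> X]]
  let ?Z = "fob e (fob (pow_ftor G s) X)"
  have zo: "zero_object B (fob (pow_ftor F s) (fob e X))"
    using z X by (simp add: zero_functor_def)
  have "\<psi> X = Zro B ?Z (fob (pow_ftor F s) (fob e X))"
    by (rule B.zero_ob_zro[OF zo]) (use \<psi>a in simp_all)
  then have "Idt B ?Z = inv_arr B (\<psi> X) \<cdot> Zro B ?Z (fob (pow_ftor F s) (fob e X))"
    using v(5) \<psi>a by simp
  also have "\<dots> = Zro B ?Z ?Z" using v \<psi>a X by simp
  finally have "zero_object B ?Z" using X by (intro B.idt_zro_zero_ob) simp_all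
  then show ?thesis using X by (intro e_reflects_zero_ob) simp_all
qed

lemma nat_descend:
  assumes "P s" "\<And>n. P (Suc n) \<Longrightarrow> P n" shows "P (0 :: nat)"
  using assms(1) by (induction s) (auto intro: assms(2))

text \<open>Nilpotency of \<open>F\<close> makes some \<open>G\<^sup>s\<close> vanish.  For the functors \<open>l e G\<^sup>n\<close> acyclicity is the
  hypothesis, since \<open>e G\<^sup>n\<close> is \<open>F\<^sup>n e\<close> up to isomorphism; for \<open>n = 0\<close> it holds because \<open>e\<close> is exact and \<open>l\<close>
  preserves projectives.  The sequences
  \<open>0 \<rightarrow> G\<^sup>n\<^sup>+\<^sup>1 \<rightarrow> l e G\<^sup>n \<rightarrow> G\<^sup>n \<rightarrow> 0\<close> stay exact under \<open>q\<close> on projectives and under \<open>Hom(Q, -)\<close> for projective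
  \<open>Q\<close>.  So acyclicity descends from \<open>G\<^sup>s\<close> to the identity functor.\<close>

lemma compatible_C2ii_imp_C2i:
  assumes id: "identifications B A e i l G q \<kappa> \<phi>1 \<phi>2" and c: "compatible_C2ii B A e l F"
  shows "compatible_C2i B A i q"
  unfolding compatible_C2i_def
proof (intro allI impI conjI ballI)
  fix Q d assume cr: "complete_resolution A Q d"
  note ec = A.complete_resolutionD(1)[OF cr] and proj = A.complete_resolutionD(2)[OF cr]
  from id have \<kappa>: "nat_iso B B (q \<circ>\<^sub>F l) id_ftor \<kappa>" and p1: "nat_iso A B (e \<circ>\<^sub>F G) (F \<circ>\<^sub>F e) \<phi>1"
    by (simp_all add: identifications_def)
  from c obtain s where s: "zero_functor B B (pow_ftor F s)"
    unfolding compatible_C2ii_def nilpotent_functor_def by blast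
  have Fe: "exact_image B (pow_ftor F j \<circ>\<^sub>F e) Q d" if "j > 0" for j
    using c cr that unfolding compatible_C2ii_def by blast
  have lF: "hom_exact A Q d (fob l (fob (pow_ftor F j) P))" if "j > 0" "P \<in> Proj B" for j P
    using c cr that unfolding compatible_C2ii_def by fastforce
  interpret Q: complex_image A B Q d by unfold_locales (rule ec)
  note \<kappa>a = nat_trans_arr[OF nat_iso_nat_trans[OF \<kappa>], simplified]
    and \<kappa>n = nat_trans_nat[OF nat_iso_nat_trans[OF \<kappa>], simplified]
  show "exact_image B q Q d"
  proof -
    have add: "additive_functor A B (q \<circ>\<^sub>F pow_ftor G n)" for n
      using additive_comp[OF G_pow_additive q.L_additive] .
    have "exact_image B (q \<circ>\<^sub>F pow_ftor G 0) Q d"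
    proof (rule nat_descend[where P = "\<lambda>n. exact_image B (q \<circ>\<^sub>F pow_ftor G n) Q d"])
      show "exact_image B (q \<circ>\<^sub>F pow_ftor G s) Q d"
        by (rule Q.exact_image_zero[OF add]) (simp add: q.L.far_zero_ob G_pow_zero[OF p1 s])
      fix n assume IH: "exact_image B (q \<circ>\<^sub>F pow_ftor G (Suc n)) Q d"
      interpret Gn: additive_ftr A A "pow_ftor G n" by unfold_locales (rule G_pow_additive)
      obtain \<psi> where \<psi>: "nat_iso A B (e \<circ>\<^sub>F pow_ftor G n) (pow_ftor F n \<circ>\<^sub>F e) \<psi>"
        using eG_pow_iso[OF p1] by blast
      note \<psi>a = nat_trans_arr[OF nat_iso_nat_trans[OF \<psi>], simplified]
        and \<psi>n = nat_trans_nat[OF nat_iso_nat_trans[OF \<psi>], simplified]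
      let ?S = "q \<circ>\<^sub>F (l \<circ>\<^sub>F (e \<circ>\<^sub>F pow_ftor G n))"
      have Sadd: "additive_functor A B ?S"
        using additive_comp[OF additive_comp[OF additive_comp[OF G_pow_additive R_additive] L_additive] q.L_additive] .
      let ?\<mu> = "\<lambda>X. \<psi> X \<cdot> \<kappa> (fob e (fob (pow_ftor G n) X))"
      have iso: "nat_iso A B ?S (pow_ftor F n \<circ>\<^sub>F e) ?\<mu>"
        unfolding nat_iso_def nat_trans_def
      proof (intro conjI ballI allI)
        show "is_functor A B ?S" using Sadd by (simp add: additive_functor_def)
        show "is_functor A B (pow_ftor F n \<circ>\<^sub>F e)" using is_functor_comp[OF e.ftr F_pow_functor] .
        show "?\<mu> X \<in> Hom B (fob ?S X) (fob (pow_ftor F n \<circ>\<^sub>F e) X)" if "X \<in> Ob A" for X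
          using that \<psi>a[OF that] \<kappa>a[of "fob e (fob (pow_ftor G n) X)"] by (simp add: Hom_def)
        show "is_iso_arr B (?\<mu> X)" if "X \<in> Ob A" for X
          by (rule B.iso_cmp[OF nat_iso_iso[OF \<kappa>] nat_iso_iso[OF \<psi>]])
            (use that \<psi>a[OF that] \<kappa>a[of "fob e (fob (pow_ftor G n) X)"] in simp_all)
        fix X Y f assume "f \<in> Hom A X Y"
        then have f: "f \<in> Arr A" "Dom A f = X" "Cod A f = Y" "X \<in> Ob A" "Y \<in> Ob A" by (auto simp: Hom_def)
        let ?f = "far e (far (pow_ftor G n) f)"
        let ?GX = "fob e (fob (pow_ftor G n) X)" and ?GY = "fob e (fob (pow_ftor G n) Y)"
        have gf: "?f \<in> Arr B" "Dom B ?f = ?GX" "Cod B ?f = ?GY" "?GX \<in> Ob B" "?GY \<in> Ob B" using f by simp_all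
        note kx = \<kappa>a[OF gf(4)] and ky = \<kappa>a[OF gf(5)]
        have F': "far (pow_ftor F n) (far e f) \<in> Arr B"
          "Dom B (far (pow_ftor F n) (far e f)) = fob (pow_ftor F n) (fob e X)"
          using ftr.far_arr[of B B "pow_ftor F n" "far e f"] F_pow_functor f
          by (simp_all add: ftr_def ftr_axioms_def B.cat_axioms)
        have k: "\<kappa> ?GY \<cdot> far q (far l ?f) = ?f \<cdot> \<kappa> ?GX"
          using \<kappa>n[OF gf(1)] gf by simp
        have "?\<mu> Y \<cdot> far q (far l ?f) = \<psi> Y \<cdot> (?f \<cdot> \<kappa> ?GX)"
          using k \<psi>a[OF f(5)] ky gf f by simp
        also have "\<dots> = far (pow_ftor F n) (far e f) \<cdot> ?\<mu> X"
          by (rule B.reassoc2) (use \<psi>n[OF f(1)] \<psi>a[OF f(4)] \<psi>a[OF f(5)] kx gf f F' in simp_all)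
        finally show "?\<mu> Y \<cdot> far ?S f = far (pow_ftor F n \<circ>\<^sub>F e) f \<cdot> ?\<mu> X" by simp
      qed
      have "exact_image B (pow_ftor F n \<circ>\<^sub>F e) Q d"
      proof (cases n)
        case 0
        have "pow_ftor F n \<circ>\<^sub>F e = e" using 0 by (simp add: comp_ftor_def id_ftor_def)
        moreover have "exact_image B e Q d"
          unfolding exact_image_def exact_complex_def
          using Q.dn e.far_exact_at by (simp add: Hom_def)
        ultimately show ?thesis by simp
      qed (rule Fe, simp)
      then have M: "exact_image B ?S Q d" by (rule Q.exact_image_iso[OF Sadd iso])
      have gX: "fob (pow_ftor G n) X \<in> Ob A" if "X \<in> Ob A" for X using that by simp
      show "exact_image B (q \<circ>\<^sub>F pow_ftor G n) Q d"
      proof (rule Q.exact_image_two_of_three[OF _ add _ _ _ IH M])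
        show "is_functor A B (q \<circ>\<^sub>F pow_ftor G (Suc n))"
          using add[of "Suc n"] by (simp add: additive_functor_def)
        show "nat_trans A B (q \<circ>\<^sub>F pow_ftor G (Suc n)) ?S (\<lambda>X. far q (u (fob (pow_ftor G n) X)))"
          unfolding nat_trans_def
        proof (intro conjI ballI allI)
          show "is_functor A B (q \<circ>\<^sub>F pow_ftor G (Suc n))" "is_functor A B ?S"
            using add[of "Suc n"] Sadd by (simp_all add: additive_functor_def)
          show "far q (u (fob (pow_ftor G n) X)) \<in> Hom B (fob (q \<circ>\<^sub>F pow_ftor G (Suc n)) X) (fob ?S X)"
            if "X \<in> Ob A" for X using gX[OF that] by (simp add: Hom_def)
          fix X Y f assume "f \<in> Hom A X Y"
          then have f: "f \<in> Arr A" "Dom A f = X" "Cod A f = Y" "X \<in> Ob A" "Y \<in> Ob A" by (auto simp: Hom_def)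
          show "far q (u (fob (pow_ftor G n) Y)) \<cdot> far (q \<circ>\<^sub>F pow_ftor G (Suc n)) f =
              far ?S f \<cdot> far q (u (fob (pow_ftor G n) X))"
            using arg_cong[OF u_nat[of "far (pow_ftor G n) f"], of "far q"] f gX by simp
        qed
        show "nat_trans A B ?S (q \<circ>\<^sub>F pow_ftor G n) (\<lambda>X. far q (lam (fob (pow_ftor G n) X)))"
          unfolding nat_trans_def
        proof (intro conjI ballI allI)
          show "is_functor A B (q \<circ>\<^sub>F pow_ftor G n)" "is_functor A B ?S"
            using add[of n] Sadd by (simp_all add: additive_functor_def)
          show "far q (lam (fob (pow_ftor G n) X)) \<in> Hom B (fob ?S X) (fob (q \<circ>\<^sub>F pow_ftor G n) X)"
            if "X \<in> Ob A" for X using gX[OF that] by (simp add: Hom_def)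
          fix X Y f assume "f \<in> Hom A X Y"
          then have f: "f \<in> Arr A" "Dom A f = X" "Cod A f = Y" "X \<in> Ob A" "Y \<in> Ob A" by (auto simp: Hom_def)
          show "far q (lam (fob (pow_ftor G n) Y)) \<cdot> far ?S f =
              far (q \<circ>\<^sub>F pow_ftor G n) f \<cdot> far q (lam (fob (pow_ftor G n) X))"
            using arg_cong[OF counit_nat[of "far (pow_ftor G n) f"], of "far q"] f gX by simp
        qed
        show "short_exact B (far q (u (fob (pow_ftor G n) (Q k)))) (far q (lam (fob (pow_ftor G n) (Q k))))" for k
          using rel_proj_G(2)[OF G_pow_rel_proj[OF Proj_rel_proj[OF proj]]] .
      qed
    qed
    moreover have "q \<circ>\<^sub>F pow_ftor G 0 = q" by (simp add: comp_ftor_def id_ftor_def)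
    ultimately show ?thesis by (simp only:)
  qed
  fix P assume P: "P \<in> Proj B"
  have P': "P \<in> Ob B" "fob i P \<in> Ob A" using B.Proj_ob[OF P] by simp_all
  have "hom_exact A Q d (fob (pow_ftor G 0) (fob i P))"
  proof (rule nat_descend[where P = "\<lambda>n. hom_exact A Q d (fob (pow_ftor G n) (fob i P))"])
    show "hom_exact A Q d (fob (pow_ftor G s) (fob i P))"
      by (rule A.hom_exact_zero[OF ec G_pow_zero[OF p1 s P'(2)]])
    fix n assume IH: "hom_exact A Q d (fob (pow_ftor G (Suc n)) (fob i P))"
    interpret Gn: additive_ftr A A "pow_ftor G n" by unfold_locales (rule G_pow_additive)
    interpret Fn: ftr B B "pow_ftor F n" by unfold_locales (rule F_pow_functor)
    obtain \<psi> where \<psi>: "nat_iso A B (e \<circ>\<^sub>F pow_ftor G n) (pow_ftor F n \<circ>\<^sub>F e) \<psi>"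
      using eG_pow_iso[OF p1] by blast
    note \<psi>a = nat_trans_arr[OF nat_iso_nat_trans[OF \<psi>], simplified, OF P'(2)]
    let ?N = "fob (pow_ftor G n) (fob i P)"
    have N: "?N \<in> Ob A" using P' by simp
    let ?h = "far (pow_ftor F n) (\<rho> P) \<cdot> \<psi> (fob i P)"
    have h: "is_iso_arr B ?h"
      by (rule B.iso_cmp[OF nat_iso_iso[OF \<psi> P'(2)] Fn.far_iso[OF \<rho>_inverse(8)[OF P'(1)]]])
        (use \<psi>a P' in simp)
    have ht: "Dom B ?h = fob e ?N" "Cod B ?h = fob (pow_ftor F n) P" using \<psi>a P' by simp_all
    note hi = B.iso_inverse[OF h]
    have li: "is_iso_arr A (far l (inv_arr B ?h))" "Dom A (far l (inv_arr B ?h)) = fob l (fob (pow_ftor F n) P)"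
      "Cod A (far l (inv_arr B ?h)) = fob l (fob e ?N)"
      using L.far_iso[OF B.iso_inv_iso[OF h]] hi(2-4) ht by simp_all
    have "hom_exact A Q d (fob l (fob (pow_ftor F n) P))"
    proof (cases n)
      case 0
      then show ?thesis using A.complete_resolutionD(3)[OF cr l_Proj[OF P]] by simp
    next
      case (Suc m)
      show ?thesis by (rule lF[OF _ P]) (simp add: Suc)
    qed
    then have M: "hom_exact A Q d (fob l (fob e ?N))"
      by (rule A.hom_exact_iso[OF ec _ li])
    have "hom_exact A Q d (Cod A (lam ?N))"
      by (rule A.hom_exact_two_of_three[OF ec proj u_kernel[OF N] lam_epi[OF N]]) (use IH M N in simp_all)
    then show "hom_exact A Q d ?N" using N by simp
  qed
  then show "hom_exact A Q d (fob i P)" by simp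
qed

section \<open>Gorenstein projective objects satisfy condition (2)\<close>

lemma q_complete_resolution:
  assumes c: "compatible_C2i B A i q" and cr: "complete_resolution A Q d"
  shows "complete_resolution B (fob q \<circ> Q) (far q \<circ> d)"
proof -
  note ec = A.complete_resolutionD(1)[OF cr] and proj = A.complete_resolutionD(2)[OF cr]
  note dn = A.exact_complexD[OF ec]
  have eB: "exact_complex B (fob q \<circ> Q) (far q \<circ> d)"
    using c cr by (auto simp: compatible_C2i_def exact_image_def)
  have "hom_exact B (fob q \<circ> Q) (far q \<circ> d) P" if P: "P \<in> Proj B" for P
  proof (rule B.hom_exactI[OF eB B.Proj_ob[OF P]])
    have hA: "hom_exact A Q d (fob i P)" using c cr P by (auto simp: compatible_C2i_def)
    have P': "P \<in> Ob B" using B.Proj_ob[OF P] .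
    fix f n assume "f \<in> Arr B" "Dom B f = (fob q \<circ> Q) n" "Cod B f = P"
      "f \<cdot> (far q \<circ> d) (n - 1) = Zro B ((fob q \<circ> Q) (n - 1)) P"
    then have f: "f \<in> Arr B" "Dom B f = fob q (Q n)" "Cod B f = P"
      "f \<cdot> far q (d (n - 1)) = Zro B (fob q (Q (n - 1))) P" by simp_all
    note d0 = dn(1-4)[of "n - 1", simplified] and d1 = dn(1-4)[of n]
    let ?f = "far i f \<cdot>\<^bsub>A\<^esub> \<theta> (Q n)"
    have ft: "?f \<in> Arr A" "Dom A ?f = Q n" "Cod A ?f = fob i P" using f d1 by simp_all
    have "?f \<cdot>\<^bsub>A\<^esub> d (n - 1) = far i (f \<cdot> far q (d (n - 1))) \<cdot>\<^bsub>A\<^esub> \<theta> (Q (n - 1))"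
      using q.unit_nat[of "d (n - 1)"] f(1-3) d0 d1 by simp
    also have "\<dots> = Zro A (Q (n - 1)) (fob i P)"
      unfolding f(4) using d0 P' by simp
    finally obtain g where g: "g \<in> Arr A" "Dom A g = Q (n + 1)" "Cod A g = fob i P" "g \<cdot>\<^bsub>A\<^esub> d n = ?f"
      using A.hom_exactD[OF hA ft] by blast
    let ?g = "\<tau> P \<cdot> far q g"
    have "?g \<cdot> far q (d n) = \<tau> P \<cdot> far q (g \<cdot>\<^bsub>A\<^esub> d n)"
      using g(1-3) d1 P' by simp
    also have "\<dots> = f"
      unfolding g(4) using q.transpose_transpose[OF f(1) d1(4) f(2)] f(3) by simp
    finally show "\<exists>g. g \<in> Arr B \<and> Dom B g = (fob q \<circ> Q) (n + 1) \<and> Cod B g = P \<and> g \<cdot> (far q \<circ> d) n = f"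
      using g(1-3) P' by (intro exI[of _ ?g]) simp
  qed
  moreover have "fob q (Q n) \<in> Proj B" for n using q.L_Proj[OF proj i_epi] .
  ultimately show ?thesis using eB by (simp add: complete_resolution_def)
qed

text \<open>For a lift \<open>t : Q 0 \<rightarrow> l e X\<close> of the cover of \<open>X\<close>, an element of the kernel of \<open>q(u)\<close> comes from
  \<open>q(Q (-1))\<close>, by right exactness applied to the mapping cone.  It is a cycle there, hence a boundary
  because the complex \<open>q(Q)\<close> is exact, and boundaries have zero image in \<open>q(G X)\<close>.\<close>

lemma Gorenstein_q:
  assumes c: "compatible_C2i B A i q" and X: "Gorenstein_projective A X"
  shows "Gorenstein_projective B (fob q X)" "is_mono B (far q (u X))"
proof -
  obtain Q d p m where cr: "complete_resolution A Q d" and im: "is_image A (d 0) p m" "Cod A p = X"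
    using X unfolding Gorenstein_projective_def by blast
  note ec = A.complete_resolutionD(1)[OF cr] and proj = A.complete_resolutionD(2)[OF cr]
  note dn = A.exact_complexD[OF ec]
  note pm = A.image_arr[OF im(1)]
  have rB: "complete_resolution B (fob q \<circ> Q) (far q \<circ> d)" using q_complete_resolution[OF c cr] .
  note dB = B.exact_complexD[OF B.complete_resolutionD(1)[OF rB], simplified]
  let ?d1 = "d (-1)" and ?d2 = "d (-2)"
  have d1: "?d1 \<in> Arr A" "Dom A ?d1 = Q (-1)" "Cod A ?d1 = Q 0" "Q (-1) \<in> Ob A" "Q 0 \<in> Ob A"
    and d2: "?d2 \<in> Arr A" "Dom A ?d2 = Q (-2)" "Cod A ?d2 = Q (-1)" "Q (-2) \<in> Ob A"
    using dn(1-4)[of "-1"] dn(1-4)[of "-2"] dn(4)[of 0] by simp_all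
  have ex10: "exact_at A ?d1 (d 0)" and ex21: "exact_at A ?d2 ?d1"
    using dn(5)[of 0] dn(5)[of "-1"] by simp_all
  have exB10: "exact_at B (far q ?d1) (far q (d 0))" and exB21: "exact_at B (far q ?d2) (far q ?d1)"
    using dB(5)[of 0] dB(5)[of "-1"] by simp_all
  have p: "p \<in> Arr A" "Dom A p = Q 0" "Cod A p = X" "is_epi A p" and Xo: "X \<in> Ob A"
    using pm(1-3,5) im(2) dn(1-3)[of 0] A.arr_ob(2)[OF pm(1)] by simp_all
  \<comment> \<open>\<open>Q (-1) \<rightarrow> Q 0 \<rightarrow> X \<rightarrow> 0\<close> is exact.\<close>
  have "m \<cdot>\<^bsub>A\<^esub> (p \<cdot>\<^bsub>A\<^esub> ?d1) = Zro A (Q (-1)) (Cod A m)"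
    using A.reassoc[OF pm(4), of ?d1] A.exact_at_arr(4)[OF ex10] pm d1 p by simp
  from A.mono_zero[OF pm(9) this] have pd: "p \<cdot>\<^bsub>A\<^esub> ?d1 = Zro A (Q (-1)) X"
    using pm d1 p im(2) by simp
  have exp: "\<exists>x. elt A x (Q (-1)) \<and> Dom A x = Dom A y \<and> ?d1 \<cdot>\<^bsub>A\<^esub> x = y"
    if "elt A y (Q 0)" "p \<cdot>\<^bsub>A\<^esub> y = Zro A (Dom A y) X" for y
  proof -
    note y' = A.elt_arr[OF that(1)]
    have "d 0 \<cdot>\<^bsub>A\<^esub> y = Zro A (Dom A y) (Cod A (d 0))"
      using A.reassoc[OF pm(4), of y] y' that(2) p pm(3,6,7) by simp
    moreover have "elt A y (Dom A (d 0))" using that(1) dn(2)[of 0] by simp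
    ultimately show ?thesis using A.exact_lift[OF ex10] d1(2) by metis
  qed
  show "Gorenstein_projective B (fob q X)"
  proof -
    have qmp: "far q m \<cdot> far q p = far q (d 0)" using q.L.far_cmp[of p m] pm by simp
    have qm: "is_mono B (far q m)"
    proof (rule B.mono_elt)
      show "far q m \<in> Arr B" using pm by simp
      fix z assume z: "elt B z (Dom B (far q m))" "far q m \<cdot> z = Zro B (Dom B z) (Cod B (far q m))"
      then have "elt B z (Cod B (far q p))" using pm by simp
      then obtain w where w: "elt B w (Dom B (far q p))" "Dom B w = Dom B z" "far q p \<cdot> w = z"
        using B.epi_lift[OF q.L_epi[OF pm(5)]] by blast
      note w' = B.elt_arr[OF w(1)] and z' = B.elt_arr[OF z(1)]
      have "far q (d 0) \<cdot> w = Zro B (Dom B w) (Cod B (far q (d 0)))"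
        using B.reassoc[OF qmp, of w] z(2) w w' pm(1-3,6-8) by simp
      moreover have "elt B w (Dom B (far q (d 0)))" using w(1) pm by simp
      ultimately obtain v where v: "elt B v (Dom B (far q ?d1))" "Dom B v = Dom B w" "far q ?d1 \<cdot> v = w"
        using B.exact_lift[OF exB10] by blast
      note v' = B.elt_arr[OF v(1)]
      have "far q p \<cdot> far q ?d1 = Zro B (fob q (Q (-1))) (fob q X)"
        using q.L.far_cmp[of ?d1 p] pd p d1 Xo by simp
      from B.reassoc[OF this, of v] have "far q p \<cdot> w = Zro B (Dom B v) (fob q X)"
        using v v' p d1 Xo by simp
      then show "z = Zro B (Dom B z) (Dom B (far q m))"
        unfolding w(3) using v(2) w(2) pm(3,6) im(2) by simp
    qed
    have "is_image B ((far q \<circ> d) 0) (far q p) (far q m)"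
      unfolding is_image_def using qm q.L_epi[OF pm(5)] qmp pm by simp
    then have "Gorenstein_projective B (Cod B (far q p))" by (rule B.Gorenstein_image[OF rB])
    then show ?thesis using p by simp
  qed
  let ?L = "fob l (fob e X)" and ?GX = "fob G X"
  obtain t where t: "t \<in> Arr A" "Dom A t = Q 0" "Cod A t = ?L" "lam X \<cdot>\<^bsub>A\<^esub> t = p"
    by (rule A.Proj_lift[OF proj[of 0] lam_epi[OF Xo] p(1,2)]) (use p Xo in auto)
  have "lam X \<cdot>\<^bsub>A\<^esub> (t \<cdot>\<^bsub>A\<^esub> ?d1) = Zro A (Q (-1)) X"
    using A.reassoc[OF t(4), of ?d1] t(1-3) d1 pd Xo by simp
  then obtain s where s: "s \<in> Arr A" "Dom A s = Q (-1)" "Cod A s = ?GX" "u X \<cdot>\<^bsub>A\<^esub> s = t \<cdot>\<^bsub>A\<^esub> ?d1"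
    by - (rule A.kernel_lift[OF u_kernel[OF Xo], of "t \<cdot>\<^bsub>A\<^esub> ?d1" "Q (-1)"]; use t(1-3) d1 Xo in simp)
  have dd: "?d1 \<cdot>\<^bsub>A\<^esub> ?d2 = Zro A (Q (-2)) (Q 0)" using A.exact_at_arr(4)[OF ex21] d1 d2 by simp
  have "u X \<cdot>\<^bsub>A\<^esub> (s \<cdot>\<^bsub>A\<^esub> ?d2) = Zro A (Q (-2)) ?L"
    using A.reassoc2[OF s(4), of ?d2] s(1-3) t(1-3) d1 d2 dd Xo by simp
  then have sd: "s \<cdot>\<^bsub>A\<^esub> ?d2 = Zro A (Q (-2)) ?GX"
    by - (rule A.mono_zero[OF u_mono[OF Xo]]; use s(1-3) d2 Xo in simp)
  have dp: "exact_at A ?d1 p"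
    by (rule A.exact_elt) (use d1 p pd exp in \<open>auto simp: elt_def\<close>)
  have ty: "Dom A t = Dom A p" "Cod A t = Dom A (lam X)" "Dom A s = Dom A ?d1" "Cod A s = Dom A (u X)"
    "Cod A p = Cod A (lam X)" using p t s d1 Xo by simp_all
  from A.mapping_cone_exact[OF u_lam_short_exact[OF Xo] dp p(4) ty(5) t(1) ty(1,2) t(4) s(1) ty(3,4) s(4)]
  obtain S r1 r2 i1 b c where r: "r1 \<in> Arr A" "Dom A r1 = S" "Cod A r1 = ?GX"
    "r2 \<in> Arr A" "Dom A r2 = S" "Cod A r2 = Q 0"
    "i1 \<in> Arr A" "Dom A i1 = ?GX" "Cod A i1 = S"
    "r1 \<cdot>\<^bsub>A\<^esub> i1 = Idt A ?GX" "r2 \<cdot>\<^bsub>A\<^esub> i1 = Zro A ?GX (Q 0)"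
    and b: "b \<in> Arr A" "Dom A b = Q (-1)" "Cod A b = S" "r1 \<cdot>\<^bsub>A\<^esub> b = Neg A s" "r2 \<cdot>\<^bsub>A\<^esub> b = ?d1"
    and c: "c \<in> Arr A" "Dom A c = S" "Cod A c = ?L" and ci: "c \<cdot>\<^bsub>A\<^esub> i1 = u X"
    and exb: "exact_at A b c" and cepi: "is_epi A c"
    unfolding u_arr[OF Xo] counit_arr[OF Xo] p(2) d1(2) by blast
  have S: "S \<in> Ob A" using r by auto
  have exqb: "exact_at B (far q b) (far q c)" using q.L_right_exact(1)[OF exb cepi] .
  show "is_mono B (far q (u X))"
  proof (rule B.mono_elt)
    show "far q (u X) \<in> Arr B" using Xo by simp
    fix w assume "elt B w (Dom B (far q (u X)))" "far q (u X) \<cdot> w = Zro B (Dom B w) (Cod B (far q (u X)))"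
    then have w: "elt B w (fob q ?GX)" "far q (u X) \<cdot> w = Zro B (Dom B w) (fob q ?L)" using Xo by simp_all
    note w' = B.elt_arr[OF w(1)]
    have qci: "far q c \<cdot> far q i1 = far q (u X)" using q.L.far_cmp[of i1 c] c r(7-9) ci by simp
    have q1: "far q r1 \<cdot> far q i1 = Idt B (fob q ?GX)" using q.L.far_cmp[of i1 r1] r Xo by simp
    have q2: "far q r2 \<cdot> far q i1 = Zro B (fob q ?GX) (fob q (Q 0))" using q.L.far_cmp[of i1 r2] r Xo d1(5) by simp
    have b1: "far q r1 \<cdot> far q b = Neg B (far q s)" using q.L.far_cmp[of b r1] b r(1-3) s(1) by simp
    have b2: "far q r2 \<cdot> far q b = far q ?d1" using q.L.far_cmp[of b r2] b r(4-6) by simp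
    have sd': "far q s \<cdot> far q ?d2 = Zro B (fob q (Q (-2))) (fob q ?GX)"
      using q.L.far_cmp[of ?d2 s] sd s(1-3) d2 Xo by simp
    let ?w = "far q i1 \<cdot> w"
    have wt: "elt B ?w (fob q S)" "Dom B ?w = Dom B w" using w' r(7-9) by (simp_all add: elt_def)
    have "far q c \<cdot> ?w = Zro B (Dom B ?w) (Cod B (far q c))"
      using B.reassoc[OF qci, of w] w(2) w' c r(7-9) by simp
    moreover have "elt B ?w (Dom B (far q c))" using wt c by simp
    ultimately obtain x where x: "elt B x (Dom B (far q b))" "Dom B x = Dom B ?w" "far q b \<cdot> x = ?w"
      using B.exact_lift[OF exqb] by blast
    note x' = B.elt_arr[OF x(1)]
    have xt: "x \<in> Arr B" "Dom B x = Dom B w" "Cod B x = fob q (Q (-1))" using x' x(2) wt b by simp_all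
    have "far q ?d1 \<cdot> x = far q r2 \<cdot> ?w"
      unfolding x(3)[symmetric] using B.reassoc[OF b2, of x] xt b(1-3) r(4-6) by simp
    also have "\<dots> = Zro B (Dom B x) (Cod B (far q ?d1))"
      using B.reassoc[OF q2, of w] w' r(4-9) d1 Xo xt by simp
    finally obtain v where v: "elt B v (Dom B (far q ?d2))" "Dom B v = Dom B x" "far q ?d2 \<cdot> v = x"
      using B.exact_lift[OF exB21, of x] x(1) b d1 by auto
    note v' = B.elt_arr[OF v(1)]
    have "far q s \<cdot> x = Zro B (Dom B w) (fob q ?GX)"
      unfolding v(3)[symmetric] using B.reassoc[OF sd', of v] v' v(2) xt s(1-3) d2 Xo by simp
    then have "Neg B (far q s \<cdot> x) = Zro B (Dom B w) (fob q ?GX)"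
      using B.add_zero_neg[of "Zro B (Dom B w) (fob q ?GX)" "Zro B (Dom B w) (fob q ?GX)"] w' Xo by simp
    moreover have "w = far q r1 \<cdot> ?w" using B.reassoc[OF q1, of w] w' r(1-3,7-9) by simp
    moreover have "far q r1 \<cdot> ?w = Neg B (far q s \<cdot> x)"
      unfolding x(3)[symmetric] using B.reassoc[OF b1, of x] xt b(1-3) r(1-3) s(1-3) by simp
    ultimately show "w = Zro B (Dom B w) (Dom B (far q (u X)))" using Xo by simp
  qed
qed

end

section \<open>The equivalence of the conditions\<close>

theorem mainTheorem2:
  fixes B :: "('ob, 'mb) catg" and A :: "('oa, 'ma) catg"
    and e q :: "('oa, 'ma, 'ob, 'mb) ftor"
    and i l :: "('ob, 'mb, 'oa, 'ma) ftor"
    and G :: "('oa, 'ma, 'oa, 'ma) ftor"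
    and \<sigma> \<rho> \<nu>' \<kappa> \<tau> :: "'ob \<Rightarrow> 'mb"
    and lam u \<theta> :: "'oa \<Rightarrow> 'ma"
    and \<phi>1 \<phi>2 :: "'oa \<Rightarrow> 'mb"
    and X :: 'oa
  assumes "cleft_extension B A e i l \<sigma> lam \<rho>"
    and "enough_projectives B" and "enough_projectives A"
    and "adjunction A B q i \<theta> \<tau>"
    and "kernel_of_counit A e l lam G u"
    and "natural_retraction B (cleft_F e i G) (e \<circ>\<^sub>F l) (cleft_nu B e i l \<rho> u) \<nu>'"
    and "identifications B A e i l G q \<kappa> \<phi>1 \<phi>2"
    and "compatible B A e i l G q"
    and "X \<in> Ob A"
  defines "cond1 \<equiv> Gorenstein_projective A X"
    and "cond2 \<equiv> Gorenstein_projective B (fob q X) \<and> is_mono B (far q (u X))"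
    and "cond3 \<equiv> Gorenstein_projective B (fob q X) \<and>
      exact_at B (alpha B e lam G u q \<kappa> \<phi>1 \<phi>2 X) (beta B e lam G u q \<kappa> \<phi>1 X)"
    and "eta_zero \<equiv> \<forall>Y \<in> Ob B. cleft_eta B e i l lam \<rho> G u \<nu>' Y =
      Zro B (fob (pow_ftor (cleft_F e i G) 2) Y) (fob (cleft_F e i G) Y)"
  shows "(cond1 \<longrightarrow> cond2) \<and> (cond2 \<longleftrightarrow> cond3) \<and>
    (eta_zero \<longrightarrow> (cond1 \<longleftrightarrow> cond2) \<and> (cond2 \<longleftrightarrow> cond3))"
proof -
  interpret ce: cleft_extension B A e i l \<sigma> lam \<rho> by fact
  interpret B: abelian_cat_ep B
    using ce.abelian_B assms(2) by (simp add: abelian_cat_ep_def abelian_cat_ep_axioms_def)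
  interpret A: abelian_cat_ep A
    using ce.abelian_A assms(3) by (simp add: abelian_cat_ep_def abelian_cat_ep_axioms_def)
  interpret cleft B A e l \<sigma> lam i \<rho> G u \<nu>' q \<theta> \<tau>
    by unfold_locales
      (use ce.functor_i ce.faithful_e ce.exact_e ce.adjunction_l_e ce.iso_e_i assms(4-6)
        in \<open>simp_all add: exact_functor_def\<close>)
  have "compatible_C2i B A i q"
    using assms(8) compatible_C2ii_imp_C2i[OF assms(7)] unfolding compatible_def by blast
  then have 12: "cond1 \<longrightarrow> cond2"
    using Gorenstein_q unfolding cond1_def cond2_def by blast
  have 23: "cond2 \<longleftrightarrow> cond3"
    using alpha_beta_exact_iff_mono[OF assms(7,9)] unfolding cond2_def cond3_def by blast
  have 21: cond1 if eta: eta_zero and c2: cond2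
  proof -
    interpret square_zero_cleft B A e l \<sigma> lam i \<rho> G u \<nu>' q \<theta> \<tau>
      by unfold_locales (use eta_zero_square_zero eta in \<open>simp add: eta_zero_def\<close>)
    obtain j where "extension_structure X (fob q X) j (quot X)"
      using mono_imp_structure[OF assms(9)] c2 unfolding cond2_def by blast
    then show cond1
      using Gorenstein_of_structure c2 assms(8) unfolding cond1_def cond2_def compatible_def by blast
  qed
  show ?thesis using 12 23 21 by blast
qed

end
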